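(* Let $G\subset\mathbb{R}^d$ be a two-digit tile with dilation matrix $M$, $|\det M|=2$, let $n\ge 0$, and let $\varphi=B_n^G$ be the corresponding tile B-spline. Let $\varphi_1$ be its orthogonalization, and let $c_k$, $k\in\mathbb{Z}^d$, be the coefficients of the refinement equation of $\varphi_1$. Then: 1) There is a wavelet function $\psi$ corresponding to $\varphi_1$ which is a linear combination of (integer shifts of) the $M$-dilation of $\varphi_1$ with coefficients $\pm c_k$, i.e. $\psi(x)=\sum_{k\in\mathbb{Z}^d}\epsilon_k c_k\varphi_1(Mx-w_k)$ with $\epsilon_k\in\{1,-1\}$ and pairwise distinct $w_k\in\mathbb{Z}^d$. 2) For $d=2$, $D=\{(0,0)^T,(1,0)^T\}$ and the matrices below, the following functions are wavelet functions corresponding to $\varphi_1$ (with $k=(k_1,k_2)^T$): a) if $M=M_B=\begin{pmatrix}1&-2\\1&0\end{pmatrix}$ (Bear), $\ \psi_B(x)=\sum_{k\in\mathbb{Z}^2}c_k(-1)^{k_2-k_1}\varphi_1\left(M_Bx+k-\begin{pmatrix}0\\1\end{pmatrix}\right)$; b) if $M=M_S=\begin{pmatrix}0&-2\\1&0\end{pmatrix}$ (Square), $\ \psi_S(x)=\sum_{k\in\mathbb{Z}^2}c_k(-1)^{k_1}\varphi_1\left(M_Sx+k-\begin{pmatrix}1\\0\end{pmatrix}\right)$; c) if $M=M_D=\begin{pmatrix}1&1\\-1&1\end{pmatrix}$ (Dragon), $\ \psi_D(x)=\sum_{k\in\mathbb{Z}^2}c_k(-1)^{k_2-k_1}\varp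hi_1\left(M_Dx+k-\begin{pmatrix}0\\1\end{pmatrix}\right)$.
   Context: Let $M\in\mathbb{Z}^{d\times d}$ be expanding (all eigenvalues larger than $1$ in modulus), $m=|\det M|$, and $D\ni0$ a set of representatives of $\mathbb{Z}^d/M\mathbb{Z}^d$. $G=\{\sum_{k\ge1}M^{-k}\Delta_k:\Delta_k\in D\}$ is a tile if its Lebesgue measure is $1$; it is a two-digit tile (2-tile) if $m=2$, so $D=\{0,e\}$. $B_n^G$ is the convolution of $n+1$ copies of $\chi_G$. Fourier transform: $\widehat f(\xi)=\int f(x)e^{-2\pi i(x,\xi)}dx$. The orthogonalization $\varphi_1\in L_2(\mathbb{R}^d)$ of $\varphi$ is defined by $\widehat\varphi_1(\xi)=\widehat\varphi(\xi)\big/\sqrt{\sum_{k\in\mathbb{Z}^d}|\widehat\varphi(\xi+k)|^2}$; its integer shifts are orthonormal. It satisfies a refinement equation $\varphi_1(x)=\sum_{k\in\mathbb{Z}^d}c_k\varphi_1(Mx-k)$ (in general with infinitely many nonzero $c_k$), which defines the numbers $c_k$. Let $V_0$ be the closed linear span in $L_2(\mathbb{R}^d)$ of $\{\varphi_1(\cdot-k)\}_{k\in\mathbb{Z}^d}$ and $V_1=\{f(M\cdot):f\in V_0\}\supset V_0$. A wavelet function corresponding to $\varphi_1$ (in the case $m=2$) is a function $\psi\in V_1$ whose integer shifts $\{\psi(\cdot-k)\}_{k\in\mathbb{Z}^d}$ form an orthonormal basis of $V_1\ominus V_0$. Infinite sums converge in $L_2$. *)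

theory Defs
  imports "HOL-Analysis.Analysis"
begin

section \<open>Two-digit tiles\<close>

definition rvec :: "int^'d \<Rightarrow> real^'d" where
  "rvec k = (\<chi> i. real_of_int (k $ i))"

definition rmat :: "int^'d^'d \<Rightarrow> real^'d^'d" where
  "rmat M = map_matrix real_of_int M"

definition expanding :: "int^'d^'d \<Rightarrow> bool" where
  "expanding M \<longleftrightarrow>
     (\<forall>(\<mu>::complex) v. v \<noteq> 0 \<and> map_matrix of_int M *v v = \<mu> *s v \<longrightarrow> cmod \<mu> > 1)"

definition digit_set :: "int^'d^'d \<Rightarrow> (int^'d) set \<Rightarrow> bool" where
  "digit_set M D \<longleftrightarrow> 0 \<in> D \<and> (\<forall>k. \<exists>!r. r \<in> D \<and> (\<exists>l. k - r = M *v l))"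

text \<open>The sequence below is indexed from \<open>0\<close>, hence the exponent \<open>Suc k\<close>; powers of the inverse
  matrix are iterates of its action, since \<open>^\<close> is the componentwise power on this type.\<close>

definition tile_set :: "int^'d^'d \<Rightarrow> (int^'d) set \<Rightarrow> (real^'d) set" where
  "tile_set M D = {x. \<exists>\<Delta>::nat \<Rightarrow> int^'d. (\<forall>k. \<Delta> k \<in> D) \<and>
     (\<lambda>k. (((*v) (matrix_inv (rmat M))) ^^ Suc k) (rvec (\<Delta> k))) sums x}"

definition two_digit_tile :: "int^'d^'d \<Rightarrow> (int^'d) set \<Rightarrow> bool" where
  "two_digit_tile M D \<longleftrightarrow> expanding M \<and> \<bar>det M\<bar> = 2 \<and> digit_set M D \<and>
     measure lebesgue (tile_set M D) = 1"


section \<open>Tile B-splines\<close>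

definition convol :: "(real^'d \<Rightarrow> complex) \<Rightarrow> (real^'d \<Rightarrow> complex) \<Rightarrow> real^'d \<Rightarrow> complex" where
  "convol f g x = (LINT y|lborel. f y * g (x - y))"

fun tile_bspline :: "(real^'d) set \<Rightarrow> nat \<Rightarrow> real^'d \<Rightarrow> complex" where
  "tile_bspline G 0 = indicator G"
| "tile_bspline G (Suc n) = convol (tile_bspline G n) (indicator G)"


section \<open>Square-integrable functions\<close>

text \<open>Elements of \<open>L\<^sub>2\<close> are represented by Borel functions; the notions below are not affected
  by Borel changes on null sets.\<close>

definition L2 :: "(real^'d \<Rightarrow> complex) set" where
  "L2 = {f \<in> borel_measurable lborel. integrable lborel (\<lambda>x. (cmod (f x))\<^sup>2)}"

definition l2_inner :: "(real^'d \<Rightarrow> complex) \<Rightarrow> (real^'d \<Rightarrow> complex) \<Rightarrow> complex" where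
  "l2_inner f g = (LINT x|lborel. f x * cnj (g x))"

definition l2_norm :: "(real^'d \<Rightarrow> complex) \<Rightarrow> real" where
  "l2_norm f = sqrt (LINT x|lborel. (cmod (f x))\<^sup>2)"

definition l2_tendsto ::
  "('i \<Rightarrow> real^'d \<Rightarrow> complex) \<Rightarrow> (real^'d \<Rightarrow> complex) \<Rightarrow> 'i filter \<Rightarrow> bool" where
  "l2_tendsto s f F \<longleftrightarrow> (\<forall>i. s i \<in> L2) \<and> f \<in> L2 \<and>
     ((\<lambda>i. l2_norm (\<lambda>x. s i x - f x)) \<longlongrightarrow> 0) F"

definition has_l2_sum ::
  "('i \<Rightarrow> real^'d \<Rightarrow> complex) \<Rightarrow> (real^'d \<Rightarrow> complex) \<Rightarrow> bool" where
  "has_l2_sum b f \<longleftrightarrow> l2_tendsto (\<lambda>A x. \<Sum>i\<in>A. b i x) f (finite_subsets_at_top UNIV)"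

definition closed_span :: "('i \<Rightarrow> real^'d \<Rightarrow> complex) \<Rightarrow> (real^'d \<Rightarrow> complex) set" where
  "closed_span b = {f \<in> L2. \<forall>\<epsilon>>0. \<exists>A a. finite A \<and>
     l2_norm (\<lambda>x. f x - (\<Sum>i\<in>A. a i * b i x)) < \<epsilon>}"

definition orthonormal_basis ::
  "('i \<Rightarrow> real^'d \<Rightarrow> complex) \<Rightarrow> (real^'d \<Rightarrow> complex) set \<Rightarrow> bool" where
  "orthonormal_basis b W \<longleftrightarrow> (\<forall>i. b i \<in> W) \<and>
     (\<forall>i j. l2_inner (b i) (b j) = (if i = j then 1 else 0)) \<and> closed_span b = W"


section \<open>Fourier transform and orthogonalization\<close>

definition fourier :: "(real^'d \<Rightarrow> complex) \<Rightarrow> real^'d \<Rightarrow> complex" where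
  "fourier f \<xi> = (LINT x|lborel. f x * cis (- 2 * pi * (x \<bullet> \<xi>)))"

text \<open>The Fourier transform on \<open>L\<^sub>2\<close> is the continuous extension of the integral from
  \<open>L\<^sub>1 \<inter> L\<^sub>2\<close>. It is given as a relation because \<open>g\<close> is only determined almost everywhere.\<close>

definition is_fourier_l2 :: "(real^'d \<Rightarrow> complex) \<Rightarrow> (real^'d \<Rightarrow> complex) \<Rightarrow> bool" where
  "is_fourier_l2 f g \<longleftrightarrow> (\<exists>s::nat \<Rightarrow> real^'d \<Rightarrow> complex. (\<forall>n. integrable lborel (s n)) \<and>
     l2_tendsto s f sequentially \<and> l2_tendsto (\<lambda>n. fourier (s n)) g sequentially)"

definition is_orthogonalization :: "(real^'d \<Rightarrow> complex) \<Rightarrow> (real^'d \<Rightarrow> complex) \<Rightarrow> bool" where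
  "is_orthogonalization \<phi> \<phi>1 \<longleftrightarrow> is_fourier_l2 \<phi>1
     (\<lambda>\<xi>. fourier \<phi> \<xi> / complex_of_real (sqrt (\<Sum>\<^sub>\<infinity>k. (cmod (fourier \<phi> (\<xi> + rvec k)))\<^sup>2)))"


section \<open>Refinement equation and wavelet functions\<close>

definition refinement_coeffs ::
  "int^'d^'d \<Rightarrow> (real^'d \<Rightarrow> complex) \<Rightarrow> (int^'d \<Rightarrow> complex) \<Rightarrow> bool" where
  "refinement_coeffs M \<phi>1 c \<longleftrightarrow> has_l2_sum (\<lambda>k x. c k * \<phi>1 (rmat M *v x - rvec k)) \<phi>1"

definition shifts :: "(real^'d \<Rightarrow> complex) \<Rightarrow> int^'d \<Rightarrow> real^'d \<Rightarrow> complex" where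
  "shifts f k x = f (x - rvec k)"

definition V0 :: "(real^'d \<Rightarrow> complex) \<Rightarrow> (real^'d \<Rightarrow> complex) set" where
  "V0 \<phi>1 = closed_span (shifts \<phi>1)"

definition V1 :: "int^'d^'d \<Rightarrow> (real^'d \<Rightarrow> complex) \<Rightarrow> (real^'d \<Rightarrow> complex) set" where
  "V1 M \<phi>1 = {(\<lambda>x. f (rmat M *v x)) | f. f \<in> V0 \<phi>1}"

definition is_wavelet ::
  "int^'d^'d \<Rightarrow> (real^'d \<Rightarrow> complex) \<Rightarrow> (real^'d \<Rightarrow> complex) \<Rightarrow> bool" where
  "is_wavelet M \<phi>1 \<psi> \<longleftrightarrow> \<psi> \<in> V1 M \<phi>1 \<and>
     orthonormal_basis (shifts \<psi>) {f \<in> V1 M \<phi>1. \<forall>g \<in> V0 \<phi>1. l2_inner f g = 0}"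


section \<open>The planar matrices\<close>

definition bear :: "int^2^2" where
  "bear = vector [vector [1, -2], vector [1, 0]]"

definition square :: "int^2^2" where
  "square = vector [vector [0, -2], vector [1, 0]]"

definition dragon :: "int^2^2" where
  "dragon = vector [vector [1, 1], vector [-1, 1]]"

end

theory Submission
  imports Defs "HOL-Probability.Characteristic_Functions"
    "HOL-Computational_Algebra.Fundamental_Theorem_Algebra"
begin

text \<open>The image \<open>M \<int>\<^sup>d\<close> has index two, so \<open>\<int>\<^sup>d\<close> carries a character \<open>\<sigma>\<close> with values \<open>\<plusminus>1\<close> and this
  kernel. For \<open>w0\<close> outside the kernel put \<open>\<psi>(x) = \<Sum>\<^sub>k \<sigma>(k) c\<^sub>k \<phi>\<^sub>1(Mx - (w0 - k))\<close>. The coefficients \<open>c\<^sub>k\<close>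
  are real; the reflection \<open>k \<mapsto> w0 - k\<close> swaps the two cosets, which makes \<open>\<psi>(\<cdot> - k)\<close> orthogonal to
  \<open>\<phi>\<^sub>1(\<cdot> - l)\<close> because the sum of products cancels against itself. The shifts of \<open>\<phi>\<^sub>1\<close> and \<open>\<psi>\<close> together
  span \<open>V\<^sub>1\<close>: the squared coefficients of each \<open>\<phi>\<^sub>1(M\<cdot> - j)\<close> along them run through \<open>|c\<^sub>k|\<^sup>2 / 4\<close> once on
  each coset, hence add up to its squared norm.

  The analytic input is that the shifts of \<open>\<phi>\<^sub>1\<close> are orthonormal and \<open>\<phi>\<^sub>1\<close> is real. By Plancherel both
  are statements about the transform of \<open>\<phi>\<^sub>1\<close>, which is well behaved because the transform of the tile
  is a product of masks \<open>(1 + exp(-2\<pi>i(e, \<cdot>))) / 2\<close> and so vanishes almost nowhere.\<close>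

section \<open>The space of square-integrable functions\<close>

text \<open>The coefficients of \<psi> imitate the one-dimensional rule (-1)^(1-k) c_(1-k): parity
  becomes the character \<sigma>, and 1 becomes any \<open>w0\<close> with
  \<open>\<sigma> w0 = -1\<close>. Pairing the series of \<psi> with that of \<open>\<phi>1\<close>
  puts conjugates on one factor only; the reflected products agree up to sign because the
  coefficients are real, hence the detour to prove \<open>\<phi>1\<close> real.
  \<open>is_fourier_l2\<close> determines a transform through limits and up to null sets, so nothing
  about \<open>\<phi>1\<close> is available pointwise. Inner products pass to limits: orthonormality
  is read off modulated transforms, reality off the norm of
  \<open>cnj (\<phi>1 x) - \<phi>1 x\<close>. The denominator of the orthogonalization must be
  finite and nonzero almost everywhere, since a divergent \<open>infsum\<close> and a division by 0
  both return 0. Square integrability gives the former, the almost nowhere vanishing transform the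
  latter. Halves and quarters come from \<bar>det M\<bar> = 2: each
  \<open>\<phi>1 (rmat M *v x - rvec k)\<close> has squared norm 1/2, so inner products with it are
  c/2. In the plane \<sigma> is the parity of k2 - k1 (Bear, Dragon) or of k1 (Square), and
  \<open>w0\<close> is the constant vector in the stated formula.\<close>

lemma L2_iff: "f \<in> L2 \<longleftrightarrow> f \<in> borel_measurable borel \<and> integrable lborel (\<lambda>x. (cmod (f x))\<^sup>2)"
  by (auto simp: L2_def)

lemma L2_measurable [measurable_dest]: "f \<in> L2 \<Longrightarrow> f \<in> borel_measurable borel"
  by (auto simp: L2_iff)

lemma L2_integrable: "f \<in> L2 \<Longrightarrow> integrable lborel (\<lambda>x. (cmod (f x))\<^sup>2)"
  by (auto simp: L2_iff)

lemma L2_dominated: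
  assumes "f \<in> L2" "g \<in> borel_measurable borel" "\<And>x. cmod (g x) \<le> C * cmod (f x)"
  shows "g \<in> L2"
  unfolding L2_iff
proof
  show "integrable lborel (\<lambda>x. (cmod (g x))\<^sup>2)"
  proof (rule Bochner_Integration.integrable_bound)
    show "integrable lborel (\<lambda>x. C\<^sup>2 * (cmod (f x))\<^sup>2)"
      using assms L2_integrable by auto
    show "AE x in lborel. norm ((cmod (g x))\<^sup>2) \<le> norm (C\<^sup>2 * (cmod (f x))\<^sup>2)"
      using assms(3) by (auto simp flip: power_mult_distrib intro!: power_mono)
  qed (use assms in auto)
qed (use assms in auto)

lemma L2_zero [simp]: "(\<lambda>x. 0) \<in> L2"
  by (simp add: L2_iff)

lemma L2_scale: "f \<in> L2 \<Longrightarrow> (\<lambda>x. a * f x) \<in> L2"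
  by (rule L2_dominated[of f _ "cmod a"]) (auto simp: norm_mult L2_iff)

lemma norm_add_power2_le:
  fixes a b :: "'a::real_normed_vector"
  shows "(norm (a + b))\<^sup>2 \<le> 2 * (norm a)\<^sup>2 + 2 * (norm b)\<^sup>2"
proof -
  have "(norm (a + b))\<^sup>2 \<le> (norm a + norm b)\<^sup>2"
    by (intro power_mono norm_triangle_ineq) auto
  also have "\<dots> \<le> 2 * (norm a)\<^sup>2 + 2 * (norm b)\<^sup>2"
    using sum_squares_bound[of "norm a" "norm b"] by (simp add: power2_sum)
  finally show ?thesis .
qed

lemma L2_add:
  assumes "f \<in> L2" "g \<in> L2"
  shows "(\<lambda>x. f x + g x) \<in> L2"
  unfolding L2_iff
proof
  show "integrable lborel (\<lambda>x. (cmod (f x + g x))\<^sup>2)"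
  proof (rule Bochner_Integration.integrable_bound)
    show "integrable lborel (\<lambda>x. 2 * (cmod (f x))\<^sup>2 + 2 * (cmod (g x))\<^sup>2)"
      using assms by (intro Bochner_Integration.integrable_add integrable_mult_right L2_integrable)
    show "AE x in lborel. norm ((cmod (f x + g x))\<^sup>2) \<le> norm (2 * (cmod (f x))\<^sup>2 + 2 * (cmod (g x))\<^sup>2)"
      using norm_add_power2_le by auto
  qed (use assms in \<open>auto simp: L2_iff\<close>)
qed (use assms in \<open>auto simp: L2_iff\<close>)

lemma L2_minus: "f \<in> L2 \<Longrightarrow> (\<lambda>x. - f x) \<in> L2"
  using L2_scale[of f "-1"] by simp

lemma L2_diff:
  assumes "f \<in> L2" "g \<in> L2"
  shows "(\<lambda>x. f x - g x) \<in> L2"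
  using L2_add[OF assms(1) L2_minus[OF assms(2)]] by simp

lemma L2_sum: "(\<And>i. i \<in> A \<Longrightarrow> f i \<in> L2) \<Longrightarrow> (\<lambda>x. \<Sum>i\<in>A. f i x) \<in> L2"
  by (induction A rule: infinite_finite_induct) (auto intro: L2_add)

lemma borel_measurable_cnj [measurable (raw)]:
  "f \<in> borel_measurable M \<Longrightarrow> (\<lambda>x. cnj (f x)) \<in> borel_measurable M"
  by (rule measurable_compose[OF _ borel_measurable_continuous_onI]) (auto intro: continuous_intros)

lemma L2_cnj: "f \<in> L2 \<Longrightarrow> (\<lambda>x. cnj (f x)) \<in> L2"
  by (auto simp: L2_iff)

lemma L2_inner_integrable:
  assumes "f \<in> L2" "g \<in> L2"
  shows "integrable lborel (\<lambda>x. f x * cnj (g x))"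
proof (rule Bochner_Integration.integrable_bound)
  show "integrable lborel (\<lambda>x. (cmod (f x))\<^sup>2 + (cmod (g x))\<^sup>2)"
    using assms by (intro Bochner_Integration.integrable_add L2_integrable)
  have "cmod (f x * cnj (g x)) \<le> (cmod (f x))\<^sup>2 + (cmod (g x))\<^sup>2" for x
  proof -
    have "cmod (f x * cnj (g x)) = cmod (f x) * cmod (g x)"
      by (simp add: norm_mult)
    moreover have "2 * cmod (f x) * cmod (g x) \<le> (cmod (f x))\<^sup>2 + (cmod (g x))\<^sup>2"
      by (rule sum_squares_bound)
    moreover have "0 \<le> cmod (f x) * cmod (g x)"
      by simp
    ultimately show ?thesis
      by linarith
  qed
  then show "AE x in lborel. norm (f x * cnj (g x)) \<le> norm ((cmod (f x))\<^sup>2 + (cmod (g x))\<^sup>2)"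
    by auto
qed (use assms in \<open>auto simp: L2_iff\<close>)

section \<open>Inner product and norm\<close>

lemma l2_norm_nonneg [simp]: "0 \<le> l2_norm f"
  by (simp add: l2_norm_def)

lemma l2_norm_power2: "(l2_norm f)\<^sup>2 = (LINT x|lborel. (cmod (f x))\<^sup>2)"
  by (simp add: l2_norm_def)

lemma l2_norm_zero [simp]: "l2_norm (\<lambda>x. 0) = 0"
  by (simp add: l2_norm_def)

lemma l2_inner_self: "l2_inner f f = of_real ((l2_norm f)\<^sup>2)"
  by (simp add: l2_inner_def l2_norm_power2 flip: complex_norm_square integral_complex_of_real)

lemma l2_inner_cong_AE:
  assumes "AE x in lborel. f x = f' x" "AE x in lborel. g x = g' x"
    "f \<in> borel_measurable borel" "f' \<in> borel_measurable borel"
    "g \<in> borel_measurable borel" "g' \<in> borel_measurable borel"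
  shows "l2_inner f g = l2_inner f' g'"
  unfolding l2_inner_def using assms by (intro integral_cong_AE) auto

lemma l2_norm_cong_AE:
  assumes "AE x in lborel. f x = f' x"
    "f \<in> borel_measurable borel" "f' \<in> borel_measurable borel"
  shows "l2_norm f = l2_norm f'"
  unfolding l2_norm_def using assms by (intro arg_cong[where f=sqrt] integral_cong_AE) auto

lemma l2_norm_minus_commute: "l2_norm (\<lambda>x. f x - g x) = l2_norm (\<lambda>x. g x - f x)"
  by (simp add: l2_norm_def norm_minus_commute)

lemma l2_norm_scale: "l2_norm (\<lambda>x. a * f x) = cmod a * l2_norm f"
  by (simp add: l2_norm_def norm_mult power_mult_distrib real_sqrt_mult)

lemma l2_inner_commute: "l2_inner g f = cnj (l2_inner f g)"
  unfolding l2_inner_def by (simp add: mult.commute flip: Bochner_Integration.integral_cnj)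

lemma l2_inner_add_left:
  assumes "f \<in> L2" "g \<in> L2" "h \<in> L2"
  shows "l2_inner (\<lambda>x. f x + g x) h = l2_inner f h + l2_inner g h"
  unfolding l2_inner_def
  by (simp add: distrib_right Bochner_Integration.integral_add L2_inner_integrable assms)

lemma l2_inner_scale_left: "l2_inner (\<lambda>x. a * f x) h = a * l2_inner f h"
  unfolding l2_inner_def by (simp add: mult.assoc)

lemma l2_inner_scale_right: "l2_inner h (\<lambda>x. a * f x) = cnj a * l2_inner h f"
  by (subst l2_inner_commute) (simp add: l2_inner_scale_left flip: l2_inner_commute)

lemma l2_inner_zero [simp]: "l2_inner (\<lambda>x. 0) h = 0" "l2_inner h (\<lambda>x. 0) = 0"
  by (simp_all add: l2_inner_def)

lemma l2_inner_diff_left: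
  assumes "f \<in> L2" "g \<in> L2" "h \<in> L2"
  shows "l2_inner (\<lambda>x. f x - g x) h = l2_inner f h - l2_inner g h"
  unfolding l2_inner_def
  by (simp add: left_diff_distrib Bochner_Integration.integral_diff L2_inner_integrable assms)

lemma l2_inner_add_right:
  assumes "f \<in> L2" "g \<in> L2" "h \<in> L2"
  shows "l2_inner h (\<lambda>x. f x + g x) = l2_inner h f + l2_inner h g"
  by (subst l2_inner_commute) (simp add: l2_inner_add_left assms flip: l2_inner_commute)

lemma l2_inner_diff_right:
  assumes "f \<in> L2" "g \<in> L2" "h \<in> L2"
  shows "l2_inner h (\<lambda>x. f x - g x) = l2_inner h f - l2_inner h g"
  by (subst l2_inner_commute) (simp add: l2_inner_diff_left assms flip: l2_inner_commute)

lemma l2_inner_sum_left: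
  assumes "\<And>i. i \<in> A \<Longrightarrow> f i \<in> L2" "h \<in> L2"
  shows "l2_inner (\<lambda>x. \<Sum>i\<in>A. f i x) h = (\<Sum>i\<in>A. l2_inner (f i) h)"
  using assms
  by (induction A rule: infinite_finite_induct) (auto simp: l2_inner_add_left L2_sum)

lemma l2_inner_sum_right:
  assumes "\<And>i. i \<in> A \<Longrightarrow> f i \<in> L2" "h \<in> L2"
  shows "l2_inner h (\<lambda>x. \<Sum>i\<in>A. f i x) = (\<Sum>i\<in>A. l2_inner h (f i))"
  by (subst l2_inner_commute) (simp add: l2_inner_sum_left assms flip: l2_inner_commute)

lemma l2_norm_add_power2:
  assumes "f \<in> L2" "g \<in> L2"
  shows "(l2_norm (\<lambda>x. f x + g x))\<^sup>2 = (l2_norm f)\<^sup>2 + (l2_norm g)\<^sup>2 + 2 * Re (l2_inner f g)"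
proof -
  have "complex_of_real ((l2_norm (\<lambda>x. f x + g x))\<^sup>2)
      = of_real ((l2_norm f)\<^sup>2) + of_real ((l2_norm g)\<^sup>2) + (l2_inner f g + cnj (l2_inner f g))"
    by (simp add: l2_inner_add_left l2_inner_add_right L2_add assms algebra_simps
        del: of_real_power flip: l2_inner_self l2_inner_commute)
  also have "\<dots> = of_real ((l2_norm f)\<^sup>2 + (l2_norm g)\<^sup>2 + 2 * Re (l2_inner f g))"
    by (simp add: complex_add_cnj)
  finally show ?thesis
    using of_real_eq_iff by blast
qed

text \<open>Cauchy-Schwarz from the pointwise bound ab \<le> t a^2 / 2 + b^2 / (2t), with t the
  ratio of the norms. Adding \<delta> to both norms keeps t defined when one of them vanishes; then
  \<delta> tends to 0.\<close>

lemma cmod_l2_inner_le: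
  assumes "f \<in> L2" "g \<in> L2"
  shows "cmod (l2_inner f g) \<le> l2_norm f * l2_norm g"
proof -
  define F G where "F = l2_norm f" and "G = l2_norm g"
  have F0: "0 \<le> F" and G0: "0 \<le> G"
    by (auto simp: F_def G_def)
  have *: "cmod (l2_inner f g) \<le> (F + \<delta>) * (G + \<delta>)" if "\<delta> > 0" for \<delta>
  proof -
    define t where "t = (G + \<delta>) / (F + \<delta>)"
    have t: "t > 0"
      using F0 G0 that by (simp add: t_def)
    have "cmod (l2_inner f g) \<le> (LINT x|lborel. cmod (f x * cnj (g x)))"
      unfolding l2_inner_def by (rule integral_norm_bound)
    also have "\<dots> \<le> (LINT x|lborel. t / 2 * (cmod (f x))\<^sup>2 + 1 / (2 * t) * (cmod (g x))\<^sup>2)"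
    proof (rule integral_mono)
      fix x
      have "2 * (sqrt t * cmod (f x)) * (cmod (g x) / sqrt t) \<le> (sqrt t * cmod (f x))\<^sup>2 + (cmod (g x) / sqrt t)\<^sup>2"
        by (rule sum_squares_bound)
      then show "cmod (f x * cnj (g x)) \<le> t / 2 * (cmod (f x))\<^sup>2 + 1 / (2 * t) * (cmod (g x))\<^sup>2"
        using t by (simp add: norm_mult power_mult_distrib power_divide field_simps)
    qed (intro integrable_norm L2_inner_integrable Bochner_Integration.integrable_add integrable_mult_right
        L2_integrable assms)+
    also have "\<dots> = t / 2 * F\<^sup>2 + 1 / (2 * t) * G\<^sup>2"
      unfolding F_def G_def l2_norm_power2
      by (subst Bochner_Integration.integral_add) (auto intro!: integrable_mult_right L2_integrable assms)
    also have "\<dots> \<le> t / 2 * (F + \<delta>)\<^sup>2 + 1 / (2 * t) * (G + \<delta>)\<^sup>2"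
      using t F0 G0 that by (intro add_mono mult_left_mono power_mono) auto
    also have "\<dots> = (F + \<delta>) * (G + \<delta>)"
    proof -
      have "F + \<delta> \<noteq> 0" "G + \<delta> \<noteq> 0"
        using F0 G0 that by auto
      then show ?thesis
        unfolding t_def by (simp add: power2_eq_square divide_simps) (simp add: algebra_simps)
    qed
    finally show ?thesis .
  qed
  have "((\<lambda>\<delta>. (F + \<delta>) * (G + \<delta>)) \<longlongrightarrow> (F + 0) * (G + 0)) (at_right 0)"
    by (intro tendsto_intros)
  moreover have "\<forall>\<^sub>F \<delta> in at_right 0. cmod (l2_inner f g) \<le> (F + \<delta>) * (G + \<delta>)"
    by (rule eventually_mono[OF eventually_at_right_less *])
  ultimately have "cmod (l2_inner f g) \<le> (F + 0) * (G + 0)"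
    by (rule tendsto_lowerbound) auto
  then show ?thesis
    by (simp add: F_def G_def)
qed

lemma l2_norm_triangle:
  assumes "f \<in> L2" "g \<in> L2"
  shows "l2_norm (\<lambda>x. f x + g x) \<le> l2_norm f + l2_norm g"
proof -
  have "Re (l2_inner f g) \<le> l2_norm f * l2_norm g"
    using cmod_l2_inner_le[OF assms] complex_Re_le_cmod order_trans by blast
  then have "(l2_norm (\<lambda>x. f x + g x))\<^sup>2 \<le> (l2_norm f + l2_norm g)\<^sup>2"
    by (simp add: l2_norm_add_power2 assms power2_sum)
  then show ?thesis
    by (rule power2_le_imp_le) auto
qed

lemma l2_norm_triangle_diff:
  assumes "f \<in> L2" "g \<in> L2" "h \<in> L2"
  shows "l2_norm (\<lambda>x. f x - h x) \<le> l2_norm (\<lambda>x. f x - g x) + l2_norm (\<lambda>x. g x - h x)"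
  using l2_norm_triangle[OF L2_diff[OF assms(1,2)] L2_diff[OF assms(2,3)]] by simp

lemma l2_norm_diff_ge:
  assumes "f \<in> L2" "g \<in> L2"
  shows "\<bar>l2_norm f - l2_norm g\<bar> \<le> l2_norm (\<lambda>x. f x - g x)"
  using l2_norm_triangle_diff[of f g "\<lambda>x. 0"] l2_norm_triangle_diff[of g f "\<lambda>x. 0"] assms
  by (simp add: l2_norm_minus_commute[of f g])

lemma l2_norm_eq_0_AE:
  assumes "f \<in> L2" "l2_norm f = 0"
  shows "AE x in lborel. f x = 0"
proof -
  have "(LINT x|lborel. (cmod (f x))\<^sup>2) = 0"
    using assms(2) by (simp flip: l2_norm_power2)
  then have "AE x in lborel. (cmod (f x))\<^sup>2 = 0"
    using L2_integrable[OF assms(1)] by (subst (asm) integral_nonneg_eq_0_iff_AE) auto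
  then show ?thesis
    by simp
qed

section \<open>Convergence in norm\<close>

lemma l2_tendsto_norm:
  assumes "l2_tendsto s f F"
  shows "((\<lambda>i. l2_norm (s i)) \<longlongrightarrow> l2_norm f) F"
proof -
  have "((\<lambda>i. l2_norm (s i) - l2_norm f) \<longlongrightarrow> 0) F"
    by (rule Lim_null_comparison[where g="\<lambda>i. l2_norm (\<lambda>x. s i x - f x)"])
      (use assms in \<open>auto simp: l2_tendsto_def intro!: always_eventually l2_norm_diff_ge\<close>)
  then show ?thesis
    by (simp add: LIM_zero_iff)
qed

lemma l2_tendsto_inner:
  assumes s: "l2_tendsto s f F" and t: "l2_tendsto t g F"
  shows "((\<lambda>i. l2_inner (s i) (t i)) \<longlongrightarrow> l2_inner f g) F"
proof -
  have sL: "\<And>i. s i \<in> L2" "f \<in> L2" and tL: "\<And>i. t i \<in> L2" "g \<in> L2"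
    using s t by (auto simp: l2_tendsto_def)
  have "cmod (l2_inner (s i) (t i) - l2_inner f g)
      \<le> l2_norm (\<lambda>x. s i x - f x) * l2_norm (t i) + l2_norm f * l2_norm (\<lambda>x. t i x - g x)" for i
  proof -
    have "l2_inner (s i) (t i) - l2_inner f g
        = l2_inner (\<lambda>x. s i x - f x) (t i) + l2_inner f (\<lambda>x. t i x - g x)"
      by (simp add: l2_inner_diff_left l2_inner_diff_right sL tL)
    also have "cmod \<dots> \<le> cmod (l2_inner (\<lambda>x. s i x - f x) (t i)) + cmod (l2_inner f (\<lambda>x. t i x - g x))"
      by (rule norm_triangle_ineq)
    also have "\<dots> \<le> l2_norm (\<lambda>x. s i x - f x) * l2_norm (t i) + l2_norm f * l2_norm (\<lambda>x. t i x - g x)"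
      by (intro add_mono cmod_l2_inner_le L2_diff sL tL)
    finally show ?thesis .
  qed
  moreover have "((\<lambda>i. l2_norm (\<lambda>x. s i x - f x) * l2_norm (t i) + l2_norm f * l2_norm (\<lambda>x. t i x - g x))
      \<longlongrightarrow> 0 * l2_norm g + l2_norm f * 0) F"
    using s t by (intro tendsto_intros l2_tendsto_norm) (auto simp: l2_tendsto_def)
  ultimately have "((\<lambda>i. l2_inner (s i) (t i) - l2_inner f g) \<longlongrightarrow> 0) F"
    by (intro Lim_null_comparison[where f="\<lambda>i. l2_inner (s i) (t i) - l2_inner f g", OF always_eventually[OF allI]])
      simp_all
  then show ?thesis
    by (simp add: LIM_zero_iff)
qed

lemma l2_tendsto_const: "f \<in> L2 \<Longrightarrow> l2_tendsto (\<lambda>_. f) f F"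
  by (simp add: l2_tendsto_def)

lemma l2_tendsto_add:
  assumes s: "l2_tendsto s f F" and t: "l2_tendsto t g F"
  shows "l2_tendsto (\<lambda>i x. s i x + t i x) (\<lambda>x. f x + g x) F"
proof -
  have sL: "\<And>i. s i \<in> L2" "f \<in> L2" and tL: "\<And>i. t i \<in> L2" "g \<in> L2"
    using s t by (auto simp: l2_tendsto_def)
  have "((\<lambda>i. l2_norm (\<lambda>x. s i x - f x) + l2_norm (\<lambda>x. t i x - g x)) \<longlongrightarrow> 0) F"
    using s t by (intro tendsto_add_zero) (auto simp: l2_tendsto_def)
  moreover have "l2_norm (\<lambda>x. s i x + t i x - (f x + g x)) \<le> l2_norm (\<lambda>x. s i x - f x) + l2_norm (\<lambda>x. t i x - g x)" for i
    using l2_norm_triangle[OF L2_diff[OF sL(1) sL(2)] L2_diff[OF tL(1) tL(2)], of i i]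
    by (simp add: algebra_simps)
  ultimately have "((\<lambda>i. l2_norm (\<lambda>x. s i x + t i x - (f x + g x))) \<longlongrightarrow> 0) F"
    by (intro Lim_null_comparison[where f="\<lambda>i. l2_norm (\<lambda>x. s i x + t i x - (f x + g x))",
          OF always_eventually[OF allI]]) simp_all
  then show ?thesis
    by (auto simp: l2_tendsto_def sL tL intro: L2_add)
qed

subsection \<open>Approximation by simple functions\<close>

text \<open>Chebyshev's inequality for the square of the modulus. It makes the nonzero level sets of
  a simple function in \<open>L2\<close> have finite measure.\<close>

lemma emeasure_finite_superlevel_L2:
  assumes f: "f \<in> L2" and A: "A \<in> sets borel" and c: "c > 0" "\<And>x. x \<in> A \<Longrightarrow> c \<le> cmod (f x)"
  shows "emeasure lborel A < \<infinity>"
proof -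
  have "ennreal (c\<^sup>2) * emeasure lborel A = (\<integral>\<^sup>+x. ennreal (c\<^sup>2) * indicator A x \<partial>lborel)"
    using A by (simp add: nn_integral_cmult_indicator)
  also have "\<dots> \<le> (\<integral>\<^sup>+x. ennreal ((cmod (f x))\<^sup>2) \<partial>lborel)"
    using c by (intro nn_integral_mono) (auto split: split_indicator intro!: ennreal_leI power_mono)
  also have "\<dots> < \<infinity>"
    using L2_integrable[OF f] by (subst nn_integral_eq_integral) auto
  finally show ?thesis
    using c by (auto simp: ennreal_mult_less_top)
qed

lemma integrable_indicator_complex:
  assumes "A \<in> sets borel" "emeasure lborel A < \<infinity>"
  shows "integrable lborel (indicator A :: real^'d \<Rightarrow> complex)"
proof -
  have "integrable lborel (\<lambda>x::real^'d. complex_of_real (indicator A x))"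
    using assms by (intro integrable_of_real integrable_real_indicator) auto
  moreover have "(\<lambda>x::real^'d. complex_of_real (indicator A x)) = indicator A"
    by (auto split: split_indicator)
  ultimately show ?thesis
    by simp
qed

lemma indicator_L2:
  assumes "A \<in> sets borel" "emeasure lborel A < \<infinity>"
  shows "(indicator A :: real^'d \<Rightarrow> complex) \<in> L2"
proof -
  have "(\<lambda>x. (cmod (indicator A x))\<^sup>2) = (indicator A :: real^'d \<Rightarrow> real)"
    by (auto split: split_indicator)
  then show ?thesis
    using assms by (auto simp: L2_iff)
qed

text \<open>Density of simple functions, packaged as an induction rule. Simple approximants bounded
  by a multiple of \<open>f\<close> lie in \<open>L2\<close>, are integrable, and converge in norm
  by dominated convergence.\<close>

lemma L2_induct [consumes 1, case_names indicator add lim]: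
  fixes f :: "real^'d \<Rightarrow> complex"
  assumes f: "f \<in> L2"
    and ind: "\<And>A c. A \<in> sets borel \<Longrightarrow> emeasure lborel A < \<infinity> \<Longrightarrow> P (\<lambda>x. c * indicator A x)"
    and add: "\<And>f g. \<lbrakk>f \<in> L2; integrable lborel f; P f; g \<in> L2; integrable lborel g; P g\<rbrakk> \<Longrightarrow> P (\<lambda>x. f x + g x)"
    and lim: "\<And>s f. \<lbrakk>\<And>i. integrable lborel (s i); l2_tendsto s f sequentially; \<And>i. P (s i)\<rbrakk> \<Longrightarrow> P f"
  shows "P f"
proof -
  have fm: "f \<in> borel_measurable borel"
    using f by (auto simp: L2_iff)
  obtain s where s: "\<And>i. simple_function borel (s i)" "\<And>x. (\<lambda>i. s i x) \<longlonglongrightarrow> f x"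
    "\<And>i x. cmod (s i x) \<le> 2 * cmod (f x)"
    using borel_measurable_implies_sequence_metric[OF fm, of 0] by (auto simp: dist_norm)
  have sm: "s i \<in> borel_measurable borel" for i
    using s(1) borel_measurable_simple_function by blast
  have sL2: "s i \<in> L2" for i
    by (rule L2_dominated[OF f sm s(3)])
  have "integrable lborel (s i) \<and> P (s i)" for i
  proof -
    have fin: "finite (range (s i))"
      using simple_functionD(1)[OF s(1)[of i]] by simp
    define T where "T y x = y * (indicator (s i -` {y}) x :: complex)" for y x
    have meas: "s i -` {y} \<in> sets borel" for y
      using measurable_sets[OF sm[of i], of "{y}"] by simp
    have T: "T y \<in> L2 \<and> integrable lborel (T y) \<and> P (T y)" for y
    \<comment> \<open>The level set of 0 may have infinite measure; its summand vanishes, so it is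
      treated as a multiple of an empty indicator.\<close>
    proof (cases "y = 0")
      case True
      then show ?thesis
        using ind[of "{}" 0] by (simp add: T_def[abs_def])
    next
      case False
      have fin: "emeasure lborel (s i -` {y}) < \<infinity>"
        using False by (intro emeasure_finite_superlevel_L2[OF sL2[of i] meas, of "cmod y"]) auto
      have "integrable lborel (T y)"
        unfolding T_def using fin meas by (intro integrable_mult_right integrable_indicator_complex)
      then show ?thesis
        unfolding T_def using ind[OF meas fin] indicator_L2[OF meas fin] by (auto intro: L2_scale)
    qed
    have "integrable lborel (\<lambda>x. \<Sum>y\<in>B. T y x) \<and> P (\<lambda>x. \<Sum>y\<in>B. T y x)" if "finite B" for B
      using that
    proof induction
      case empty
      then show ?case
        using ind[of "{}" 0] by simp
    next
      case (insert y B)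
      then show ?case
        using add[of "T y" "\<lambda>x. \<Sum>y\<in>B. T y x"] T L2_sum[of B T] by auto
    qed
    moreover have "(\<lambda>x. \<Sum>y\<in>range (s i). T y x) = s i"
    proof
      fix x
      have "(\<Sum>y\<in>range (s i). T y x) = (\<Sum>y\<in>range (s i). if y = s i x then y else 0)"
        by (intro sum.cong) (auto simp: T_def)
      then show "(\<Sum>y\<in>range (s i). T y x) = s i x"
        using fin by simp
    qed
    ultimately show ?thesis
      using fin by metis
  qed
  moreover have "l2_tendsto s f sequentially"
  proof -
    have "(\<lambda>i. LINT x|lborel. (cmod (s i x - f x))\<^sup>2) \<longlonglongrightarrow> (LINT (x::real^'d)|lborel. 0)"
    \<comment> \<open>10 = 2 * 2^2 + 2, from \<open>norm_add_power2_le\<close> and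
      \<open>cmod (s i x) \<le> 2 * cmod (f x)\<close>.\<close>
    proof (rule integral_dominated_convergence[where w="\<lambda>x. 10 * (cmod (f x))\<^sup>2"])
      show "AE x in lborel. (\<lambda>i. (cmod (s i x - f x))\<^sup>2) \<longlonglongrightarrow> 0"
      proof (rule AE_I2)
        fix x
        have "(\<lambda>i. (cmod (s i x - f x))\<^sup>2) \<longlonglongrightarrow> (cmod (f x - f x))\<^sup>2"
          by (intro tendsto_intros s)
        then show "(\<lambda>i. (cmod (s i x - f x))\<^sup>2) \<longlonglongrightarrow> 0"
          by simp
      qed
      show "AE x in lborel. norm ((cmod (s i x - f x))\<^sup>2) \<le> 10 * (cmod (f x))\<^sup>2" for i
      proof (rule AE_I2)
        fix x
        have "(cmod (s i x))\<^sup>2 \<le> (2 * cmod (f x))\<^sup>2"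
          using s(3) by (intro power_mono) auto
        then show "norm ((cmod (s i x - f x))\<^sup>2) \<le> 10 * (cmod (f x))\<^sup>2"
          using norm_add_power2_le[of "s i x" "- f x"] by (simp add: power_mult_distrib)
      qed
    qed (use L2_integrable[OF f] fm sm in auto)
    then have "(\<lambda>i. sqrt (LINT x|lborel. (cmod (s i x - f x))\<^sup>2)) \<longlonglongrightarrow> sqrt 0"
      by (intro tendsto_real_sqrt) simp
    then show ?thesis
      using sL2 f by (auto simp: l2_tendsto_def l2_norm_def)
  qed
  ultimately show ?thesis
    using lim by blast
qed

section \<open>Lebesgue measure: linear images, translations and periodization\<close>

subsection \<open>Linear images\<close>

text \<open>The linear change of variables of the library is only available for well-ordered index types.
  A copy of the index type, ordered by some enumeration, extends it to arbitrary finite index types.\<close>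

typedef 'a wo = "UNIV :: 'a set" ..

instantiation wo :: (finite) "{finite, wellorder}"
begin

definition less_eq_wo :: "'a wo \<Rightarrow> 'a wo \<Rightarrow> bool" where
  "less_eq_wo x y \<longleftrightarrow> to_nat (Rep_wo x) \<le> to_nat (Rep_wo y)"

definition less_wo :: "'a wo \<Rightarrow> 'a wo \<Rightarrow> bool" where
  "less_wo x y \<longleftrightarrow> to_nat (Rep_wo x) < to_nat (Rep_wo y)"

instance
proof
  have "(UNIV :: 'a wo set) = range Abs_wo"
    by (simp add: type_definition.Abs_image[OF type_definition_wo])
  then show "finite (UNIV :: 'a wo set)"
    by (metis finite finite_imageI)
next
  fix x y :: "'a wo"
  assume "x \<le> y" "y \<le> x"
  then have "Rep_wo x = Rep_wo y"
    by (auto simp: less_eq_wo_def intro!: injD[OF inj_to_nat])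
  then show "x = y"
    by (simp add: Rep_wo_inject)
next
  fix P :: "'a wo \<Rightarrow> bool" and a :: "'a wo"
  assume step: "\<And>x. (\<And>y. y < x \<Longrightarrow> P y) \<Longrightarrow> P x"
  show "P a"
    by (induction a rule: measure_induct_rule[of "\<lambda>x. to_nat (Rep_wo x)"])
      (rule step, auto simp: less_wo_def)
qed (auto simp: less_eq_wo_def less_wo_def)

end

lemma bij_Rep_wo: "bij Rep_wo"
  by (metis Abs_wo_inverse Rep_wo_inverse UNIV_I bij_betw_def injI surj_def)

text \<open>Conjugation by \<open>f\<close> is a sign-preserving bijection between the permutations
  of the two index types, so the Leibniz sums agree term by term.\<close>

lemma det_reindex:
  fixes A :: "'c::comm_ring_1^'a^'a" and f :: "'b::finite \<Rightarrow> 'a"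
  assumes f: "bij f"
  shows "det (\<chi> i j. A $ f i $ f j) = det A"
proof -
  have inj: "inj f" and surj: "surj f" and inj': "inj (inv f)" and bij': "bij (inv f)"
    using f by (auto simp: bij_def surj_imp_inj_inv inj_imp_surj_inv)
  show ?thesis
    unfolding det_def
  proof (rule sum.reindex_bij_witness[where i="map_permutation UNIV (inv f)" and j="map_permutation UNIV f"])
    fix p :: "'b \<Rightarrow> 'b" assume "p \<in> {p. p permutes UNIV}"
    then have p: "p permutes UNIV"
      by simp
    show "map_permutation UNIV (inv f) (map_permutation UNIV f p) = p"
      using f inj by (intro map_permutation_compose_inv[OF f p]) auto
    show "map_permutation UNIV f p \<in> {p. p permutes UNIV}"
      using map_permutation_permutes[OF f p] by simp
    have "(\<Prod>i\<in>UNIV. A $ i $ map_permutation UNIV f p i)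
        = (\<Prod>i\<in>UNIV. A $ f i $ map_permutation UNIV f p (f i))"
      by (intro prod.reindex_bij_betw[OF f, symmetric])
    also have "\<dots> = (\<Prod>i\<in>UNIV. A $ f i $ f (p i))"
      using inj by (simp add: map_permutation_apply)
    finally show "of_int (sign (map_permutation UNIV f p)) * (\<Prod>i\<in>UNIV. A $ i $ map_permutation UNIV f p i)
        = of_int (sign p) * (\<Prod>i\<in>UNIV. (\<chi> i j. A $ f i $ f j) $ i $ p i)"
      using inj p by (simp add: sign_map_permutation)
  next
    fix p :: "'a \<Rightarrow> 'a" assume "p \<in> {p. p permutes UNIV}"
    then have p: "p permutes UNIV"
      by simp
    show "map_permutation UNIV f (map_permutation UNIV (inv f) p) = p"
      using surj by (intro map_permutation_compose_inv[OF bij' p]) (auto simp: surj_f_inv_f)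
    show "map_permutation UNIV (inv f) p \<in> {p. p permutes UNIV}"
      using map_permutation_permutes[OF bij' p] by simp
  qed
qed

lemma Basis_real_vec: "(Basis :: (real^'d) set) = range (\<lambda>i. axis i 1)"
  by (auto simp: Basis_vec_def)

lemma prod_Basis_vec: "(\<Prod>b\<in>(Basis :: (real^'d) set). f b) = (\<Prod>i\<in>UNIV. f (axis i 1))"
  unfolding Basis_real_vec by (subst prod.reindex) (auto intro!: injI simp: axis_eq_axis)

text \<open>Renaming coordinates permutes the side lengths of a box, and boxes determine
  \<open>lborel\<close>.\<close>

lemma lborel_distr_reindex:
  fixes f :: "'b::finite \<Rightarrow> 'a::finite"
  assumes f: "bij f"
  shows "distr lborel borel (\<lambda>x::real^'a. \<chi> i. x $ f i) = lborel"
proof (rule lborel_eqI[symmetric])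
  have [measurable]: "(\<lambda>x::real^'a. \<chi> i. x $ f i) \<in> borel_measurable borel"
    by (intro borel_measurable_continuous_onI continuous_intros)
  have inv: "f (inv f j) = j" "inv f (f i) = i" for i j
    using f by (auto simp: bij_def surj_f_inv_f)
  fix l u :: "real^'b"
  assume "\<And>b. b \<in> Basis \<Longrightarrow> l \<bullet> b \<le> u \<bullet> b"
  then have le: "l $ i \<le> u $ i" for i
    by (force simp: Basis_real_vec inner_axis)
  have "(\<lambda>x::real^'a. \<chi> i. x $ f i) -` box l u = box (\<chi> j. l $ inv f j) (\<chi> j. u $ inv f j)"
    by (auto simp: mem_box_cart inv) (metis inv)+
  then have "emeasure (distr lborel borel (\<lambda>x::real^'a. \<chi> i. x $ f i)) (box l u)
      = ennreal (\<Prod>j\<in>UNIV. u $ inv f j - l $ inv f j)"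
    using le by (simp add: emeasure_distr emeasure_lborel_box_eq Basis_real_vec prod_Basis_vec[unfolded Basis_real_vec]
      inner_axis inner_diff_left)
  also have "(\<Prod>j\<in>UNIV. u $ inv f j - l $ inv f j) = (\<Prod>i\<in>UNIV. u $ i - l $ i)"
    using prod.reindex_bij_betw[OF bij_imp_bij_inv[OF f], of "\<lambda>i. u $ i - l $ i"] by simp
  also have "\<dots> = (\<Prod>b\<in>Basis. (u - l) \<bullet> b)"
    by (simp add: prod_Basis_vec inner_axis)
  finally show "emeasure (distr lborel borel (\<lambda>x::real^'a. \<chi> i. x $ f i)) (box l u)
      = ennreal (\<Prod>b\<in>Basis. (u - l) \<bullet> b)" .
qed simp

lemma borel_measurable_matrix_vector_mult [measurable]: "(\<lambda>x. (A :: real^'n^'m) *v x) \<in> borel_measurable borel"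
  by (intro borel_measurable_continuous_onI linear_continuous_on matrix_vector_mul_bounded_linear)

lemma matrix_inv_mult:
  assumes "invertible A"
  shows "A ** matrix_inv A = mat 1" "matrix_inv A ** A = mat 1"
  using someI_ex[OF assms[unfolded invertible_def]] by (simp_all add: matrix_inv_def)

text \<open>Both measures agree on boxes: the preimage of a box under \<open>A\<close> is its image
  under the inverse, whose volume carries the factor 1 / \<bar>det A\<bar>.\<close>

lemma nn_integral_matrix_wellorder:
  fixes A :: "real^('n::{finite,wellorder})^('n::_)"
  assumes A: "det A \<noteq> 0" and f: "f \<in> borel_measurable borel"
  shows "(\<integral>\<^sup>+x. f x \<partial>lborel) = ennreal \<bar>det A\<bar> * (\<integral>\<^sup>+x. f (A *v x) \<partial>lborel)"
proof -
  have inv: "A ** matrix_inv A = mat 1" "matrix_inv A ** A = mat 1"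
    using A matrix_inv_mult[of A] by (auto simp: invertible_det_nz)
  have det: "det (matrix_inv A) = 1 / det A"
  proof -
    have "det A * det (matrix_inv A) = 1"
      by (metis det_I det_mul inv(1))
    then show ?thesis
      using A by (simp add: field_simps)
  qed
  have "lborel = density (distr lborel borel ((*v) A)) (\<lambda>_. ennreal \<bar>det A\<bar>)"
  proof (rule lborel_eqI)
    fix l u :: "real^'n::_"
    assume "\<And>b. b \<in> Basis \<Longrightarrow> l \<bullet> b \<le> u \<bullet> b"
    then have box: "measure lebesgue (box l u) = (\<Prod>b\<in>Basis. (u - l) \<bullet> b)"
      by simp
    have img: "(*v) A -` box l u = (*v) (matrix_inv A) ` box l u"
    proof (safe, goal_cases)
      case (1 x)
      then show ?case
        by (intro image_eqI[of _ _ "A *v x"]) (simp_all add: matrix_vector_mul_assoc inv)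
    next
      case (2 _ x)
      then show ?case
        by (simp add: matrix_vector_mul_assoc inv)
    qed
    have meas: "(*v) A -` box l u \<in> sets borel"
      using measurable_sets[OF borel_measurable_matrix_vector_mult, of "box l u" A] by simp
    have lm: "(*v) (matrix_inv A) ` box l u \<in> lmeasurable"
      by (intro measurable_linear_image) auto
    have "emeasure lborel ((*v) A -` box l u) = emeasure lebesgue ((*v) (matrix_inv A) ` box l u)"
      using meas by (simp add: img)
    also have "\<dots> = ennreal (measure lebesgue ((*v) (matrix_inv A) ` box l u))"
      using lm by (simp add: emeasure_eq_measure2)
    also have "\<dots> = ennreal (1 / \<bar>det A\<bar> * (\<Prod>b\<in>Basis. (u - l) \<bullet> b))"
      by (subst measure_linear_image) (simp_all add: box det)
    finally have "emeasure lborel ((*v) A -` box l u) = ennreal (1 / \<bar>det A\<bar> * (\<Prod>b\<in>Basis. (u - l) \<bullet> b))" .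
    then show "emeasure (density (distr lborel borel ((*v) A)) (\<lambda>_. ennreal \<bar>det A\<bar>)) (box l u)
        = ennreal (\<Prod>b\<in>Basis. (u - l) \<bullet> b)"
      using A by (simp add: emeasure_density nn_integral_cmult_indicator emeasure_distr flip: ennreal_mult')
  qed simp
  then have "(\<integral>\<^sup>+x. f x \<partial>lborel) = (\<integral>\<^sup>+x. f x \<partial>density (distr lborel borel ((*v) A)) (\<lambda>_. ennreal \<bar>det A\<bar>))"
    by simp
  also have "\<dots> = ennreal \<bar>det A\<bar> * (\<integral>\<^sup>+x. f (A *v x) \<partial>lborel)"
    using f by (simp add: nn_integral_density nn_integral_cmult nn_integral_distr)
  finally show ?thesis .
qed

text \<open>The renaming \<open>R\<close> preserves \<open>lborel\<close> and intertwines
  \<open>B\<close> with \<open>A\<close>, and \<open>det_reindex\<close> equates the determinants,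
  so the well-ordered case carries over.\<close>

lemma nn_integral_matrix:
  fixes A :: "real^'d^'d"
  assumes A: "det A \<noteq> 0" and f: "f \<in> borel_measurable borel"
  shows "(\<integral>\<^sup>+x. f x \<partial>lborel) = ennreal \<bar>det A\<bar> * (\<integral>\<^sup>+x. f (A *v x) \<partial>lborel)"
proof -
  define R :: "real^('d wo) \<Rightarrow> real^'d" where "R y = (\<chi> i. y $ inv Rep_wo i)" for y
  define B :: "real^('d wo)^('d wo)" where "B = (\<chi> i j. A $ Rep_wo i $ Rep_wo j)"
  have det: "det B = det A"
    unfolding B_def by (rule det_reindex[OF bij_Rep_wo])
  have [measurable]: "R \<in> borel_measurable borel"
    unfolding R_def[abs_def] by (intro borel_measurable_continuous_onI continuous_intros)
  have R: "distr lborel borel R = lborel"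
    unfolding R_def[abs_def] by (rule lborel_distr_reindex[OF bij_imp_bij_inv[OF bij_Rep_wo]])
  have RB: "R (B *v y) = A *v R y" for y
  proof -
    have "(\<Sum>j\<in>UNIV. A $ i $ Rep_wo j * y $ j) = (\<Sum>j\<in>UNIV. A $ i $ j * y $ inv Rep_wo j)" for i
      using sum.reindex_bij_betw[OF bij_Rep_wo, of "\<lambda>j. A $ i $ j * y $ inv Rep_wo j"]
      by (simp add: inv_f_f bij_is_inj[OF bij_Rep_wo])
    then show ?thesis
      by (simp add: R_def B_def matrix_vector_mult_def vec_eq_iff surj_f_inv_f bij_is_surj[OF bij_Rep_wo])
  qed
  have "(\<integral>\<^sup>+x. f x \<partial>lborel) = (\<integral>\<^sup>+x. f x \<partial>distr lborel borel R)"
    by (simp add: R)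
  also have "\<dots> = (\<integral>\<^sup>+y. f (R y) \<partial>lborel)"
    using f by (subst nn_integral_distr) auto
  also have "\<dots> = ennreal \<bar>det A\<bar> * (\<integral>\<^sup>+y. f (R (B *v y)) \<partial>lborel)"
    using nn_integral_matrix_wellorder[of B "\<lambda>y. f (R y)"] f A by (simp add: det)
  also have "(\<integral>\<^sup>+y. f (R (B *v y)) \<partial>lborel) = (\<integral>\<^sup>+x. f (A *v x) \<partial>distr lborel borel R)"
    using f by (subst nn_integral_distr) (auto simp: RB)
  finally show ?thesis
    by (simp add: R)
qed

text \<open>As an identity of measures the change of variables also yields the Bochner versions
  below.\<close>

lemma lborel_matrix:
  fixes A :: "real^'d^'d"
  assumes A: "det A \<noteq> 0"
  shows "lborel = density (distr lborel borel ((*v) A)) (\<lambda>_. ennreal \<bar>det A\<bar>)"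
proof (rule measure_eqI)
  fix X :: "(real^'d) set" assume X: "X \<in> sets lborel"
  have "emeasure lborel X = (\<integral>\<^sup>+x. indicator X x \<partial>lborel)"
    using X by simp
  also have "\<dots> = ennreal \<bar>det A\<bar> * (\<integral>\<^sup>+x. indicator X (A *v x) \<partial>lborel)"
    using X by (intro nn_integral_matrix A) auto
  also have "(\<integral>\<^sup>+x. indicator X (A *v x) \<partial>lborel) = emeasure (distr lborel borel ((*v) A)) X"
    using X by (simp add: nn_integral_distr flip: nn_integral_indicator)
  finally show "emeasure lborel X = emeasure (density (distr lborel borel ((*v) A)) (\<lambda>_. ennreal \<bar>det A\<bar>)) X"
    using X by (simp add: emeasure_density nn_integral_cmult_indicator)
qed simp

lemma integrable_matrix_iff:
  fixes A :: "real^'d^'d" and f :: "real^'d \<Rightarrow> 'b::{banach, second_countable_topology}"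
  assumes A: "det A \<noteq> 0" and f: "f \<in> borel_measurable borel"
  shows "integrable lborel (\<lambda>x. f (A *v x)) \<longleftrightarrow> integrable lborel f"
proof -
  have "integrable lborel f \<longleftrightarrow> integrable (density (distr lborel borel ((*v) A)) (\<lambda>_. ennreal \<bar>det A\<bar>)) f"
    using lborel_matrix[OF A] by simp
  also have "\<dots> \<longleftrightarrow> integrable lborel (\<lambda>x. f (A *v x))"
  proof -
    have "integrable lborel (\<lambda>x. \<bar>det A\<bar> *\<^sub>R f (A *v x)) \<Longrightarrow>
        integrable lborel (\<lambda>x. inverse \<bar>det A\<bar> *\<^sub>R \<bar>det A\<bar> *\<^sub>R f (A *v x))"
      by (rule integrable_scaleR_right)
    then show ?thesis
      using f A by (auto simp: integrable_density integrable_distr_eq)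
  qed
  finally show ?thesis ..
qed

lemma integral_matrix:
  fixes A :: "real^'d^'d" and f :: "real^'d \<Rightarrow> 'b::{banach, second_countable_topology}"
  assumes A: "det A \<noteq> 0" and f: "f \<in> borel_measurable borel"
  shows "(LINT x|lborel. f (A *v x)) = (LINT x|lborel. f x) /\<^sub>R \<bar>det A\<bar>"
proof -
  have "(LINT x|lborel. f x) = (LINT x|density (distr lborel borel ((*v) A)) (\<lambda>_. ennreal \<bar>det A\<bar>). f x)"
    using lborel_matrix[OF A] by simp
  also have "\<dots> = \<bar>det A\<bar> *\<^sub>R (LINT x|lborel. f (A *v x))"
    using f A by (simp add: integral_density integral_distr)
  finally show ?thesis
    using A by simp
qed

subsection \<open>Translations and reflection\<close>

lemma integral_translate:
  fixes f :: "real^'d \<Rightarrow> 'b::{banach, second_countable_topology}"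
  assumes "f \<in> borel_measurable borel"
  shows "(LINT x|lborel. f (x + c)) = (LINT x|lborel. f x)"
  using integral_distr[of "(+) c" lborel borel f] assms by (simp add: lborel_distr_plus add.commute)

lemma integrable_translate_iff:
  fixes f :: "real^'d \<Rightarrow> 'b::{banach, second_countable_topology}"
  assumes "f \<in> borel_measurable borel"
  shows "integrable lborel (\<lambda>x. f (x + c)) \<longleftrightarrow> integrable lborel f"
  using integrable_distr_eq[of "(+) c" lborel borel f] assms by (simp add: lborel_distr_plus add.commute)

lemma nn_integral_translate:
  fixes f :: "real^'d \<Rightarrow> ennreal"
  assumes "f \<in> borel_measurable borel"
  shows "(\<integral>\<^sup>+x. f (x + c) \<partial>lborel) = (\<integral>\<^sup>+x. f x \<partial>lborel)"
  using nn_integral_distr[of "(+) c" lborel borel f] assms by (simp add: lborel_distr_plus add.commute)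

lemma lborel_distr_uminus_vec: "distr lborel borel uminus = (lborel :: (real^'d) measure)"
proof -
  have "lborel = density (distr lborel borel (\<lambda>x::real^'d. 0 + (-1) *\<^sub>R x)) (\<lambda>_. ennreal (\<bar>-1\<bar> ^ DIM(real^'d)))"
    by (rule lborel_affine) simp
  then show ?thesis
    by (simp add: density_1)
qed

lemma integral_reflect:
  fixes f :: "real^'d \<Rightarrow> 'b::{banach, second_countable_topology}"
  assumes "f \<in> borel_measurable borel"
  shows "(LINT x|lborel. f (- x)) = (LINT x|lborel. f x)"
  using integral_distr[of uminus lborel borel f] assms by (simp add: lborel_distr_uminus_vec)

lemma integrable_reflect_iff:
  fixes f :: "real^'d \<Rightarrow> 'b::{banach, second_countable_topology}"
  assumes "f \<in> borel_measurable borel"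
  shows "integrable lborel (\<lambda>x. f (- x)) \<longleftrightarrow> integrable lborel f"
  using integrable_distr_eq[of uminus lborel borel f] assms by (simp add: lborel_distr_uminus_vec)

subsection \<open>Products of functions of one variable\<close>

text \<open>Fubini over the coordinates. \<open>lborel_eq\<close> presents \<open>lborel\<close> as
  an image of a product measure indexed by \<open>Basis\<close>, so the factors are carried to basis
  vectors by \<open>axis_index\<close>.\<close>

lemma integral_lborel_prod:
  fixes f :: "'d::finite \<Rightarrow> real \<Rightarrow> 'b::{real_normed_field,banach,second_countable_topology}"
  assumes f: "\<And>i. integrable lborel (f i)"
  shows "(LINT x|lborel. (\<Prod>i\<in>UNIV. f i ((x :: real^'d) $ i))) = (\<Prod>i\<in>UNIV. LINT t|lborel. f i t)"
    and "integrable lborel (\<lambda>x::real^'d. \<Prod>i\<in>UNIV. f i (x $ i))"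
proof -
  interpret product_sigma_finite "\<lambda>_::real^'d. lborel :: real measure" ..
  define g where "g b = f (axis_index b)" for b :: "real^'d"
  have g: "g (axis i 1) = f i" for i
    by (simp add: g_def)
  have meas: "f i \<in> borel_measurable borel" for i
    using borel_measurable_integrable[OF f[of i]] by simp
  have S: "(\<lambda>y. \<Sum>b\<in>Basis. y b *\<^sub>R b) \<in> Pi\<^sub>M Basis (\<lambda>b::real^'d. lborel :: real measure) \<rightarrow>\<^sub>M borel"
    by measurable
  have P: "(\<lambda>x::real^'d. \<Prod>i\<in>UNIV. f i (x $ i)) \<in> borel_measurable borel"
    using meas by (intro borel_measurable_prod measurable_compose[OF _ meas]
        borel_measurable_continuous_onI continuous_intros)
  have eq: "(\<Prod>i\<in>UNIV. f i ((\<Sum>b\<in>Basis. y b *\<^sub>R b) $ i)) = (\<Prod>b\<in>Basis. g b (y b))" for y :: "real^'d \<Rightarrow> real"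
  proof -
    have "(\<Sum>b\<in>Basis. y b *\<^sub>R b) $ i = y (axis i 1)" for i
    proof -
      have "(\<Sum>b\<in>Basis. y b *\<^sub>R b) $ i = (\<Sum>b\<in>Basis. y b *\<^sub>R b) \<bullet> axis i 1"
        by (simp add: inner_axis)
      also have "\<dots> = y (axis i 1)"
        by (rule inner_sum_left_Basis) (simp add: Basis_real_vec)
      finally show ?thesis .
    qed
    then show ?thesis
      by (simp add: prod_Basis_vec g)
  qed
  have gi: "b \<in> Basis \<Longrightarrow> integrable lborel (g b)" for b
    by (simp add: g_def f)
  show "(LINT x|lborel. (\<Prod>i\<in>UNIV. f i ((x :: real^'d) $ i))) = (\<Prod>i\<in>UNIV. LINT t|lborel. f i t)"
  proof -
    have "(LINT x|lborel. (\<Prod>i\<in>UNIV. f i ((x :: real^'d) $ i)))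
        = (LINT y|Pi\<^sub>M Basis (\<lambda>b::real^'d. lborel). (\<Prod>b\<in>Basis. g b (y b)))"
      by (subst lborel_eq, subst integral_distr[OF S P]) (simp only: eq)
    also have "\<dots> = (\<Prod>b\<in>Basis. LINT t|lborel. g b t)"
      by (rule product_integral_prod) (simp_all add: gi)
    finally show ?thesis
      by (simp add: prod_Basis_vec g)
  qed
  show "integrable lborel (\<lambda>x::real^'d. \<Prod>i\<in>UNIV. f i (x $ i))"
    by (subst lborel_eq, subst integrable_distr_eq[OF S P])
      (simp only: eq, intro product_integrable_prod gi finite_Basis)
qed

subsection \<open>Periodization over the integer lattice\<close>

lemma rvec_add: "rvec (j + k) = rvec j + rvec k"
  by (simp add: rvec_def vec_eq_iff)

lemma rvec_diff: "rvec (j - k) = rvec j - rvec k"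
  by (simp add: rvec_def vec_eq_iff)

lemma rvec_minus: "rvec (- k) = - rvec k"
  by (simp add: rvec_def vec_eq_iff)

lemma rvec_0 [simp]: "rvec 0 = 0"
  by (simp add: rvec_def vec_eq_iff)

lemma rvec_inject [simp]: "rvec j = rvec k \<longleftrightarrow> j = k"
  by (simp add: rvec_def vec_eq_iff)

lemma rmat_mult_rvec: "rmat M *v rvec k = rvec (M *v k)"
  by (simp add: rvec_def rmat_def map_matrix_def vec_eq_iff matrix_vector_mult_def)

lemma det_rmat: "det (rmat M) = of_int (det M)"
  by (simp add: det_def rmat_def map_matrix_def)

text \<open>Half-open, so that its integer translates partition the space without overlapping on
  faces.\<close>

definition unit_cube :: "(real^'d) set" where
  "unit_cube = {x. \<forall>i. 0 \<le> x $ i \<and> x $ i < 1}"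

lemma unit_cube_borel [measurable, simp]: "unit_cube \<in> sets borel"
proof -
  have "unit_cube = (\<Inter>i. {x :: real^'d. 0 \<le> x $ i} \<inter> {x. x $ i < 1})"
    by (auto simp: unit_cube_def)
  moreover have "closed {x :: real^'d. 0 \<le> x $ i}" "open {x :: real^'d. x $ i < 1}" for i
    by (intro closed_Collect_le open_Collect_less continuous_intros)+
  ultimately show ?thesis
    by (metis (no_types, lifting) UNIV_not_empty borel_closed borel_open finite sets.Int sets.finite_INT)
qed

lemma emeasure_unit_cube: "emeasure lborel (unit_cube :: (real^'d) set) = 1"
proof (rule antisym)
  have "emeasure lborel (unit_cube :: (real^'d) set) \<le> emeasure lborel (cbox 0 (\<chi> i. 1) :: (real^'d) set)"
    by (intro emeasure_mono) (auto simp: unit_cube_def mem_box_cart less_imp_le)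
  also have "\<dots> = 1"
    by (simp add: emeasure_lborel_cbox_eq Basis_real_vec inner_axis prod_Basis_vec[unfolded Basis_real_vec])
  finally show "emeasure lborel (unit_cube :: (real^'d) set) \<le> 1" .
  have "1 = emeasure lborel (box 0 (\<chi> i. 1) :: (real^'d) set)"
    by (simp add: emeasure_lborel_box_eq Basis_real_vec inner_axis prod_Basis_vec[unfolded Basis_real_vec])
  also have "\<dots> \<le> emeasure lborel (unit_cube :: (real^'d) set)"
    by (intro emeasure_mono) (auto simp: unit_cube_def mem_box_cart less_imp_le)
  finally show "1 \<le> emeasure lborel (unit_cube :: (real^'d) set)" .
qed

lemma ex1_shift_unit_cube: "\<exists>!k. x - rvec k \<in> unit_cube"
proof
  show "x - rvec (\<chi> i. \<lfloor>x $ i\<rfloor>) \<in> unit_cube"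
    by (auto simp: unit_cube_def rvec_def) linarith
  fix k assume "x - rvec k \<in> unit_cube"
  then have "k $ i = \<lfloor>x $ i\<rfloor>" for i
    by (auto simp: unit_cube_def rvec_def intro!: floor_unique[symmetric]) (smt (verit))+
  then show "k = (\<chi> i. \<lfloor>x $ i\<rfloor>)"
    by (simp add: vec_eq_iff)
qed

lemma ex1_add_shift_unit_cube: "\<exists>!k. x + rvec k \<in> unit_cube"
proof -
  from ex1_shift_unit_cube[of x] obtain k where k: "x - rvec k \<in> unit_cube"
    "\<And>j. x - rvec j \<in> unit_cube \<Longrightarrow> j = k"
    by auto
  show ?thesis
  proof
    show "x + rvec (- k) \<in> unit_cube"
      using k(1) by (simp add: rvec_minus)
    show "j = - k" if "x + rvec j \<in> unit_cube" for j
    proof -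
      have "- j = k"
        using k(2)[of "- j"] that by (simp add: rvec_minus)
      then show ?thesis
        by auto
    qed
  qed
qed

lemma nn_integral_count_space_Ex1:
  assumes "\<exists>!k. P k"
  shows "(\<integral>\<^sup>+k. (if P k then c else 0) \<partial>count_space UNIV) = c"
proof -
  from assms obtain k where k: "P k" "\<And>j. j \<noteq> k \<Longrightarrow> \<not> P j"
    by metis
  then have "(\<integral>\<^sup>+k. (if P k then c else 0) \<partial>count_space UNIV) = (\<Sum>j\<in>{k}. if P j then c else 0)"
    by (intro nn_integral_count_space') auto
  then show ?thesis
    using k by simp
qed

text \<open>Insert the partition of unity formed by the translated cubes, exchange sum and integral,
  and translate each term back. Working in \<open>ennreal\<close> makes the exchange free of
  summability conditions.\<close>

lemma nn_integral_periodize: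
  fixes f :: "real^'d \<Rightarrow> ennreal"
  assumes [measurable]: "f \<in> borel_measurable borel"
  shows "(\<integral>\<^sup>+x. f x \<partial>lborel)
    = (\<integral>\<^sup>+x. (\<integral>\<^sup>+k. f (x + rvec k) \<partial>count_space UNIV) * indicator unit_cube x \<partial>lborel)"
proof -
  have "(\<integral>\<^sup>+x. f x \<partial>lborel) = (\<integral>\<^sup>+x. (\<integral>\<^sup>+k. f x * indicator unit_cube (x - rvec k) \<partial>count_space UNIV) \<partial>lborel)"
  proof (rule nn_integral_cong)
    fix x :: "real^'d"
    have "(\<integral>\<^sup>+k. f x * indicator unit_cube (x - rvec k) \<partial>count_space UNIV)
        = (\<integral>\<^sup>+k. (if x - rvec k \<in> unit_cube then f x else 0) \<partial>count_space UNIV)"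
      by (intro nn_integral_cong) (auto split: split_indicator)
    then show "f x = (\<integral>\<^sup>+k. f x * indicator unit_cube (x - rvec k) \<partial>count_space UNIV)"
      using nn_integral_count_space_Ex1[OF ex1_shift_unit_cube[of x]] by simp
  qed
  also have "\<dots> = (\<integral>\<^sup>+k. (\<integral>\<^sup>+x. f x * indicator unit_cube (x - rvec k) \<partial>lborel) \<partial>count_space UNIV)"
    by (rule nn_integral_count_space_nn_integral) auto
  also have "\<dots> = (\<integral>\<^sup>+k. (\<integral>\<^sup>+x. f (x + rvec k) * indicator unit_cube x \<partial>lborel) \<partial>count_space UNIV)"
  proof (rule nn_integral_cong)
    fix k :: "int^'d"
    show "(\<integral>\<^sup>+x. f x * indicator unit_cube (x - rvec k) \<partial>lborel)
        = (\<integral>\<^sup>+x. f (x + rvec k) * indicator unit_cube x \<partial>lborel)"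
      using nn_integral_translate[of "\<lambda>x. f x * indicator unit_cube (x - rvec k)" "rvec k"] by simp
  qed
  also have "\<dots> = (\<integral>\<^sup>+x. (\<integral>\<^sup>+k. f (x + rvec k) * indicator unit_cube x \<partial>count_space UNIV) \<partial>lborel)"
    by (rule nn_integral_count_space_nn_integral[symmetric]) auto
  also have "\<dots> = (\<integral>\<^sup>+x. (\<integral>\<^sup>+k. f (x + rvec k) \<partial>count_space UNIV) * indicator unit_cube x \<partial>lborel)"
    by (simp add: nn_integral_multc)
  finally show ?thesis .
qed

text \<open>The image \<open>P\<close> of the unit cube under \<open>M\<close> has volume \<open>\<bar>det M\<bar>\<close>, and every translate of \<open>P\<close>
  contains exactly one lattice point from each residue class.\<close>

lemma card_digit_set:
  fixes M :: "int^'d^'d"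
  assumes D: "digit_set M D" and M: "det M \<noteq> 0"
  shows "finite D" "int (card D) = \<bar>det M\<bar>"
proof -
  define A where "A = rmat M"
  define P where "P = {x. matrix_inv A *v x \<in> unit_cube}"
  have A: "det A \<noteq> 0"
    using M by (simp add: A_def det_rmat)
  have inv: "A ** matrix_inv A = mat 1" "matrix_inv A ** A = mat 1"
    using A matrix_inv_mult[of A] by (auto simp: invertible_det_nz)
  have [measurable]: "P \<in> sets borel"
    using measurable_sets[OF borel_measurable_matrix_vector_mult[of "matrix_inv A"], of unit_cube]
    by (simp add: P_def vimage_def)
  have P: "emeasure lborel P = ennreal \<bar>det A\<bar>"
  proof -
    have "emeasure lborel P = (\<integral>\<^sup>+x. indicator P x \<partial>lborel)"
      by simp
    also have "\<dots> = ennreal \<bar>det A\<bar> * (\<integral>\<^sup>+x. indicator P (A *v x) \<partial>lborel)"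
      by (intro nn_integral_matrix A) auto
    also have "(\<integral>\<^sup>+x. indicator P (A *v x) \<partial>lborel) = (\<integral>\<^sup>+x. indicator (unit_cube :: (real^'d) set) x \<partial>lborel)"
      by (intro nn_integral_cong)
        (simp add: P_def indicator_def matrix_vector_mul_assoc inv)
    finally show ?thesis
      by (simp add: emeasure_unit_cube)
  qed
  define h where "h k = (THE r. r \<in> D \<and> (\<exists>l. k - r = M *v l))" for k
  have ex1: "\<exists>!r. r \<in> D \<and> (\<exists>l. k - r = M *v l)" for k
    using D by (auto simp: digit_set_def)
  have h: "h k \<in> D" "\<exists>l. k = h k + M *v l" for k
    using theI'[OF ex1[of k]] by (auto simp: algebra_simps h_def)
  have h_eq: "h k = r" if "r \<in> D" "k = r + M *v l" for k r l
    unfolding h_def using that by (intro the1_equality[OF ex1]) auto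
  have bij: "bij_betw h {k. x + rvec k \<in> P} D" (is "bij_betw h ?S D") for x
  proof -
    \<comment> \<open>Pulled back by the inverse matrix, membership in the translated
      \<open>P\<close> says that \<open>rvec l\<close> moves a fixed point into the unit cube;
      exactly one \<open>l\<close> does so for each digit \<open>r\<close>.\<close>
    have S: "r + M *v l \<in> ?S \<longleftrightarrow> matrix_inv A *v (x + rvec r) + rvec l \<in> unit_cube" for r l
    proof -
      have "matrix_inv A *v (x + rvec (r + M *v l)) = matrix_inv A *v (x + rvec r) + matrix_inv A *v (A *v rvec l)"
        by (simp add: rvec_add A_def rmat_mult_rvec matrix_vector_right_distrib)
      then show ?thesis
        by (simp add: P_def matrix_vector_mul_assoc inv)
    qed
    show ?thesis
      unfolding bij_betw_def
    proof (intro conjI inj_onI equalityI subsetI)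
      fix j k assume "j \<in> ?S" "k \<in> ?S" and eq: "h j = h k"
      obtain l m where l: "j = h j + M *v l" and m: "k = h k + M *v m"
        using h(2) by metis
      have "matrix_inv A *v (x + rvec (h j)) + rvec l \<in> unit_cube"
        using S[of "h j" l] l \<open>j \<in> ?S\<close> by simp
      moreover have "matrix_inv A *v (x + rvec (h j)) + rvec m \<in> unit_cube"
        using S[of "h k" m] m \<open>k \<in> ?S\<close> eq by simp
      ultimately have "l = m"
        using ex1_add_shift_unit_cube by blast
      then show "j = k"
        using l m eq by metis
    next
      fix r assume "r \<in> h ` ?S"
      then show "r \<in> D"
        using h(1) by auto
    next
      fix r assume r: "r \<in> D"
      obtain l where "matrix_inv A *v (x + rvec r) + rvec l \<in> unit_cube"
        using ex1_add_shift_unit_cube by blast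
      then have "r + M *v l \<in> ?S"
        using S by blast
      then show "r \<in> h ` ?S"
        using h_eq[OF r refl, of l] image_eqI[of r h "r + M *v l" ?S] by simp
    qed
  qed
  \<comment> \<open>Counting measure instead of \<open>card\<close> keeps infinite \<open>D\<close>
    in the comparison; finiteness is then read off the finite volume.\<close>
  have count: "emeasure (count_space UNIV) {k. x + rvec k \<in> P} = emeasure (count_space UNIV) D" for x
    using bij_betw_finite[OF bij[of x]] bij_betw_same_card[OF bij[of x]]
    by (simp add: emeasure_count_space)
  have "ennreal \<bar>det A\<bar> = (\<integral>\<^sup>+x. indicator P x \<partial>lborel)"
    by (simp add: P)
  also have "\<dots> = (\<integral>\<^sup>+x. (\<integral>\<^sup>+k. indicator P (x + rvec k) \<partial>count_space UNIV) * indicator unit_cube x \<partial>lborel)"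
    by (rule nn_integral_periodize) auto
  also have "\<dots> = (\<integral>\<^sup>+x. emeasure (count_space UNIV) D * indicator (unit_cube :: (real^'d) set) x \<partial>lborel)"
  proof (rule nn_integral_cong)
    fix x :: "real^'d"
    have "(\<integral>\<^sup>+k. indicator P (x + rvec k) \<partial>count_space UNIV)
        = (\<integral>\<^sup>+k. indicator {k. x + rvec k \<in> P} k \<partial>count_space UNIV)"
      by (intro nn_integral_cong) (auto split: split_indicator)
    then show "(\<integral>\<^sup>+k. indicator P (x + rvec k) \<partial>count_space UNIV) * indicator unit_cube x
        = emeasure (count_space UNIV) D * indicator unit_cube x"
      by (simp add: count)
  qed
  also have "\<dots> = emeasure (count_space UNIV) D"
    by (simp add: nn_integral_cmult_indicator emeasure_unit_cube)
  finally have eq: "ennreal \<bar>det A\<bar> = emeasure (count_space UNIV) D" .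
  then show fin: "finite D"
    by (metis emeasure_count_space_infinite ennreal_neq_top infinity_ennreal_def subset_UNIV)
  have "\<bar>det A\<bar> = real (card D)"
    using eq fin by (simp add: emeasure_count_space ennreal_of_nat_eq_real_of_nat)
  then show "int (card D) = \<bar>det M\<bar>"
    by (simp add: A_def det_rmat)
qed

section \<open>Orthogonality of characters on the unit cube\<close>

lemma integral_exp_interval:
  fixes k :: int
  shows "(LINT t|lborel. indicator {0..<1::real} t * cis (2 * pi * (of_int k * t))) = (if k = 0 then 1 else 0)" (is ?A)
    and "integrable lborel (\<lambda>t. indicator {0..<1::real} t * cis (2 * pi * (of_int k * t)))" (is ?B)
proof -
  define f where "f t = cis (2 * pi * (of_int k * t))" for t :: real
  have cont: "continuous_on S f" for S
    unfolding f_def by (intro continuous_intros)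
  have f: "f \<in> borel_measurable borel"
    by (intro borel_measurable_continuous_onI cont)
  have AE: "AE t in lborel. indicator {0..<1::real} t * f t = indicator {0..1} t *\<^sub>R f t"
    using AE_lborel_singleton[of 1] by eventually_elim (auto simp: indicator_def)
  have int: "integrable lborel (\<lambda>t. indicator {0..1::real} t *\<^sub>R f t)"
    by (rule borel_integrable_compact) (auto intro: cont)
  show ?B
    using int AE f unfolding f_def[symmetric]
    by (subst integrable_cong_AE[OF _ _ AE]) auto
  have "(LINT t|lborel. indicator {0..<1::real} t * f t) = (LINT t|lborel. indicator {0..1} t *\<^sub>R f t)"
    using f by (intro integral_cong_AE AE) auto
  also have "\<dots> = (if k = 0 then 1 else 0)"
  proof (cases "k = 0")
    case True
    then have "f = (\<lambda>t. 1)"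
      by (auto simp: f_def)
    then show ?thesis
      using True by simp
  next
    case False
    define c where "c = 2 * complex_of_real pi * of_int k * \<i>"
    have c: "c \<noteq> 0"
      using False by (simp add: c_def)
    have f_exp: "f = (\<lambda>t. exp (c * of_real t))"
      by (auto simp: f_def c_def cis_conv_exp mult_ac)
    have "(LINT t|lborel. indicator {0..1} t *\<^sub>R f t) = f 1 / c - f 0 / c"
    proof (rule integral_FTC_Icc)
      fix t :: real
      show "((\<lambda>t. f t / c) has_vector_derivative f t) (at t within {0..1})"
        unfolding f_exp using c
        by (auto intro!: derivative_eq_intros has_vector_derivative_real_field)
    qed (auto intro: cont)
    also have "f 1 = f 0"
      by (simp add: f_def)
    finally show ?thesis
      using False by simp
  qed
  finally show ?A
    by (simp add: f_def)
qed

lemma cis_sum: "finite A \<Longrightarrow> cis (\<Sum>i\<in>A. f i) = (\<Prod>i\<in>A. cis (f i))"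
  by (induction A rule: finite_induct) (auto simp flip: cis_mult)

text \<open>Fourier coefficients of the constant 1 on the torus, a product of one-dimensional ones.
  This is how a constant periodization turns into orthonormal shifts.\<close>

lemma integral_exp_unit_cube:
  fixes k :: "int^'d"
  shows "(LINT x|lborel. indicator unit_cube x * cis (2 * pi * (rvec k \<bullet> x))) = (if k = 0 then 1 else 0)"
proof -
  have eq: "indicator unit_cube x * cis (2 * pi * (rvec k \<bullet> x))
      = (\<Prod>i\<in>UNIV. indicator {0..<1} (x $ i) * cis (2 * pi * (of_int (k $ i) * x $ i)))" for x :: "real^'d"
  proof (cases "x \<in> unit_cube")
    case True
    then show ?thesis
      by (simp add: unit_cube_def indicator_def inner_vec_def rvec_def sum_distrib_left cis_sum)
  next
    case False
    then obtain i where "x $ i \<notin> {0..<1}"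
      by (auto simp: unit_cube_def)
    then have "indicator {0..<1} (x $ i) * cis (2 * pi * (of_int (k $ i) * x $ i)) = 0"
      by simp
    then have "(\<Prod>i\<in>UNIV. indicator {0..<1} (x $ i) * cis (2 * pi * (of_int (k $ i) * x $ i))) = 0"
      by (intro prod_zero) auto
    with False show ?thesis
      by simp
  qed
  show ?thesis
    unfolding eq
    by (subst integral_lborel_prod(1)) (auto simp: integral_exp_interval vec_eq_iff)
qed

section \<open>The Plancherel theorem\<close>

subsection \<open>Continuity of translations\<close>

lemma L2_translate: "f \<in> L2 \<Longrightarrow> (\<lambda>x. f (x + c)) \<in> L2"
  using integrable_translate_iff[of "\<lambda>x. (cmod (f x))\<^sup>2" c] by (auto simp: L2_iff)

lemma l2_norm_translate:
  assumes "f \<in> L2"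
  shows "l2_norm (\<lambda>x. f (x + c)) = l2_norm f"
  unfolding l2_norm_def using integral_translate[of "\<lambda>x. (cmod (f x))\<^sup>2" c] assms
  by (simp add: L2_iff)

text \<open>A three-epsilon argument: translations are isometries, so the error of an approximant is
  the same before and after translation, uniformly in \<open>n\<close>.\<close>

lemma translate_tendsto_closed:
  fixes s :: "nat \<Rightarrow> real^'d \<Rightarrow> complex"
  assumes s: "l2_tendsto s f sequentially"
    and cont: "\<And>i. l2_tendsto (\<lambda>n x. s i (x + t n)) (s i) sequentially"
  shows "l2_tendsto (\<lambda>n x. f (x + t n)) f sequentially"
proof -
  have L: "s i \<in> L2" "f \<in> L2" for i
    using s by (auto simp: l2_tendsto_def)
  have "(\<lambda>n. l2_norm (\<lambda>x. f (x + t n) - f x)) \<longlonglongrightarrow> 0"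
  proof (rule LIMSEQ_I)
    fix e :: real assume e: "0 < e"
    have "\<forall>\<^sub>F i in sequentially. l2_norm (\<lambda>x. s i x - f x) < e / 3"
      using s e by (intro order_tendstoD) (auto simp: l2_tendsto_def)
    then obtain i where i: "l2_norm (\<lambda>x. s i x - f x) < e / 3"
      by (auto simp: eventually_sequentially)
    have "\<forall>\<^sub>F n in sequentially. l2_norm (\<lambda>x. s i (x + t n) - s i x) < e / 3"
      using cont[of i] e by (intro order_tendstoD) (auto simp: l2_tendsto_def)
    then obtain N where N: "\<And>n. n \<ge> N \<Longrightarrow> l2_norm (\<lambda>x. s i (x + t n) - s i x) < e / 3"
      by (auto simp: eventually_sequentially)
    have "norm (l2_norm (\<lambda>x. f (x + t n) - f x) - 0) < e" if "n \<ge> N" for n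
    proof -
      have "l2_norm (\<lambda>x. f (x + t n) - f x)
          \<le> l2_norm (\<lambda>x. f (x + t n) - s i (x + t n)) + l2_norm (\<lambda>x. s i (x + t n) - f x)"
        by (intro l2_norm_triangle_diff L2_translate L)
      also have "l2_norm (\<lambda>x. s i (x + t n) - f x) \<le> l2_norm (\<lambda>x. s i (x + t n) - s i x) + l2_norm (\<lambda>x. s i x - f x)"
        by (intro l2_norm_triangle_diff L2_translate L)
      also have "l2_norm (\<lambda>x. f (x + t n) - s i (x + t n)) = l2_norm (\<lambda>x. s i x - f x)"
        using l2_norm_translate[OF L2_diff[OF L(2) L(1)[of i]], of "t n"] l2_norm_minus_commute[of f "s i"]
        by simp
      finally show ?thesis
        using i N[OF that] by simp
    qed
    then show "\<exists>N. \<forall>n\<ge>N. norm (l2_norm (\<lambda>x. f (x + t n) - f x) - 0) < e"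
      by blast
  qed
  then show ?thesis
    by (auto simp: l2_tendsto_def L L2_translate)
qed

text \<open>With equal norms, the squared distance is 2 times the squared norm of \<open>f\<close>
  minus 2 \<open>Re (l2_inner (s i) f)\<close>, so convergence of this single inner product forces
  norm convergence.\<close>

lemma l2_tendsto_inner_imp_tendsto:
  assumes L: "\<And>i. s i \<in> L2" "f \<in> L2" and norm: "\<And>i. l2_norm (s i) = l2_norm f"
    and lim: "((\<lambda>i. l2_inner (s i) f) \<longlongrightarrow> l2_inner f f) F"
  shows "l2_tendsto s f F"
proof -
  have eq: "l2_norm (\<lambda>x. s i x - f x) = sqrt (2 * (l2_norm f)\<^sup>2 - 2 * Re (l2_inner (s i) f))" for i
  proof -
    have "(l2_norm (\<lambda>x. s i x + (- 1) * f x))\<^sup>2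
        = (l2_norm (s i))\<^sup>2 + (l2_norm (\<lambda>x. (- 1) * f x))\<^sup>2 + 2 * Re (l2_inner (s i) (\<lambda>x. (- 1) * f x))"
      by (intro l2_norm_add_power2 L L2_scale)
    also have "\<dots> = 2 * (l2_norm f)\<^sup>2 - 2 * Re (l2_inner (s i) f)"
      unfolding l2_inner_scale_right l2_norm_scale by (simp add: norm)
    finally have "(l2_norm (\<lambda>x. s i x - f x))\<^sup>2 = 2 * (l2_norm f)\<^sup>2 - 2 * Re (l2_inner (s i) f)"
      by simp
    then show ?thesis
      by (metis l2_norm_nonneg real_sqrt_unique)
  qed
  have "((\<lambda>i. sqrt (2 * (l2_norm f)\<^sup>2 - 2 * Re (l2_inner (s i) f)))
      \<longlongrightarrow> sqrt (2 * (l2_norm f)\<^sup>2 - 2 * Re (l2_inner f f))) F"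
    by (intro tendsto_intros lim)
  then show ?thesis
    by (simp add: l2_tendsto_def L eq l2_inner_self del: of_real_power)
qed

lemma l2_tendsto_scale: "l2_tendsto s f F \<Longrightarrow> l2_tendsto (\<lambda>i x. a * s i x) (\<lambda>x. a * f x) F"
  unfolding l2_tendsto_def
  by (auto simp: L2_scale l2_norm_scale simp flip: right_diff_distrib intro!: tendsto_mult_right_zero)

text \<open>Only the inner product with \<open>indicator U\<close> has to converge. Points outside
  \<open>U\<close> are killed by that factor, and a point of the open set \<open>U\<close> stays
  inside under small translations.\<close>

lemma translate_tendsto_indicator_open:
  fixes U :: "(real^'d) set"
  assumes U: "open U" "emeasure lborel U < \<infinity>" and t: "t \<longlonglongrightarrow> 0"
  shows "l2_tendsto (\<lambda>n x. indicator U (x + t n)) (indicator U) sequentially"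
proof (rule l2_tendsto_inner_imp_tendsto)
  have ind: "(indicator U :: real^'d \<Rightarrow> complex) \<in> L2"
    using U by (intro indicator_L2) auto
  have [measurable]: "U \<in> sets borel"
    using U by simp
  show "(indicator U :: real^'d \<Rightarrow> complex) \<in> L2"
    by (fact ind)
  show "(\<lambda>x. indicator U (x + t n) :: complex) \<in> L2" for n
    by (rule L2_translate[OF ind])
  show "l2_norm (\<lambda>x. indicator U (x + t n)) = l2_norm (indicator U)" for n
    by (rule l2_norm_translate[OF ind])
  show "(\<lambda>n. l2_inner (\<lambda>x. indicator U (x + t n)) (indicator U)) \<longlonglongrightarrow> l2_inner (indicator U) (indicator U)"
    unfolding l2_inner_def
  proof (rule integral_dominated_convergence[where w="indicator U"])
    show "AE x in lborel. (\<lambda>n. indicator U (x + t n) * cnj (indicator U x) :: complex)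
        \<longlonglongrightarrow> indicator U x * cnj (indicator U x)"
    proof (rule AE_I2)
      fix x :: "real^'d"
      show "(\<lambda>n. indicator U (x + t n) * cnj (indicator U x) :: complex) \<longlonglongrightarrow> indicator U x * cnj (indicator U x)"
      proof (cases "x \<in> U")
        case True
        have "(\<lambda>n. x + t n) \<longlonglongrightarrow> x + 0"
          by (intro tendsto_intros t)
        then have "\<forall>\<^sub>F n in sequentially. x + t n \<in> U"
          using U(1) True by (intro topological_tendstoD) auto
        then have "\<forall>\<^sub>F n in sequentially. indicator U (x + t n) * cnj (indicator U x) = (1 :: complex)"
          by eventually_elim (use True in auto)
        then show ?thesis
          using True by (intro tendsto_eventually) auto
      qed auto
    qed
  qed (use U in \<open>auto simp: indicator_def\<close>)
qed

text \<open>Outer regularity approximates a Borel set of finite measure by open sets; the two other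
  cases of the induction are closure properties.\<close>

lemma translate_tendsto:
  fixes f :: "real^'d \<Rightarrow> complex"
  assumes f: "f \<in> L2" and t: "t \<longlonglongrightarrow> 0"
  shows "l2_tendsto (\<lambda>n x. f (x + t n)) f sequentially"
  using f
proof (induction f rule: L2_induct)
  case (indicator A c)
  have "\<exists>U. open U \<and> A \<subseteq> U \<and> emeasure lborel (U - A) < ennreal (1 / Suc i)" for i
    using outer_regular_lborel[OF indicator(1), of "1 / Suc i"] by (metis of_nat_0_less_iff zero_less_Suc zero_less_divide_1_iff)
  then obtain U where U: "\<And>i. open (U i)" "\<And>i. A \<subseteq> U i" "\<And>i. emeasure lborel (U i - A) < ennreal (1 / Suc i)"
    by metis
  have fin: "emeasure lborel (U i) < \<infinity>" for i
  proof -
    have "emeasure lborel (U i) = emeasure lborel (A \<union> (U i - A))"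
      using U(2)[of i] by (intro arg_cong[where f="emeasure lborel"]) auto
    also have "\<dots> \<le> emeasure lborel A + emeasure lborel (U i - A)"
      using U indicator by (intro emeasure_subadditive) auto
    also have "\<dots> < \<infinity>"
      using indicator(2) U(3)[of i] by (simp add: less_top) (metis ennreal_less_top order.strict_trans top.not_eq_extremum)
    finally show ?thesis .
  qed
  have lim: "l2_tendsto (\<lambda>i x. indicator (U i) x) (indicator A) sequentially"
    unfolding l2_tendsto_def
  proof (intro conjI allI)
    show "indicator (U i) \<in> L2" for i
      using U fin by (intro indicator_L2) auto
    show "indicator A \<in> L2"
      using indicator by (intro indicator_L2) auto
    have "l2_norm (\<lambda>x. indicator (U i) x - indicator A x) \<le> sqrt (1 / Suc i)" for i
    proof -
      have "(\<lambda>x. (cmod (indicator (U i) x - indicator A x))\<^sup>2) = indicator (U i - A)"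
        using U(2)[of i] by (auto simp: indicator_def fun_eq_iff)
      then have "l2_norm (\<lambda>x. indicator (U i) x - indicator A x) = sqrt (measure lborel (U i - A))"
        by (simp add: l2_norm_def)
      also have "measure lborel (U i - A) \<le> 1 / Suc i"
        using U(3)[of i] by (auto simp: measure_def intro!: enn2real_leI)
      finally show ?thesis
        by simp
    qed
    moreover have "(\<lambda>i. sqrt (1 / Suc i)) \<longlonglongrightarrow> sqrt 0"
      by (intro tendsto_real_sqrt LIMSEQ_Suc[OF lim_1_over_n])
    ultimately show "(\<lambda>i. l2_norm (\<lambda>x. indicator (U i) x - indicator A x)) \<longlonglongrightarrow> 0"
      by (intro Lim_null_comparison[where f="\<lambda>i. l2_norm (\<lambda>x. indicator (U i) x - indicator A x)",
            OF always_eventually[OF allI]]) auto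
  qed
  have "l2_tendsto (\<lambda>n x. indicator A (x + t n)) (indicator A) sequentially"
    by (rule translate_tendsto_closed[OF lim]) (use U fin t in \<open>auto intro: translate_tendsto_indicator_open\<close>)
  then show ?case
    by (rule l2_tendsto_scale)
next
  case (add f g)
  then show ?case
    using l2_tendsto_add by fastforce
next
  case (lim s f)
  then show ?case
    by (intro translate_tendsto_closed[of s f t]) auto
qed

subsection \<open>The Fourier integral on integrable functions\<close>

lemma borel_measurable_cis [measurable (raw)]:
  "f \<in> borel_measurable M \<Longrightarrow> (\<lambda>x. cis (f x)) \<in> borel_measurable M"
  by (rule measurable_compose[OF _ borel_measurable_continuous_onI]) (auto intro: continuous_intros)

lemma integrable_mult_cis:
  assumes "integrable lborel f" "h \<in> borel_measurable borel"
  shows "integrable lborel (\<lambda>x. f x * cis (h x))"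
  by (rule Bochner_Integration.integrable_bound[OF assms(1)])
    (use assms borel_measurable_integrable[OF assms(1)] in \<open>auto simp: norm_mult\<close>)

lemma integrable_fourier_integrand:
  assumes "integrable lborel f"
  shows "integrable lborel (\<lambda>x. f x * cis (- 2 * pi * (x \<bullet> \<xi>)))"
  by (rule integrable_mult_cis[OF assms]) auto

lemma borel_measurable_fourier [measurable]:
  fixes f :: "real^'d \<Rightarrow> complex"
  assumes "integrable lborel f"
  shows "fourier f \<in> borel_measurable borel"
proof -
  have [measurable]: "f \<in> borel_measurable borel"
    using borel_measurable_integrable[OF assms] by simp
  have "(\<lambda>\<xi>. LINT x|lborel. f x * cis (- 2 * pi * (x \<bullet> \<xi>))) \<in> borel_measurable borel"
    by (rule sigma_finite_measure.borel_measurable_lebesgue_integral[OF sigma_finite_lborel]) measurable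
  then show ?thesis
    by (simp add: fourier_def[abs_def])
qed

lemma fourier_add:
  assumes "integrable lborel f" "integrable lborel g"
  shows "fourier (\<lambda>x. f x + g x) \<xi> = fourier f \<xi> + fourier g \<xi>"
  unfolding fourier_def distrib_right
  by (intro Bochner_Integration.integral_add integrable_fourier_integrand assms)

lemma fourier_scale: "fourier (\<lambda>x. a * f x) \<xi> = a * fourier f \<xi>"
  unfolding fourier_def mult.assoc by simp

lemma cmod_fourier_le:
  shows "cmod (fourier f \<xi>) \<le> (LINT x|lborel. cmod (f x))"
  unfolding fourier_def by (rule order_trans[OF integral_norm_bound]) (simp add: norm_mult)

lemma fourier_cnj: "fourier (\<lambda>x. cnj (f x)) \<xi> = cnj (fourier f (- \<xi>))"
  unfolding fourier_def
  by (subst Bochner_Integration.integral_cnj[symmetric]) (simp add: cis_cnj)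

lemma fourier_translate:
  assumes "integrable lborel f"
  shows "fourier (\<lambda>x. f (x - c)) \<xi> = cis (- 2 * pi * (c \<bullet> \<xi>)) * fourier f \<xi>"
proof -
  have [measurable]: "f \<in> borel_measurable borel"
    using borel_measurable_integrable[OF assms] by simp
  have "fourier (\<lambda>x. f (x - c)) \<xi> = (LINT x|lborel. f (x + c - c) * cis (- 2 * pi * ((x + c) \<bullet> \<xi>)))"
    unfolding fourier_def
    by (rule integral_translate[of "\<lambda>x. f (x - c) * cis (- 2 * pi * (x \<bullet> \<xi>))", symmetric]) auto
  also have "\<dots> = (LINT x|lborel. cis (- 2 * pi * (c \<bullet> \<xi>)) * (f x * cis (- 2 * pi * (x \<bullet> \<xi>))))"
  proof (rule Bochner_Integration.integral_cong[OF refl])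
    fix x
    have "cis (- 2 * pi * ((x + c) \<bullet> \<xi>)) = cis (- 2 * pi * (c \<bullet> \<xi>)) * cis (- 2 * pi * (x \<bullet> \<xi>))"
      by (simp add: cis_mult inner_add_left algebra_simps)
    then show "f (x + c - c) * cis (- 2 * pi * ((x + c) \<bullet> \<xi>))
        = cis (- 2 * pi * (c \<bullet> \<xi>)) * (f x * cis (- 2 * pi * (x \<bullet> \<xi>)))"
      by simp
  qed
  also have "\<dots> = cis (- 2 * pi * (c \<bullet> \<xi>)) * fourier f \<xi>"
    unfolding fourier_def by simp
  finally show ?thesis .
qed

lemma integrable_convol_integrand:
  fixes f g :: "real^'d \<Rightarrow> complex"
  assumes f: "integrable lborel f" and g: "integrable lborel g"
  shows "integrable (lborel \<Otimes>\<^sub>M lborel) (\<lambda>(y, x). f y * g (x - y))"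
proof (rule lborel_pair.Fubini_integrable)
  have [measurable]: "f \<in> borel_measurable borel" "g \<in> borel_measurable borel"
    using borel_measurable_integrable[OF f] borel_measurable_integrable[OF g] by simp_all
  show "(\<lambda>(y, x). f y * g (x - y)) \<in> borel_measurable (lborel \<Otimes>\<^sub>M lborel)"
    by measurable
  have "(LINT x|lborel. norm (f y * g (x - y))) = cmod (f y) * (LINT x|lborel. cmod (g x))" for y
    using integral_translate[of "\<lambda>x. cmod (g x)" "- y"] by (simp add: norm_mult)
  then show "integrable lborel (\<lambda>y. LINT x|lborel. norm (case (y, x) of (y, x) \<Rightarrow> f y * g (x - y)))"
    using f by simp
  show "AE y in lborel. integrable lborel (\<lambda>x. case (y, x) of (y, x) \<Rightarrow> f y * g (x - y))"
    using g integrable_translate_iff[of g] by (auto intro!: integrable_mult_right simp flip: add_uminus_conv_diff)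
qed

lemma
  assumes f: "integrable lborel f" and g: "integrable lborel g"
  shows integrable_convol: "integrable lborel (convol f g)"
    and integral_convol: "(LINT x|lborel. convol f g x) = (LINT x|lborel. f x) * (LINT x|lborel. g x)"
proof -
  have [measurable]: "f \<in> borel_measurable borel" "g \<in> borel_measurable borel"
    using borel_measurable_integrable[OF f] borel_measurable_integrable[OF g] by simp_all
  note int = integrable_convol_integrand[OF f g]
  show "integrable lborel (convol f g)"
    using lborel_pair.integrable_snd[OF int] by (simp add: convol_def[abs_def])
  have "(LINT x|lborel. convol f g x) = (LINT y|lborel. LINT x|lborel. f y * g (x - y))"
    unfolding convol_def by (rule lborel_pair.Fubini_integral[OF int])
  also have "\<dots> = (LINT y|lborel. f y * (LINT x|lborel. g x))"
    using integral_translate[of g] by (simp flip: add_uminus_conv_diff)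
  finally show "(LINT x|lborel. convol f g x) = (LINT x|lborel. f x) * (LINT x|lborel. g x)"
    by simp
qed

text \<open>A character splits as \<open>e y * e (x - y)\<close>, so it can be absorbed into both
  factors; what remains is the integral of a convolution.\<close>

lemma fourier_convol:
  assumes f: "integrable lborel f" and g: "integrable lborel g"
  shows "fourier (convol f g) \<xi> = fourier f \<xi> * fourier g \<xi>"
proof -
  define e where "e x = cis (- 2 * pi * (x \<bullet> \<xi>))" for x
  have e: "e y * e (x - y) = e x" for x y
    by (simp add: e_def cis_mult inner_diff_left algebra_simps)
  have "convol f g x * e x = convol (\<lambda>x. f x * e x) (\<lambda>x. g x * e x) x" for x
    unfolding convol_def using e[of _ x]
    by (subst Bochner_Integration.integral_mult_left_zero[symmetric])
      (intro Bochner_Integration.integral_cong, auto simp: mult_ac)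
  then have "(LINT x|lborel. convol f g x * e x) = (LINT x|lborel. convol (\<lambda>x. f x * e x) (\<lambda>x. g x * e x) x)"
    by simp
  moreover have "fourier (convol f g) \<xi> = (LINT x|lborel. convol f g x * e x)"
    by (simp add: fourier_def e_def)
  ultimately have "fourier (convol f g) \<xi> = (LINT x|lborel. convol (\<lambda>x. f x * e x) (\<lambda>x. g x * e x) x)"
    by simp
  also have "\<dots> = fourier f \<xi> * fourier g \<xi>"
    unfolding fourier_def e_def
    by (intro integral_convol integrable_fourier_integrand f g)
  finally show ?thesis .
qed

text \<open>Fubini for the symmetric kernel. It moves the transform onto a Gaussian, where it is
  explicit.\<close>

lemma fourier_multiplication_formula:
  assumes f: "integrable lborel f" and g: "integrable lborel g"
  shows "(LINT \<xi>|lborel. fourier f \<xi> * g \<xi>) = (LINT x|lborel. f x * fourier g x)"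
proof -
  have [measurable]: "f \<in> borel_measurable borel" "g \<in> borel_measurable borel"
    using borel_measurable_integrable[OF f] borel_measurable_integrable[OF g] by simp_all
  have int: "integrable (lborel \<Otimes>\<^sub>M lborel) (\<lambda>(x, \<xi>). f x * cis (- 2 * pi * (x \<bullet> \<xi>)) * g \<xi>)"
  proof (rule lborel_pair.Fubini_integrable)
    show "(\<lambda>(x, \<xi>). f x * cis (- 2 * pi * (x \<bullet> \<xi>)) * g \<xi>) \<in> borel_measurable (lborel \<Otimes>\<^sub>M lborel)"
      by measurable
    show "integrable lborel (\<lambda>x. LINT \<xi>|lborel. norm (case (x, \<xi>) of (x, \<xi>) \<Rightarrow> f x * cis (- 2 * pi * (x \<bullet> \<xi>)) * g \<xi>))"
      using f by (simp add: norm_mult)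
    show "AE x in lborel. integrable lborel (\<lambda>\<xi>. case (x, \<xi>) of (x, \<xi>) \<Rightarrow> f x * cis (- 2 * pi * (x \<bullet> \<xi>)) * g \<xi>)"
    proof (rule AE_I2)
      fix x
      have "integrable lborel (\<lambda>\<xi>. f x * (g \<xi> * cis (- 2 * pi * (x \<bullet> \<xi>))))"
        by (intro integrable_mult_right integrable_mult_cis g) auto
      then show "integrable lborel (\<lambda>\<xi>. case (x, \<xi>) of (x, \<xi>) \<Rightarrow> f x * cis (- 2 * pi * (x \<bullet> \<xi>)) * g \<xi>)"
        by (simp add: mult_ac)
    qed
  qed
  have "(LINT \<xi>|lborel. fourier f \<xi> * g \<xi>) = (LINT \<xi>|lborel. LINT x|lborel. f x * cis (- 2 * pi * (x \<bullet> \<xi>)) * g \<xi>)"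
    by (simp add: fourier_def)
  also have "\<dots> = (LINT x|lborel. LINT \<xi>|lborel. f x * cis (- 2 * pi * (x \<bullet> \<xi>)) * g \<xi>)"
    by (rule lborel_pair.Fubini_integral[OF int])
  also have "\<dots> = (LINT x|lborel. LINT \<xi>|lborel. f x * (g \<xi> * cis (- 2 * pi * (\<xi> \<bullet> x))))"
    by (intro Bochner_Integration.integral_cong) (auto simp: inner_commute mult_ac)
  also have "\<dots> = (LINT x|lborel. f x * fourier g x)"
    by (simp add: fourier_def)
  finally show ?thesis .
qed

subsection \<open>Gaussian regularization\<close>

text \<open>The standard normal density, kept as a product so that its integrals factor through the
  coordinates.\<close>

definition gauss :: "real^'d \<Rightarrow> real" where
  "gauss v = (\<Prod>i\<in>UNIV. std_normal_density (v $ i))"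

lemma gauss_nonneg: "0 \<le> gauss v"
  by (simp add: gauss_def prod_nonneg)

lemma integrable_gauss: "integrable lborel (gauss :: real^'d \<Rightarrow> real)"
  and integral_gauss: "(LINT v|lborel. gauss (v :: real^'d)) = 1"
  unfolding gauss_def[abs_def]
  by (rule integral_lborel_prod(2), simp) (subst integral_lborel_prod(1), simp_all)

lemma borel_measurable_gauss [measurable]: "gauss \<in> borel_measurable borel"
  using borel_measurable_integrable[OF integrable_gauss] by simp

lemma gauss_conv_exp:
  "gauss (v :: real^'d) = (1 / sqrt (2 * pi)) ^ CARD('d) * exp (- (v \<bullet> v) / 2)"
proof -
  have "gauss v = (\<Prod>i\<in>UNIV. (1 / sqrt (2 * pi)) * exp (- (v $ i)\<^sup>2 / 2))"
    by (simp add: gauss_def std_normal_density_def)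
  also have "\<dots> = (1 / sqrt (2 * pi)) ^ CARD('d) * exp (\<Sum>i\<in>UNIV. - (v $ i)\<^sup>2 / 2)"
    by (simp only: prod.distrib prod_constant exp_sum[OF finite])
  also have "(\<Sum>i\<in>UNIV. - (v $ i)\<^sup>2 / 2) = - (v \<bullet> v) / 2"
    by (simp add: inner_vec_def power2_eq_square sum_negf flip: sum_divide_distrib)
  finally show ?thesis .
qed

lemma integral_std_normal_cis:
  "(LINT t|lborel. std_normal_density t * cis (s * t)) = complex_of_real (exp (- s\<^sup>2 / 2))"
proof -
  have "complex_of_real (exp (- s\<^sup>2 / 2)) = char std_normal_distribution s"
    by (simp add: char_std_normal_distribution)
  also have "\<dots> = (LINT t|lborel. std_normal_density t *\<^sub>R iexp (s * t))"
    unfolding char_def by (subst integral_density) (auto simp: normal_density_nonneg)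
  also have "\<dots> = (LINT t|lborel. std_normal_density t * cis (s * t))"
    by (intro Bochner_Integration.integral_cong) (auto simp: cis_conv_exp scaleR_conv_of_real)
  finally show ?thesis ..
qed

lemma integral_gauss_cis:
  fixes u :: "real^'d"
  shows "(LINT v|lborel. gauss v * cis (u \<bullet> v)) = complex_of_real (exp (- (u \<bullet> u) / 2))"
proof -
  have "gauss v * cis (u \<bullet> v) = (\<Prod>i\<in>UNIV. std_normal_density (v $ i) * cis (u $ i * v $ i))" for v
    by (simp add: gauss_def inner_vec_def cis_sum prod.distrib)
  then have "(LINT v|lborel. gauss v * cis (u \<bullet> v))
      = (LINT v|lborel. (\<Prod>i\<in>UNIV. std_normal_density ((v :: real^'d) $ i) * cis (u $ i * v $ i)))"
    by simp
  also have "\<dots> = (\<Prod>i\<in>UNIV. LINT t|lborel. std_normal_density t * cis (u $ i * t))"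
    by (rule integral_lborel_prod) (auto intro!: integrable_mult_cis integrable_of_real)
  also have "\<dots> = (\<Prod>i\<in>UNIV. of_real (exp (- (u $ i)\<^sup>2 / 2)))"
    by (simp only: integral_std_normal_cis)
  also have "\<dots> = of_real (exp (\<Sum>i\<in>UNIV. - (u $ i)\<^sup>2 / 2))"
    by (simp only: exp_sum[OF finite] of_real_prod)
  also have "(\<Sum>i\<in>UNIV. - (u $ i)\<^sup>2 / 2) = - (u \<bullet> u) / 2"
    by (simp add: inner_vec_def power2_eq_square sum_negf flip: sum_divide_distrib)
  finally show ?thesis .
qed

lemma
  fixes f :: "real^'d \<Rightarrow> 'b::{banach, second_countable_topology}"
  assumes f: "f \<in> borel_measurable borel" and c: "c > 0"
  shows integral_dilate: "(LINT x|lborel. f x) = c ^ CARD('d) *\<^sub>R (LINT x|lborel. f (c *\<^sub>R x))"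
    and integrable_dilate_iff: "integrable lborel (\<lambda>x. f (c *\<^sub>R x)) \<longleftrightarrow> integrable lborel f"
proof -
  have "(mat c :: real^'d^'d) *v x = c *\<^sub>R x" for x
  proof -
    have "((mat c :: real^'d^'d) *v x) $ i = (\<Sum>j\<in>UNIV. if i = j then c * x $ j else 0)" for i
      unfolding matrix_vector_mult_def mat_def vec_lambda_beta by (intro sum.cong) auto
    then show ?thesis
      by (simp add: vec_eq_iff)
  qed
  moreover have "det (mat c :: real^'d^'d) = c ^ CARD('d)"
    by (subst det_diagonal) (simp_all add: mat_def)
  ultimately show "(LINT x|lborel. f x) = c ^ CARD('d) *\<^sub>R (LINT x|lborel. f (c *\<^sub>R x))"
    "integrable lborel (\<lambda>x. f (c *\<^sub>R x)) \<longleftrightarrow> integrable lborel f"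
    using integral_matrix[of "mat c" f] integrable_matrix_iff[of "mat c" f] f c by simp_all
qed

text \<open>Scaled so that its transform is the normal density \<open>gauss\<close> compressed by
  the factor \<open>c\<close>, of total mass 1. As \<open>c\<close> grows, the weight increases to 1
  at every point.\<close>

definition gauss_weight :: "real \<Rightarrow> real^'d \<Rightarrow> real" where
  "gauss_weight c \<xi> = exp (- ((2 * pi / c) *\<^sub>R \<xi> \<bullet> (2 * pi / c) *\<^sub>R \<xi>) / 2)"

lemma borel_measurable_gauss_weight [measurable]: "gauss_weight c \<in> borel_measurable borel"
  unfolding gauss_weight_def[abs_def] by measurable

lemma gauss_weight_conv_gauss:
  "gauss_weight c (\<xi> :: real^'d) = sqrt (2 * pi) ^ CARD('d) * gauss ((2 * pi / c) *\<^sub>R \<xi>)"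
  by (simp add: gauss_weight_def gauss_conv_exp power_divide)

lemma integrable_gauss_weight:
  assumes "c > 0"
  shows "integrable lborel (gauss_weight c :: real^'d \<Rightarrow> real)"
  unfolding gauss_weight_conv_gauss[abs_def] using assms
  by (intro integrable_mult_right) (subst integrable_dilate_iff, auto intro: integrable_gauss)

lemma fourier_gauss_weight:
  fixes z :: "real^'d"
  assumes c: "c > 0"
  shows "fourier (\<lambda>\<xi>. complex_of_real (gauss_weight c \<xi>)) z = of_real (c ^ CARD('d) * gauss (c *\<^sub>R z))"
proof -
  \<comment> \<open>The substitution by \<open>a\<close> turns the weight into a multiple of
    \<open>gauss v\<close> and absorbs the 2 pi of the character.\<close>
  define a where "a = c / (2 * pi)"
  have a: "a > 0" "2 * pi / c * a = 1" "2 * pi * a = c"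
    using c by (auto simp: a_def)
  have "fourier (\<lambda>\<xi>. complex_of_real (gauss_weight c \<xi>)) z
      = a ^ CARD('d) *\<^sub>R (LINT v|lborel. complex_of_real (gauss_weight c (a *\<^sub>R v)) * cis (- 2 * pi * (a *\<^sub>R v \<bullet> z)))"
    unfolding fourier_def
    by (rule integral_dilate[OF _ a(1)]) measurable
  also have "(\<lambda>v. complex_of_real (gauss_weight c (a *\<^sub>R v)) * cis (- 2 * pi * (a *\<^sub>R v \<bullet> z)))
      = (\<lambda>v. of_real (sqrt (2 * pi) ^ CARD('d)) * (gauss v * cis ((- c *\<^sub>R z) \<bullet> v)))"
  proof
    fix v :: "real^'d"
    have "- 2 * pi * (a *\<^sub>R v \<bullet> z) = (- c *\<^sub>R z) \<bullet> v"
      using a(3) by (simp add: inner_commute)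
    moreover have "gauss_weight c (a *\<^sub>R v) = sqrt (2 * pi) ^ CARD('d) * gauss v"
      using a(1,2) by (simp add: gauss_weight_conv_gauss)
    ultimately show "complex_of_real (gauss_weight c (a *\<^sub>R v)) * cis (- 2 * pi * (a *\<^sub>R v \<bullet> z))
        = of_real (sqrt (2 * pi) ^ CARD('d)) * (gauss v * cis ((- c *\<^sub>R z) \<bullet> v))"
      by (simp only: of_real_mult mult.assoc)
  qed
  also have "(LINT v|lborel. of_real (sqrt (2 * pi) ^ CARD('d)) * (gauss v * cis ((- c *\<^sub>R z) \<bullet> v)))
      = complex_of_real (sqrt (2 * pi) ^ CARD('d) * exp (- (c *\<^sub>R z \<bullet> c *\<^sub>R z) / 2))"
    by (simp only: integral_mult_right_zero integral_gauss_cis) simp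
  also have "a ^ CARD('d) *\<^sub>R complex_of_real (sqrt (2 * pi) ^ CARD('d) * exp (- (c *\<^sub>R z \<bullet> c *\<^sub>R z) / 2))
      = of_real ((a * sqrt (2 * pi)) ^ CARD('d) * exp (- (c *\<^sub>R z \<bullet> c *\<^sub>R z) / 2))"
    by (simp add: power_mult_distrib scaleR_conv_of_real)
  also have "a * sqrt (2 * pi) = c * (1 / sqrt (2 * pi))"
    by (simp add: a_def field_simps)
  finally show ?thesis
    by (simp add: gauss_conv_exp power_mult_distrib power_divide)
qed

text \<open>Fourier inversion at 0 in regularized form: for large \<open>c\<close> the left side
  approaches the integral of the transform, while the right side averages \<open>F\<close> ever
  closer to 0.\<close>

lemma autocorrelation_regularized:
  fixes F :: "real^'d \<Rightarrow> complex"
  assumes F: "integrable lborel F" and c: "c > 0"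
  shows "(LINT \<xi>|lborel. fourier F \<xi> * gauss_weight c \<xi>) = (LINT v|lborel. gauss v * F (v /\<^sub>R c))"
proof -
  have [measurable]: "F \<in> borel_measurable borel"
    using borel_measurable_integrable[OF F] by simp
  have "(LINT \<xi>|lborel. fourier F \<xi> * gauss_weight c \<xi>)
      = (LINT x|lborel. F x * fourier (\<lambda>\<xi>. complex_of_real (gauss_weight c \<xi>)) x)"
    by (intro fourier_multiplication_formula F integrable_of_real integrable_gauss_weight c)
  also have "\<dots> = (LINT x|lborel. c ^ CARD('d) *\<^sub>R (gauss (c *\<^sub>R x) * F x))"
    by (simp add: fourier_gauss_weight[OF c] scaleR_conv_of_real mult_ac)
  also have "\<dots> = c ^ CARD('d) *\<^sub>R (LINT x|lborel. (gauss (c *\<^sub>R x) * F ((c *\<^sub>R x) /\<^sub>R c)))"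
    using c by simp
  also have "\<dots> = (LINT v|lborel. gauss v * F (v /\<^sub>R c))"
    by (rule integral_dilate[OF _ c, symmetric]) auto
  finally show ?thesis .
qed

subsection \<open>The isometry property\<close>

text \<open>The autocorrelation \<open>F\<close> of \<open>f\<close> has transform the squared
  modulus of \<open>fourier f\<close>, and \<open>F 0\<close> is the squared norm of
  \<open>f\<close>. \<open>F\<close> is bounded by Cauchy-Schwarz and continuous at 0 by continuity
  of translations, so the regularized inversion formula converges to that norm.\<close>

theorem plancherel:
  fixes f :: "real^'d \<Rightarrow> complex"
  assumes f: "f \<in> L2" and int: "integrable lborel f"
  shows "fourier f \<in> L2" and "l2_norm (fourier f) = l2_norm f"
proof -
  have [measurable]: "f \<in> borel_measurable borel"
    using f by (auto simp: L2_iff)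
  define h where "h x = cnj (f (- x))" for x
  define F where "F = convol f h"
  have h: "integrable lborel h"
    using int integrable_reflect_iff[of "\<lambda>x. cnj (f x)"] by (simp add: h_def[abs_def])
  have F: "integrable lborel F"
    unfolding F_def by (rule integrable_convol[OF int h])
  have F_inner: "F z = l2_inner (\<lambda>x. f (x + z)) f" for z
    unfolding F_def convol_def l2_inner_def h_def
    using integral_translate[of "\<lambda>y. f y * cnj (f (y - z))" z] by simp
  have fourier_h: "fourier h \<xi> = cnj (fourier f \<xi>)" for \<xi>
  proof -
    have "fourier h \<xi> = (LINT x|lborel. cnj (f (- x)) * cis (- 2 * pi * (- (- x) \<bullet> \<xi>)))"
      by (simp add: fourier_def h_def)
    also have "\<dots> = (LINT x|lborel. cnj (f x) * cis (- 2 * pi * (- x \<bullet> \<xi>)))"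
      by (rule integral_reflect[of "\<lambda>x. cnj (f x) * cis (- 2 * pi * (- x \<bullet> \<xi>))"]) auto
    also have "\<dots> = cnj (fourier f \<xi>)"
      unfolding fourier_def by (subst Bochner_Integration.integral_cnj[symmetric]) (simp add: cis_cnj)
    finally show ?thesis .
  qed
  have fourier_F: "fourier F \<xi> = of_real ((cmod (fourier f \<xi>))\<^sup>2)" for \<xi>
    unfolding F_def fourier_convol[OF int h] fourier_h by (simp only: complex_norm_square)
  define N where "N = (l2_norm f)\<^sup>2"
  have F_bound: "cmod (F z) \<le> N" for z
    unfolding F_inner N_def power2_eq_square
    using cmod_l2_inner_le[OF L2_translate[OF f] f, of z] by (simp add: l2_norm_translate f)
  have lim: "(\<lambda>n. LINT v|lborel. gauss v * F (v /\<^sub>R real (Suc n))) \<longlonglongrightarrow> (LINT v|lborel. gauss (v :: real^'d) * F 0)"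
  proof (rule integral_dominated_convergence[where w="\<lambda>v. gauss v * N"])
    show "integrable lborel (\<lambda>v::real^'d. gauss v * N)"
      by (intro integrable_mult_left integrable_gauss)
    have [measurable]: "F \<in> borel_measurable borel"
      using borel_measurable_integrable[OF F] by simp
    show "(\<lambda>v. gauss v * F (v /\<^sub>R real (Suc n))) \<in> borel_measurable lborel" for n
      by measurable
    show "AE v in lborel. norm (gauss v * F (v /\<^sub>R real (Suc n))) \<le> gauss v * N" for n
      using F_bound by (auto simp: norm_mult gauss_nonneg intro!: mult_left_mono)
    show "AE v in lborel. (\<lambda>n. gauss v * F (v /\<^sub>R real (Suc n))) \<longlonglongrightarrow> gauss v * F 0"
    proof (rule AE_I2)
      fix v :: "real^'d"
      have "(\<lambda>n. v /\<^sub>R real (Suc n)) \<longlonglongrightarrow> 0 *\<^sub>R v"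
        by (intro tendsto_scaleR LIMSEQ_inverse_real_of_nat tendsto_const)
      then have "(\<lambda>n. F (v /\<^sub>R real (Suc n))) \<longlonglongrightarrow> F 0"
        unfolding F_inner
        using l2_tendsto_inner[OF translate_tendsto[OF f] l2_tendsto_const[OF f]] by simp
      then show "(\<lambda>n. gauss v * F (v /\<^sub>R real (Suc n))) \<longlonglongrightarrow> gauss v * F 0"
        by (intro tendsto_mult_left)
    qed
  qed auto
  have F0: "(LINT v|lborel. gauss (v :: real^'d) * F 0) = of_real N"
  proof -
    have "(LINT v|lborel. gauss (v :: real^'d) * F 0) = of_real (LINT v|lborel. gauss (v :: real^'d)) * F 0"
      by (simp only: integral_mult_left_zero integral_complex_of_real)
    then show ?thesis
      by (simp add: integral_gauss F_inner l2_inner_self N_def)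
  qed
  have reg: "(LINT \<xi>|lborel. (cmod (fourier f \<xi>))\<^sup>2 * gauss_weight (Suc n) \<xi>)
      = Re (LINT v|lborel. gauss v * F (v /\<^sub>R real (Suc n)))" for n
  proof -
    have "(LINT v|lborel. gauss v * F (v /\<^sub>R real (Suc n)))
        = (LINT \<xi>|lborel. complex_of_real ((cmod (fourier f \<xi>))\<^sup>2 * gauss_weight (Suc n) \<xi>))"
      using autocorrelation_regularized[OF F, of "real (Suc n)"] by (simp add: fourier_F)
    then show ?thesis
      by (simp only: integral_complex_of_real Re_complex_of_real)
  qed
  have fm [measurable]: "fourier f \<in> borel_measurable borel"
    by (rule borel_measurable_fourier[OF int])
  \<comment> \<open>The weights increase with \<open>n\<close>, so monotone convergence delivers
    integrability together with the value of the integral.\<close>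
  have mono: "gauss_weight (Suc m) \<xi> \<le> gauss_weight (Suc n) \<xi>" if "m \<le> n" for m n and \<xi> :: "real^'d"
    unfolding gauss_weight_def using that
    by (auto intro!: mult_mono divide_left_mono divide_right_mono mult_right_mono)
  \<comment> \<open>\<open>fourier f\<close> is bounded by the L1 norm of \<open>f\<close>, hence
    the Gaussian weight alone secures integrability.\<close>
  have int_reg: "integrable lborel (\<lambda>\<xi>. (cmod (fourier f \<xi>))\<^sup>2 * gauss_weight (Suc n) \<xi>)" for n
  proof (rule Bochner_Integration.integrable_bound)
    show "integrable lborel (\<lambda>\<xi>. (LINT x|lborel. cmod (f x))\<^sup>2 * gauss_weight (Suc n) (\<xi> :: real^'d))"
      by (intro integrable_mult_right integrable_gauss_weight) auto
    show "(\<lambda>\<xi>. (cmod (fourier f \<xi>))\<^sup>2 * gauss_weight (Suc n) \<xi>) \<in> borel_measurable lborel"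
      by measurable
    show "AE \<xi> in lborel. norm ((cmod (fourier f \<xi>))\<^sup>2 * gauss_weight (Suc n) \<xi>)
        \<le> norm ((LINT x|lborel. cmod (f x))\<^sup>2 * gauss_weight (Suc n) \<xi>)"
      using cmod_fourier_le[of f]
      by (auto simp: gauss_weight_def intro!: mult_right_mono power_mono)
  qed
  have AE_mono: "AE \<xi> in lborel. mono (\<lambda>n. (cmod (fourier f \<xi>))\<^sup>2 * gauss_weight (Suc n) \<xi>)"
    by (intro AE_I2 monoI mult_left_mono mono) auto
  have AE_lim: "AE \<xi> in lborel. (\<lambda>n. (cmod (fourier f \<xi>))\<^sup>2 * gauss_weight (Suc n) \<xi>) \<longlonglongrightarrow> (cmod (fourier f \<xi>))\<^sup>2"
  proof (rule AE_I2)
    fix \<xi> :: "real^'d"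
    have "(\<lambda>n. 2 * pi * inverse (real (Suc n))) \<longlonglongrightarrow> 2 * pi * 0"
      by (intro tendsto_mult_left LIMSEQ_inverse_real_of_nat)
    then have "(\<lambda>n. 2 * pi / real (Suc n)) \<longlonglongrightarrow> 0"
      by (simp add: divide_inverse)
    then have "(\<lambda>n. (cmod (fourier f \<xi>))\<^sup>2 * gauss_weight (Suc n) \<xi>)
        \<longlonglongrightarrow> (cmod (fourier f \<xi>))\<^sup>2 * exp (- (0 *\<^sub>R \<xi> \<bullet> 0 *\<^sub>R \<xi>) / 2)"
      unfolding gauss_weight_def by (intro tendsto_intros) auto
    then show "(\<lambda>n. (cmod (fourier f \<xi>))\<^sup>2 * gauss_weight (Suc n) \<xi>) \<longlonglongrightarrow> (cmod (fourier f \<xi>))\<^sup>2"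
      by simp
  qed
  have int_lim: "(\<lambda>n. LINT \<xi>|lborel. (cmod (fourier f \<xi>))\<^sup>2 * gauss_weight (Suc n) \<xi>) \<longlonglongrightarrow> N"
    unfolding reg using tendsto_Re[OF lim] by (simp only: F0 Re_complex_of_real)
  have "integrable lborel (\<lambda>\<xi>. (cmod (fourier f \<xi>))\<^sup>2)"
    by (rule integrable_monotone_convergence[OF int_reg AE_mono AE_lim int_lim]) measurable
  moreover have "(LINT \<xi>|lborel. (cmod (fourier f \<xi>))\<^sup>2) = N"
    by (rule integral_monotone_convergence[OF int_reg AE_mono AE_lim int_lim]) measurable
  ultimately show "fourier f \<in> L2" "l2_norm (fourier f) = l2_norm f"
    by (auto simp: L2_iff l2_norm_def N_def)
qed

text \<open>Polarization: the norm identity for \<open>f + a g\<close> determines the real part of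
  \<open>cnj a\<close> times the inner product; \<open>a = 1\<close> and \<open>a = \<i>\<close>
  give both parts.\<close>

corollary plancherel_inner:
  fixes f g :: "real^'d \<Rightarrow> complex"
  assumes f: "f \<in> L2" "integrable lborel f" and g: "g \<in> L2" "integrable lborel g"
  shows "l2_inner (fourier f) (fourier g) = l2_inner f g"
proof -
  have *: "Re (cnj a * l2_inner (fourier f) (fourier g)) = Re (cnj a * l2_inner f g)" for a
  proof -
    have ag: "(\<lambda>x. a * g x) \<in> L2" "integrable lborel (\<lambda>x. a * g x)"
      using g by (auto intro: L2_scale)
    have eq: "fourier (\<lambda>x. f x + a * g x) = (\<lambda>\<xi>. fourier f \<xi> + a * fourier g \<xi>)"
      using fourier_add[OF f(2) ag(2)] by (auto simp: fourier_scale)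
    have "(l2_norm (\<lambda>\<xi>. fourier f \<xi> + a * fourier g \<xi>))\<^sup>2 = (l2_norm (\<lambda>x. f x + a * g x))\<^sup>2"
      using plancherel(2)[of "\<lambda>x. f x + a * g x"] f ag by (simp add: L2_add eq)
    then show ?thesis
      using f g ag plancherel[OF f] plancherel[OF g]
      by (simp add: l2_norm_add_power2 L2_scale l2_norm_scale l2_inner_scale_right)
  qed
  show ?thesis
    using *[of 1] *[of "\<i>"] by (simp add: complex_eq_iff)
qed

text \<open>The isometry holds along the integrable approximants of both functions, and inner
  products pass to the limit. All later facts about \<open>\<phi>1\<close> enter through this
  identity.\<close>

lemma fourier_l2_inner:
  assumes f: "is_fourier_l2 f f'" and g: "is_fourier_l2 g g'"
  shows "l2_inner f g = l2_inner f' g'"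
proof -
  from f obtain s where s: "\<And>n. integrable lborel (s n)" "l2_tendsto s f sequentially"
    "l2_tendsto (\<lambda>n. fourier (s n)) f' sequentially"
    by (auto simp: is_fourier_l2_def)
  from g obtain t where t: "\<And>n. integrable lborel (t n)" "l2_tendsto t g sequentially"
    "l2_tendsto (\<lambda>n. fourier (t n)) g' sequentially"
    by (auto simp: is_fourier_l2_def)
  have L: "s n \<in> L2" "t n \<in> L2" for n
    using s(2) t(2) by (auto simp: l2_tendsto_def)
  have "(\<lambda>n. l2_inner (s n) (t n)) \<longlonglongrightarrow> l2_inner f g"
    by (rule l2_tendsto_inner[OF s(2) t(2)])
  moreover have "(\<lambda>n. l2_inner (s n) (t n)) \<longlonglongrightarrow> l2_inner f' g'"
    using l2_tendsto_inner[OF s(3) t(3)] by (simp add: plancherel_inner L s(1) t(1))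
  ultimately show ?thesis
    by (rule LIMSEQ_unique)
qed

section \<open>Two-digit tiles\<close>

subsection \<open>Summability of the powers of a contraction\<close>

text \<open>Summing the recurrence bounds each partial sum T by (1 - r) T \<le>
  \<open>a 0 + suminf b\<close>.\<close>

lemma summable_forced_recurrence:
  fixes a b :: "nat \<Rightarrow> real"
  assumes a: "\<And>n. 0 \<le> a n" and b: "\<And>n. 0 \<le> b n" "summable b"
    and rec: "\<And>n. a (Suc n) \<le> r * a n + b n" and r: "0 \<le> r" "r < 1"
  shows "summable a"
proof (rule summableI_nonneg_bounded[OF a])
  fix n
  define T where "T = (\<Sum>i<n. a i)"
  have "T \<le> T + a n"
    using a by simp
  also have "\<dots> = (\<Sum>i<Suc n. a i)"
    by (simp add: T_def)
  also have "\<dots> = a 0 + (\<Sum>i<n. a (Suc i))"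
    by (rule sum.lessThan_Suc_shift)
  also have "(\<Sum>i<n. a (Suc i)) \<le> (\<Sum>i<n. r * a i + b i)"
    by (intro sum_mono rec)
  also have "\<dots> = r * T + (\<Sum>i<n. b i)"
    by (simp add: T_def sum.distrib sum_distrib_left)
  also have "(\<Sum>i<n. b i) \<le> suminf b"
    using b by (intro sum_le_suminf) auto
  finally have "(1 - r) * T \<le> a 0 + suminf b"
    by (simp add: algebra_simps)
  then show "(\<Sum>i<n. a i) \<le> (a 0 + suminf b) / (1 - r)"
    using r by (simp add: T_def field_simps)
qed

lemma matrix_funpow_diff:
  fixes A :: "'a::field^'d^'d"
  shows "((*v) A ^^ k) (x - \<mu> *s y) = ((*v) A ^^ k) x - \<mu> *s ((*v) A ^^ k) y"
  by (induction k) (auto simp: matrix_vector_mult_diff_distrib vector_scalar_commute)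

lemma matrix_funpow_commute: "A *v (((*v) A ^^ k) x) = ((*v) A ^^ k) (A *v x)"
  by (rule funpow_swap1)

lemma norm_smult_vec: "norm (a *s x) = cmod a * norm (x :: complex^'d)"
  by (simp add: norm_vec_def norm_mult L2_set_right_distrib)

text \<open>This is p(A) v, built from iterates of the action because \<open>^\<close> on matrices
  is componentwise.\<close>

definition poly_matrix_apply :: "'a::field poly \<Rightarrow> 'a^'d^'d \<Rightarrow> 'a^'d \<Rightarrow> 'a^'d" where
  "poly_matrix_apply p A v = (\<Sum>i\<le>degree p. coeff p i *s ((*v) A ^^ i) v)"

lemma poly_matrix_apply_diff:
  "poly_matrix_apply p A (x - \<mu> *s y) = poly_matrix_apply p A x - \<mu> *s poly_matrix_apply p A y"
proof -
  have "poly_matrix_apply p A (x - \<mu> *s y)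
      = (\<Sum>i\<le>degree p. coeff p i *s ((*v) A ^^ i) x - \<mu> *s (coeff p i *s ((*v) A ^^ i) y))"
    by (simp add: poly_matrix_apply_def matrix_funpow_diff vec_eq_iff algebra_simps)
  also have "\<dots> = poly_matrix_apply p A x - \<mu> *s poly_matrix_apply p A y"
    by (simp add: poly_matrix_apply_def sum_subtractf vec_eq_iff sum_distrib_left mult_ac)
  finally show ?thesis .
qed

lemma poly_matrix_apply_commute:
  "poly_matrix_apply p A (A *v x) = A *v poly_matrix_apply p A x"
proof -
  have "A *v (\<Sum>i\<in>S. f i) = (\<Sum>i\<in>S. A *v f i)" for S and f :: "nat \<Rightarrow> _"
    by (induction S rule: infinite_finite_induct) (auto simp: matrix_vector_right_distrib)
  then show ?thesis
    by (simp add: poly_matrix_apply_def vector_scalar_commute matrix_funpow_commute)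
qed

text \<open>Splitting off a root lowers the degree at the price of replacing \<open>v\<close> by
  \<open>A *v v - \<mu> *s v\<close>. The assumption on \<open>q\<close> fixes the degree of the
  product and with it the range of summation.\<close>

lemma poly_matrix_apply_linear_factor:
  fixes q :: "'a::field poly"
  assumes "q \<noteq> 0"
  shows "poly_matrix_apply ([:- \<mu>, 1:] * q) A v = poly_matrix_apply q A (A *v v - \<mu> *s v)"
proof -
  define P where "P i = ((*v) A ^^ i) v" for i
  have deg: "degree ([:- \<mu>, 1:] * q) = Suc (degree q)"
    using assms by (subst degree_mult_eq) auto
  have coeff: "coeff ([:- \<mu>, 1:] * q) i = (case i of 0 \<Rightarrow> 0 | Suc j \<Rightarrow> coeff q j) - \<mu> * coeff q i" for i
    by (cases i) auto
  have "poly_matrix_apply ([:- \<mu>, 1:] * q) A v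
      = (\<Sum>i\<le>Suc (degree q). (case i of 0 \<Rightarrow> 0 | Suc j \<Rightarrow> coeff q j) *s P i - \<mu> *s (coeff q i *s P i))"
    unfolding poly_matrix_apply_def deg coeff P_def[symmetric]
    by (simp add: vec_eq_iff algebra_simps)
  also have "\<dots> = (\<Sum>i\<le>Suc (degree q). (case i of 0 \<Rightarrow> 0 | Suc j \<Rightarrow> coeff q j) *s P i)
      - (\<Sum>i\<le>Suc (degree q). \<mu> *s (coeff q i *s P i))"
    by (rule sum_subtractf)
  also have "(\<Sum>i\<le>Suc (degree q). (case i of 0 \<Rightarrow> 0 | Suc j \<Rightarrow> coeff q j) *s P i)
      = (\<Sum>i\<le>degree q. coeff q i *s P (Suc i))"
    by (subst sum.atMost_Suc_shift) simp
  also have "(\<Sum>i\<le>Suc (degree q). \<mu> *s (coeff q i *s P i)) = (\<Sum>i\<le>degree q. \<mu> *s (coeff q i *s P i))"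
    by (simp add: coeff_eq_0)
  also have "(\<Sum>i\<le>degree q. coeff q i *s P (Suc i)) - (\<Sum>i\<le>degree q. \<mu> *s (coeff q i *s P i))
      = (\<Sum>i\<le>degree q. coeff q i *s (P (Suc i) - \<mu> *s P i))"
    by (simp add: vec_eq_iff algebra_simps flip: sum_subtractf)
  also have "\<dots> = poly_matrix_apply q A (A *v v - \<mu> *s v)"
    by (simp add: poly_matrix_apply_def P_def matrix_funpow_diff matrix_funpow_commute)
  finally show ?thesis .
qed

text \<open>\<open>DIM(complex^'d)\<close> is the real dimension \<open>N\<close>, so the
  \<open>N + 1\<close> iterates from 0 to \<open>N\<close> satisfy a nontrivial relation, even with
  real coefficients.\<close>

lemma annihilating_poly:
  fixes A :: "complex^'d^'d"
  shows "\<exists>p. p \<noteq> 0 \<and> poly_matrix_apply p A v = 0"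
proof -
  define N where "N = DIM(complex^'d)"
  define P where "P i = ((*v) A ^^ i) v" for i
  have "\<exists>c :: nat \<Rightarrow> real. (\<exists>i\<le>N. c i \<noteq> 0) \<and> (\<Sum>i\<le>N. c i *\<^sub>R P i) = 0"
  \<comment> \<open>\<open>dependent\<close> speaks of a set of vectors and does not see
    repetitions; two equal iterates are turned into a relation by hand.\<close>
  proof (cases "inj_on P {..N}")
    case True
    then have "card (P ` {..N}) > N"
      by (simp add: card_image)
    then have "dependent (P ` {..N})"
      by (intro dependent_biggerset) (auto simp: N_def)
    then obtain u where u: "\<exists>v\<in>P ` {..N}. u v \<noteq> 0" "(\<Sum>v\<in>P ` {..N}. u v *\<^sub>R v) = 0"
      using real_vector.dependent_finite[of "P ` {..N}"] by auto
    have "(\<Sum>i\<le>N. u (P i) *\<^sub>R P i) = 0"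
      using u(2) by (subst (asm) sum.reindex[OF True]) simp
    with u(1) show ?thesis
      by (intro exI[of _ "\<lambda>i. u (P i)"]) auto
  next
    case False
    then obtain i j where ij: "i \<le> N" "j \<le> N" "i \<noteq> j" "P i = P j"
      by (auto simp: inj_on_def)
    have "(\<Sum>k\<le>N. (if k = i then 1 else if k = j then - 1 else 0) *\<^sub>R P k)
        = (\<Sum>k\<le>N. (if k = i then P i else 0) + (if k = j then - P j else 0))"
      using ij by (intro sum.cong) auto
    also have "\<dots> = 0"
      using ij by (simp add: sum.distrib)
    finally show ?thesis
      using ij by (intro exI[of _ "\<lambda>k. if k = i then 1 else if k = j then - 1 else 0"]) auto
  qed
  then obtain c :: "nat \<Rightarrow> real" where c: "\<exists>i\<le>N. c i \<noteq> 0" "(\<Sum>i\<le>N. c i *\<^sub>R P i) = 0"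
    by auto
  define p where "p = (\<Sum>i\<le>N. monom (complex_of_real (c i)) i)"
  have coeff: "coeff p i = (if i \<le> N then of_real (c i) else 0)" for i
    by (simp add: p_def coeff_sum)
  have "p \<noteq> 0"
    using c(1) coeff by (metis coeff_0 of_real_eq_0_iff)
  have "degree p \<le> N"
    by (rule degree_le) (simp add: coeff)
  then have "poly_matrix_apply p A v = (\<Sum>i\<le>N. coeff p i *s P i)"
    unfolding poly_matrix_apply_def P_def
    by (intro sum.mono_neutral_left) (auto simp: coeff_eq_0)
  also have "\<dots> = (\<Sum>i\<le>N. c i *\<^sub>R P i)"
    by (intro sum.cong) (auto simp: coeff vec_eq_iff scaleR_conv_of_real[of _ "_ :: complex"])
  finally show ?thesis
    using \<open>p \<noteq> 0\<close> c(2) by auto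
qed

text \<open>Peel off the roots of an annihilating polynomial of \<open>v\<close>: a root that is an eigenvalue gives a
  forced linear recurrence with a contraction factor, any other root can be cancelled.\<close>

lemma summable_matrix_powers:
  fixes A :: "complex^'d^'d"
  assumes eig: "\<And>\<mu> v. v \<noteq> 0 \<Longrightarrow> A *v v = \<mu> *s v \<Longrightarrow> cmod \<mu> < 1"
  shows "summable (\<lambda>k. norm (((*v) A ^^ k) v))"
proof -
  have "p \<noteq> 0 \<Longrightarrow> poly_matrix_apply p A v = 0 \<Longrightarrow> summable (\<lambda>k. norm (((*v) A ^^ k) v))" for p v
  proof (induction "degree p" arbitrary: p v)
    case 0
    then obtain c where p: "p = [:c:]" "c \<noteq> 0"
      by (metis degree_eq_zeroE pCons_0_0)
    with 0 have "v = 0"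
      by (simp add: poly_matrix_apply_def)
    moreover have "((*v) A ^^ k) 0 = 0" for k
      by (induction k) auto
    ultimately show ?case
      by simp
  next
    case (Suc n)
    then have "\<not> constant (poly p)"
      by (simp add: constant_degree)
    then obtain \<mu> where "poly p \<mu> = 0"
      using fundamental_theorem_of_algebra by blast
    then obtain q where q: "p = [:- \<mu>, 1:] * q"
      by (auto simp: poly_eq_0_iff_dvd dvd_def)
    have q0: "q \<noteq> 0"
      using Suc.prems q by auto
    have deg: "degree q = n"
      using Suc.hyps(2) q q0 by (simp add: degree_mult_eq del: mult_pCons_left)
    define w where "w = A *v v - \<mu> *s v"
    have "poly_matrix_apply q A w = 0"
      using Suc.prems(2) unfolding q poly_matrix_apply_linear_factor[OF q0] w_def .
    then have w: "summable (\<lambda>k. norm (((*v) A ^^ k) w))"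
      using Suc.hyps(1)[of q w] deg q0 by simp
    show ?case
    proof (cases "cmod \<mu> < 1")
      case True
      show ?thesis
      proof (rule summable_forced_recurrence[where r="cmod \<mu>", OF _ _ w])
        fix k
        have "((*v) A ^^ Suc k) v = \<mu> *s ((*v) A ^^ k) v + ((*v) A ^^ k) w"
          by (simp add: w_def matrix_funpow_diff matrix_funpow_commute)
        then show "norm (((*v) A ^^ Suc k) v) \<le> cmod \<mu> * norm (((*v) A ^^ k) v) + norm (((*v) A ^^ k) w)"
          by (metis norm_triangle_ineq norm_smult_vec)
      qed (use True in auto)
    next
      case False
      have "A *v poly_matrix_apply q A v = \<mu> *s poly_matrix_apply q A v"
        using \<open>poly_matrix_apply q A w = 0\<close>
        by (simp add: w_def poly_matrix_apply_diff poly_matrix_apply_commute)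
      then have "poly_matrix_apply q A v = 0"
        using eig False by blast
      then show ?thesis
        using Suc.hyps(1)[of q v] deg q0 by simp
    qed
  qed
  then show ?thesis
    using annihilating_poly by blast
qed

subsection \<open>The tile\<close>

locale two_digit =
  fixes M :: "int^'d^'d" and D :: "(int^'d) set"
  assumes tile: "two_digit_tile M D"
begin

definition A :: "real^'d^'d" where "A = matrix_inv (rmat M)"

definition G :: "(real^'d) set" where "G = tile_set M D"

lemma det_rmat_nz: "det (rmat M) \<noteq> 0" and abs_det_rmat: "\<bar>det (rmat M)\<bar> = 2"
  using tile by (auto simp: two_digit_tile_def det_rmat)

lemma rmat_A: "rmat M ** A = mat 1" "A ** rmat M = mat 1"
  using matrix_inv_mult[of "rmat M"] det_rmat_nz by (auto simp: A_def invertible_det_nz)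

lemma rmat_A_apply [simp]: "rmat M *v (A *v x) = x" "A *v (rmat M *v x) = x"
  by (simp_all add: matrix_vector_mul_assoc rmat_A)

lemma digits: obtains e where "D = {0, e}" "e \<noteq> 0"
proof -
  have "finite D" "card D = 2" "0 \<in> D"
    using card_digit_set[of M D] tile by (auto simp: two_digit_tile_def digit_set_def)
  then obtain a b where "D = {a, b}" "a \<noteq> b"
    by (auto simp: card_2_iff)
  with \<open>0 \<in> D\<close> that show ?thesis
    by (auto simp: insert_commute)
qed

text \<open>\<open>expanding\<close> is about complex eigenvectors, hence the complexification
  \<open>C\<close> of \<open>A\<close>. An eigenvector of \<open>C\<close> for \<mu> is one of
  \<open>M\<close> for 1/\<mu>, so all eigenvalues of \<open>C\<close> lie inside the unit
  disc.\<close>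

lemma summable_A_powers: "summable (\<lambda>k. norm (((*v) A ^^ k) v))"
proof -
  define C where "C = (map_matrix complex_of_real A)"
  define cv where "cv x = (\<chi> i. complex_of_real (x $ i))" for x :: "real^'d"
  have cv: "C *v cv x = cv (A *v x)" for x
    by (simp add: C_def cv_def map_matrix_def matrix_vector_mult_def vec_eq_iff)
  have cv_pow: "((*v) C ^^ k) (cv x) = cv (((*v) A ^^ k) x)" for k x
    by (induction k) (auto simp: cv)
  have norm_cv: "norm (cv x) = norm x" for x
    by (simp add: cv_def norm_vec_def)
  have MC: "map_matrix of_int M *v (C *v v) = v" for v :: "complex^'d"
  proof -
    have "map_matrix of_int M ** C = mat 1"
    proof -
      have "(\<Sum>k\<in>UNIV. of_int (M $ i $ k) * complex_of_real (A $ k $ j)) = (if i = j then 1 else 0)" for i j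
      proof -
        have "(\<Sum>k\<in>UNIV. of_int (M $ i $ k) * complex_of_real (A $ k $ j)) = of_real ((rmat M ** A) $ i $ j)"
          by (simp add: matrix_matrix_mult_def rmat_def map_matrix_def)
        then show ?thesis
          by (simp only: rmat_A) (simp add: mat_def)
      qed
      then show ?thesis
        by (simp add: C_def map_matrix_def matrix_matrix_mult_def vec_eq_iff mat_def)
    qed
    then show ?thesis
      by (simp add: matrix_vector_mul_assoc)
  qed
  have "summable (\<lambda>k. norm (((*v) C ^^ k) (cv v)))"
  proof (rule summable_matrix_powers)
    fix \<mu> and w :: "complex^'d"
    assume w: "w \<noteq> 0" "C *v w = \<mu> *s w"
    have eq: "w = \<mu> *s (map_matrix of_int M *v w)"
      using MC[of w] by (simp add: w(2) vector_scalar_commute)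
    then have mu: "\<mu> \<noteq> 0"
      using w(1) by auto
    have "map_matrix of_int M *v w = (1 / \<mu>) *s (\<mu> *s (map_matrix of_int M *v w))"
      using mu by (simp add: vector_smult_assoc)
    then have "map_matrix of_int M *v w = (1 / \<mu>) *s w"
      by (simp flip: eq)
    then have "cmod (1 / \<mu>) > 1"
      using tile w(1) unfolding two_digit_tile_def expanding_def by blast
    then show "cmod \<mu> < 1"
      using mu by (simp add: norm_divide field_simps)
  qed
  then show ?thesis
    by (simp add: cv_pow norm_cv)
qed

lemma A_powers_tendsto: "(\<lambda>k. ((*v) A ^^ k) v) \<longlonglongrightarrow> 0"
  using summable_LIMSEQ_zero[OF summable_A_powers] by (simp add: tendsto_norm_zero_iff)

lemma inner_transpose_powers: "((*v) (transpose A) ^^ k) x \<bullet> y = x \<bullet> ((*v) A ^^ k) y"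
proof (induction k arbitrary: x y)
  case (Suc k)
  have "((*v) (transpose A) ^^ Suc k) x \<bullet> y = (((*v) (transpose A) ^^ k) x v* A) \<bullet> y"
    by simp
  also have "\<dots> = ((*v) (transpose A) ^^ k) x \<bullet> (A *v y)"
    by (rule dot_lmul_matrix)
  also have "\<dots> = x \<bullet> ((*v) A ^^ Suc k) y"
    unfolding Suc.IH by (simp add: matrix_funpow_commute)
  finally show ?case .
qed auto

text \<open>Pairing with a coordinate vector moves the transposed powers over to powers of
  \<open>A\<close>.\<close>

lemma transpose_A_powers_tendsto: "(\<lambda>k. ((*v) (transpose A) ^^ k) x) \<longlonglongrightarrow> 0"
proof (rule vec_tendstoI)
  fix i
  have "(\<lambda>k. x \<bullet> ((*v) A ^^ k) (axis i 1)) \<longlonglongrightarrow> x \<bullet> 0"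
    by (intro tendsto_inner tendsto_const A_powers_tendsto)
  moreover have "x \<bullet> ((*v) A ^^ k) (axis i 1) = ((*v) (transpose A) ^^ k) x $ i" for k
    using inner_transpose_powers[of k x "axis i 1"] by (simp add: inner_axis)
  ultimately show "(\<lambda>k. ((*v) (transpose A) ^^ k) x $ i) \<longlonglongrightarrow> 0 $ i"
    by simp
qed

lemma continuous_on_A_power: "continuous_on S ((*v) A ^^ k)"
proof (induction k)
  case (Suc k)
  then have "continuous_on S (\<lambda>x. A *v ((*v) A ^^ k) x)"
    by (intro linear_continuous_on_compose[of _ _ "(*v) A"]) auto
  then show ?case
    by (simp add: comp_def)
qed (simp add: id_def)

lemma summable_digits:
  assumes "\<And>k. \<Delta> k \<in> D"
  shows "summable (\<lambda>k. ((*v) A ^^ Suc k) (rvec (\<Delta> k)))"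
    and "norm (((*v) A ^^ Suc k) (rvec (\<Delta> k))) \<le> (\<Sum>r\<in>D. norm (((*v) A ^^ Suc k) (rvec r)))"
proof -
  have D: "finite D"
    by (rule digits) auto
  show bound: "norm (((*v) A ^^ Suc k) (rvec (\<Delta> k))) \<le> (\<Sum>r\<in>D. norm (((*v) A ^^ Suc k) (rvec r)))" for k
    by (rule member_le_sum[OF assms[of k], of "\<lambda>r. norm (((*v) A ^^ Suc k) (rvec r))"]) (auto simp: D)
  have "summable (\<lambda>k. \<Sum>r\<in>D. norm (((*v) A ^^ Suc k) (rvec r)))"
    using summable_A_powers by (intro summable_sum) (subst summable_Suc_iff)
  then show "summable (\<lambda>k. ((*v) A ^^ Suc k) (rvec (\<Delta> k)))"
    by (rule summable_comparison_test[rotated]) (use bound in blast)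
qed

lemma mem_G: "x \<in> G \<longleftrightarrow> (\<exists>\<Delta>. (\<forall>k. \<Delta> k \<in> D) \<and> (\<lambda>k. ((*v) A ^^ Suc k) (rvec (\<Delta> k))) sums x)"
  by (simp add: G_def tile_set_def A_def)

text \<open>\<open>G\<close> is the image of the product space of digit sequences, compact by
  Tychonoff, under the sum of the series. That map is a uniform limit of continuous partial
  sums.\<close>

lemma compact_G: "compact G"
proof -
  define X where "X = PiE (UNIV :: nat set) (\<lambda>_. rvec ` D)"
  define F where "F d = (\<Sum>k. ((*v) A ^^ Suc k) (d k))" for d
  have D: "finite D"
    by (rule digits) auto
  have X: "d \<in> X \<longleftrightarrow> (\<exists>\<Delta>. (\<forall>k. \<Delta> k \<in> D) \<and> d = (\<lambda>k. rvec (\<Delta> k)))" for d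
  proof -
    have "(\<forall>k. \<exists>r. r \<in> D \<and> d k = rvec r) \<longleftrightarrow> (\<exists>\<Delta>. \<forall>k. \<Delta> k \<in> D \<and> d k = rvec (\<Delta> k))"
      by (rule choice_iff)
    then show ?thesis
      by (auto simp: X_def image_iff fun_eq_iff Bex_def)
  qed
  have "compactin (product_topology (\<lambda>_. euclidean) UNIV) X"
    unfolding X_def by (subst compactin_PiE) (use D in \<open>auto intro: finite_imp_compact\<close>)
  then have "compact X"
    by (simp add: euclidean_product_topology)
  moreover have "continuous_on X F"
  proof (rule uniform_limit_theorem)
    show "\<forall>\<^sub>F n in sequentially. continuous_on X (\<lambda>d. \<Sum>k<n. ((*v) A ^^ Suc k) (d k))"
    proof (intro always_eventually allI continuous_on_sum)
      fix n k
      have "continuous_on X (\<lambda>d. d k)"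
        by (rule continuous_on_subset[OF continuous_on_product_coordinates]) auto
      then show "continuous_on X (\<lambda>d. ((*v) A ^^ Suc k) (d k))"
        by (rule continuous_on_compose2[OF continuous_on_A_power[of UNIV]]) auto
    qed
    show "uniform_limit X (\<lambda>n d. \<Sum>k<n. ((*v) A ^^ Suc k) (d k)) F sequentially"
      unfolding F_def
    proof (rule Weierstrass_m_test)
      show "norm (((*v) A ^^ Suc k) (d k)) \<le> (\<Sum>r\<in>D. norm (((*v) A ^^ Suc k) (rvec r)))" if "d \<in> X" for k d
        using that summable_digits(2) by (auto simp: X)
      show "summable (\<lambda>k. \<Sum>r\<in>D. norm (((*v) A ^^ Suc k) (rvec r)))"
        using summable_A_powers by (intro summable_sum) (subst summable_Suc_iff)
    qed
  qed auto
  ultimately have "compact (F ` X)"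
    by (rule compact_continuous_image[rotated])
  moreover have "F ` X = G"
  proof (intro equalityI subsetI)
    fix x assume "x \<in> F ` X"
    then obtain d where "d \<in> X" "x = F d"
      by blast
    then obtain \<Delta> where \<Delta>: "\<And>k. \<Delta> k \<in> D" "x = F (\<lambda>k. rvec (\<Delta> k))"
      unfolding X by blast
    have "(\<lambda>k. ((*v) A ^^ Suc k) (rvec (\<Delta> k))) sums x"
      unfolding \<Delta>(2) F_def by (rule summable_sums[OF summable_digits(1)[OF \<Delta>(1)]])
    then show "x \<in> G"
      unfolding mem_G using \<Delta>(1) by (intro exI[of _ \<Delta>] conjI allI)
  next
    fix x assume "x \<in> G"
    then obtain \<Delta> where \<Delta>: "\<And>k. \<Delta> k \<in> D" "(\<lambda>k. ((*v) A ^^ Suc k) (rvec (\<Delta> k))) sums x"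
      by (auto simp: mem_G)
    then have "x = F (\<lambda>k. rvec (\<Delta> k))"
      by (simp add: F_def sums_iff)
    moreover have "(\<lambda>k. rvec (\<Delta> k)) \<in> X"
      using \<Delta>(1) X by blast
    ultimately show "x \<in> F ` X"
      by blast
  qed
  ultimately show ?thesis
    by simp
qed

lemma G_borel [measurable]: "G \<in> sets borel"
  using compact_G by (simp add: borel_compact)

lemma measure_G: "measure lborel G = 1"
  using tile by (simp add: two_digit_tile_def G_def[symmetric] measure_completion)

lemma emeasure_G: "emeasure lborel G = 1"
proof -
  have "emeasure lborel G < \<infinity>"
    using emeasure_compact_finite[OF compact_G] by simp
  then show ?thesis
    using measure_G by (simp add: emeasure_eq_ennreal_measure)
qed

lemma bounded_linear_matrix: "bounded_linear ((*v) (B :: real^'d^'d))"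
  by (rule matrix_vector_mul_bounded_linear)

text \<open>Multiplication by \<open>M\<close> strips the first digit of an expansion; prepending a
  digit reverses this.\<close>

lemma G_refine: "x \<in> G \<longleftrightarrow> (\<exists>r\<in>D. rmat M *v x - rvec r \<in> G)"
proof
  assume "x \<in> G"
  then obtain \<Delta> where \<Delta>: "\<And>k. \<Delta> k \<in> D" "(\<lambda>k. ((*v) A ^^ Suc k) (rvec (\<Delta> k))) sums x"
    by (auto simp: mem_G)
  have "(\<lambda>k. rmat M *v (((*v) A ^^ Suc k) (rvec (\<Delta> k)))) sums (rmat M *v x)"
    by (rule bounded_linear.sums[OF bounded_linear_matrix \<Delta>(2)])
  then have "(\<lambda>k. ((*v) A ^^ k) (rvec (\<Delta> k))) sums (rmat M *v x - rvec (\<Delta> 0) + ((*v) A ^^ 0) (rvec (\<Delta> 0)))"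
    by simp
  then have "(\<lambda>k. ((*v) A ^^ Suc k) (rvec (\<Delta> (Suc k)))) sums (rmat M *v x - rvec (\<Delta> 0))"
    by (subst (asm) sums_Suc_iff[symmetric])
  then have "rmat M *v x - rvec (\<Delta> 0) \<in> G"
    using \<Delta>(1) unfolding mem_G by (intro exI[of _ "\<lambda>k. \<Delta> (Suc k)"]) auto
  then show "\<exists>r\<in>D. rmat M *v x - rvec r \<in> G"
    using \<Delta>(1) by blast
next
  assume "\<exists>r\<in>D. rmat M *v x - rvec r \<in> G"
  then obtain r \<Delta> where r: "r \<in> D" and \<Delta>: "\<And>k. \<Delta> k \<in> D"
    "(\<lambda>k. ((*v) A ^^ Suc k) (rvec (\<Delta> k))) sums (rmat M *v x - rvec r)"
    by (auto simp: mem_G)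
  define \<Delta>' where "\<Delta>' k = (case k of 0 \<Rightarrow> r | Suc j \<Rightarrow> \<Delta> j)" for k
  have "(\<lambda>k. ((*v) A ^^ Suc k) (rvec (\<Delta>' (Suc k)))) sums (rmat M *v x - rvec r)"
    using \<Delta>(2) by (simp add: \<Delta>'_def)
  then have "(\<lambda>k. ((*v) A ^^ k) (rvec (\<Delta>' k))) sums (rmat M *v x - rvec r + ((*v) A ^^ 0) (rvec (\<Delta>' 0)))"
    by (subst (asm) sums_Suc_iff)
  then have "(\<lambda>k. ((*v) A ^^ k) (rvec (\<Delta>' k))) sums (rmat M *v x)"
    by (simp add: \<Delta>'_def)
  then have "(\<lambda>k. A *v ((*v) A ^^ k) (rvec (\<Delta>' k))) sums (A *v (rmat M *v x))"
    by (rule bounded_linear.sums[OF bounded_linear_matrix])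
  then have "(\<lambda>k. ((*v) A ^^ Suc k) (rvec (\<Delta>' k))) sums x"
    by simp
  moreover have "\<Delta>' k \<in> D" for k
    using r \<Delta>(1) by (auto simp: \<Delta>'_def split: nat.split)
  ultimately show "x \<in> G"
    by (auto simp: mem_G)
qed

subsection \<open>The Fourier transform of the tile\<close>

text \<open>The dilated tile is the union of \<open>G\<close> and its translate by \<open>e\<close>.
  Dilation doubles the volume and both pieces have the volume of \<open>G\<close>, so nothing is
  left for the overlap \<open>ov\<close>.\<close>

lemma G_overlap:
  assumes D: "D = {0, e}" "e \<noteq> 0"
  shows "AE x in lborel. indicator G x = (indicator G (rmat M *v x) + indicator G (rmat M *v x - rvec e) :: real)"
proof -
  let ?m = "\<lambda>x. rmat M *v x"
  define ov where "ov x = indicator G x * (indicator G (x - rvec e) :: real)" for x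
  have emb: "emeasure lborel G < \<infinity>"
    by (simp add: emeasure_G)
  have int: "integrable lborel (indicator G :: _ \<Rightarrow> real)"
    using emb by (intro integrable_real_indicator) auto
  have int': "integrable lborel (\<lambda>x. indicator G (x - rvec e) :: real)"
    using integrable_translate_iff[of "indicator G :: _ \<Rightarrow> real" "- rvec e"] int by simp
  have int_ov: "integrable lborel ov"
    unfolding ov_def
    by (rule Bochner_Integration.integrable_bound[OF int]) (auto simp: indicator_def)
  have m: "integrable lborel (\<lambda>x. f (?m x))" "(LINT x|lborel. f (?m x)) = (LINT x|lborel. f x) / 2"
    if "integrable lborel f" for f :: "real^'d \<Rightarrow> real"
    using integrable_matrix_iff[OF det_rmat_nz, of f] integral_matrix[OF det_rmat_nz, of f]
      borel_measurable_integrable[OF that] that abs_det_rmat by auto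
  have pt: "indicator G x = indicator G (?m x) + indicator G (?m x - rvec e) - ov (?m x)" for x
    using G_refine[of x] by (auto simp: D indicator_def ov_def)
  have "(LINT x|lborel. indicator G x) = (LINT x|lborel. indicator G (?m x) + indicator G (?m x - rvec e) - ov (?m x))"
    by (subst pt) simp
  also have "\<dots> = (LINT x|lborel. indicator G (?m x)) + (LINT x|lborel. indicator G (?m x - rvec e)) - (LINT x|lborel. ov (?m x))"
    using m(1)[OF int] m(1)[OF int'] m(1)[OF int_ov] by simp
  also have "\<dots> = (LINT x|lborel. indicator G x) / 2 + (LINT x|lborel. indicator G (x - rvec e)) / 2 - (LINT x|lborel. ov x) / 2"
    using m(2)[OF int] m(2)[OF int'] m(2)[OF int_ov] by simp
  also have "(LINT x|lborel. indicator G (x - rvec e) :: real) = (LINT x|lborel. indicator G x)"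
    using integral_translate[of "indicator G :: _ \<Rightarrow> real" "- rvec e"] by simp
  finally have "(LINT x|lborel. ov x) = 0"
    by simp
  then have "(LINT x|lborel. ov (?m x)) = 0"
    using m(2)[OF int_ov] by simp
  then have "AE x in lborel. ov (?m x) = 0"
    using m(1)[OF int_ov] by (subst (asm) integral_nonneg_eq_0_iff_AE) (auto simp: ov_def)
  then show ?thesis
  proof eventually_elim
    case (elim x)
    then show ?case
      using pt[of x] by simp
  qed
qed

lemma integrable_indicator_G: "integrable lborel (indicator G :: real^'d \<Rightarrow> complex)"
  by (intro integrable_indicator_complex) (auto simp: emeasure_G)

lemma indicator_G_L2: "(indicator G :: real^'d \<Rightarrow> complex) \<in> L2"
  by (intro indicator_L2) (auto simp: emeasure_G)

text \<open>Substitute \<open>rmat M *v x\<close> in the almost everywhere refinement. The frequency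
  moves by \<open>transpose A\<close>, and the translate by \<open>e\<close> contributes the
  exponential of the mask.\<close>

lemma fourier_G_refine:
  assumes D: "D = {0, e}" "e \<noteq> 0"
  shows "fourier (indicator G) \<xi> = (1 + cis (- 2 * pi * (rvec e \<bullet> (transpose A *v \<xi>)))) / 2
    * fourier (indicator G) (transpose A *v \<xi>)"
proof -
  define \<eta> where "\<eta> = transpose A *v \<xi>"
  define h where "h y = indicator G y + (indicator G (y - rvec e) :: complex)" for y
  have h [measurable]: "h \<in> borel_measurable borel"
    unfolding h_def by measurable
  have "AE x in lborel. indicator G x = h (rmat M *v x)"
    using G_overlap[OF D]
  proof eventually_elim
    case (elim x)
    then show ?case
      by (cases "x \<in> G"; cases "rmat M *v x \<in> G"; cases "rmat M *v x - rvec e \<in> G") (auto simp: h_def)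
  qed
  moreover have inner: "x \<bullet> \<xi> = (rmat M *v x) \<bullet> \<eta>" for x
    using dot_lmul_matrix[of \<xi> A "rmat M *v x"] by (simp add: \<eta>_def inner_commute)
  ultimately have "fourier (indicator G) \<xi>
      = (LINT x|lborel. h (rmat M *v x) * cis (- 2 * pi * ((rmat M *v x) \<bullet> \<eta>)))"
    unfolding fourier_def by (intro integral_cong_AE) auto
  also have "\<dots> = (LINT y|lborel. h y * cis (- 2 * pi * (y \<bullet> \<eta>))) /\<^sub>R 2"
    using integral_matrix[OF det_rmat_nz, of "\<lambda>y. h y * cis (- 2 * pi * (y \<bullet> \<eta>))"] abs_det_rmat by simp
  also have "(LINT y|lborel. h y * cis (- 2 * pi * (y \<bullet> \<eta>))) = fourier h \<eta>"
    by (simp add: fourier_def)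
  also have "fourier h \<eta> = fourier (indicator G) \<eta> + cis (- 2 * pi * (rvec e \<bullet> \<eta>)) * fourier (indicator G) \<eta>"
    unfolding h_def using integrable_indicator_G integrable_translate_iff[of "indicator G :: _ \<Rightarrow> complex" "- rvec e"]
    by (subst fourier_add) (auto simp: fourier_translate)
  finally show ?thesis
    by (simp add: \<eta>_def scaleR_conv_of_real field_simps)
qed

lemma fourier_tendsto:
  assumes f: "integrable lborel f" and t: "t \<longlonglongrightarrow> \<xi>"
  shows "(\<lambda>n. fourier f (t n)) \<longlonglongrightarrow> fourier f \<xi>"
  unfolding fourier_def
proof (rule integral_dominated_convergence[where w="\<lambda>x. cmod (f x)"])
  have [measurable]: "f \<in> borel_measurable borel"
    using borel_measurable_integrable[OF f] by simp
  show "(\<lambda>x. f x * cis (- 2 * pi * (x \<bullet> \<xi>))) \<in> borel_measurable lborel"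
    "(\<lambda>x. f x * cis (- 2 * pi * (x \<bullet> t n))) \<in> borel_measurable lborel" for n
    by measurable
  have "continuous_on UNIV cis"
    by (intro continuous_intros)
  then have "isCont cis x" for x
    by (simp add: continuous_on_eq_continuous_at)
  then show "AE x in lborel. (\<lambda>n. f x * cis (- 2 * pi * (x \<bullet> t n))) \<longlonglongrightarrow> f x * cis (- 2 * pi * (x \<bullet> \<xi>))"
    by (intro AE_I2 tendsto_mult_left isCont_tendsto_compose[of _ cis] tendsto_inner tendsto_const t)
qed (use f in \<open>auto simp: norm_mult\<close>)

lemma fourier_G_0: "fourier (indicator G) 0 = 1"
proof -
  have "fourier (indicator G) 0 = (LINT x|lborel. complex_of_real (indicator G x))"
    unfolding fourier_def by (intro Bochner_Integration.integral_cong) (auto simp: indicator_def)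
  then show ?thesis
    by (simp only: integral_complex_of_real) (simp add: measure_G)
qed

lemma cis_eq_minus_1_imp:
  assumes "1 + cis (- 2 * pi * t) = 0"
  shows "\<exists>n::int. t = n + 1 / 2"
proof -
  have "Re (1 + cis (- 2 * pi * t)) = 0"
    using assms by simp
  then have "cos (2 * pi * t) = - 1"
    by simp
  then obtain n :: int where "2 * pi * t = (2 * real_of_int n + 1) * pi"
    unfolding cos_eq_minus1 by blast
  then have "pi * (2 * t) = pi * (2 * real_of_int n + 1)"
    by (simp add: algebra_simps)
  then have "t = n + 1 / 2"
    by simp
  then show ?thesis ..
qed

text \<open>By the refinement equation a zero of the transform propagates along \<open>(transpose A)^k \<xi> \<longlonglongrightarrow> 0\<close>
  unless one of the points meets a zero of the mask, and these zeros lie on countably many hyperplanes.\<close>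

lemma fourier_G_nonzero: "AE \<xi> in lborel. fourier (indicator G) \<xi> \<noteq> 0"
proof -
  obtain e where D: "D = {0, e}" "e \<noteq> 0"
    by (rule digits)
  define H where "H k n = {\<xi>. ((*v) A ^^ k) (rvec e) \<bullet> \<xi> = real_of_int n + 1 / 2}" for k n
  have "AE \<xi> in lborel. \<xi> \<notin> H k n" for k n
  proof -
    \<comment> \<open>A nonzero right-hand side makes \<open>H k n\<close> negligible for every
      normal vector: with a zero normal the set is empty.\<close>
    have "real_of_int n + 1 / 2 \<noteq> 0"
    proof
      assume "real_of_int n + 1 / 2 = 0"
      then have "real_of_int (2 * n + 1) = real_of_int 0"
        by simp
      then have "2 * n + 1 = 0"
        by (rule of_int_eq_iff[THEN iffD1])
      then show False
        by presburger
    qed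
    then have "negligible (H k n)"
      unfolding H_def by (intro negligible_hyperplane) auto
    then have "AE \<xi> in lebesgue. \<xi> \<notin> H k n"
      by (auto simp: negligible_iff_null_sets dest: AE_not_in)
    then show ?thesis
      by (simp add: AE_completion_iff)
  qed
  then have "AE \<xi> in lborel. \<forall>k n. \<xi> \<notin> H k n"
    by (simp add: AE_all_countable)
  then show ?thesis
  proof eventually_elim
    case (elim \<xi>)
    define t where "t k = ((*v) (transpose A) ^^ k) \<xi>" for k
    have mask: "1 + cis (- 2 * pi * (rvec e \<bullet> t k)) \<noteq> 0" for k
    proof
      assume "1 + cis (- 2 * pi * (rvec e \<bullet> t k)) = 0"
      then obtain n :: int where "rvec e \<bullet> t k = n + 1 / 2"
        using cis_eq_minus_1_imp by blast
      then have "\<xi> \<in> H k n"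
        using inner_transpose_powers[of k \<xi> "rvec e"] by (simp add: H_def t_def inner_commute)
      then show False
        using elim by blast
    qed
    show ?case
    proof
      assume "fourier (indicator G) \<xi> = 0"
      have "fourier (indicator G) (t k) = 0" for k
      proof (induction k)
        case 0
        then show ?case
          using \<open>fourier (indicator G) \<xi> = 0\<close> by (simp add: t_def)
      next
        case (Suc k)
        have t: "transpose A *v t k = t (Suc k)"
          by (simp add: t_def)
        show ?case
          using fourier_G_refine[OF D, of "t k"] mask[of "Suc k"] Suc unfolding t by auto
      qed
      then have "(\<lambda>k. fourier (indicator G) (t k)) \<longlonglongrightarrow> 0"
        by simp
      moreover have "(\<lambda>k. fourier (indicator G) (t k)) \<longlonglongrightarrow> fourier (indicator G) 0"
        unfolding t_def by (intro fourier_tendsto integrable_indicator_G transpose_A_powers_tendsto)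
      ultimately show False
        using LIMSEQ_unique fourier_G_0 by fastforce
    qed
  qed
qed

section \<open>Transforms of the tile B-splines\<close>

lemma integrable_bspline: "integrable lborel (tile_bspline G n)"
  by (induction n) (auto intro: integrable_indicator_G integrable_convol)

lemma fourier_bspline: "fourier (tile_bspline G n) \<xi> = fourier (indicator G) \<xi> ^ Suc n"
  by (induction n) (auto simp: fourier_convol integrable_bspline integrable_indicator_G)

lemma fourier_bspline_nonzero: "AE \<xi> in lborel. fourier (tile_bspline G n) \<xi> \<noteq> 0"
  using fourier_G_nonzero by eventually_elim (simp add: fourier_bspline)

text \<open>The transform of the tile is bounded by its volume 1, so its higher powers are dominated
  by the first power, which lies in \<open>L2\<close> by Plancherel.\<close>

lemma fourier_bspline_L2: "fourier (tile_bspline G n) \<in> L2"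
proof (rule L2_dominated[where C=1])
  show "fourier (indicator G) \<in> L2"
    by (rule plancherel[OF indicator_G_L2 integrable_indicator_G])
  show "fourier (tile_bspline G n) \<in> borel_measurable borel"
    by (rule borel_measurable_fourier[OF integrable_bspline])
  fix \<xi>
  have "(LINT x|lborel. cmod (indicator G x)) = (LINT x|lborel. indicator G x)"
    by (intro Bochner_Integration.integral_cong) (auto simp: indicator_def)
  then have "cmod (fourier (indicator G) \<xi>) \<le> 1"
    using cmod_fourier_le[of "indicator G" \<xi>] by (simp add: measure_G)
  then show "cmod (fourier (tile_bspline G n) \<xi>) \<le> 1 * cmod (fourier (indicator G) \<xi>)"
    by (simp add: fourier_bspline norm_mult norm_power mult_left_le power_le_one)
qed

lemma fourier_bspline_reflect: "fourier (tile_bspline G n) (- \<xi>) = cnj (fourier (tile_bspline G n) \<xi>)"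
proof -
  have "(\<lambda>x. cnj (indicator G x)) = indicator G"
    by (auto simp: indicator_def)
  then have "fourier (indicator G) (- \<xi>) = cnj (fourier (indicator G) \<xi>)"
    using fourier_cnj[of "indicator G" "- \<xi>"] by simp
  then show ?thesis
    by (simp add: fourier_bspline)
qed

end

section \<open>Orthonormality of the integer shifts\<close>

lemma l2_norm_cis_mult: "l2_norm (\<lambda>x. cis (h x) * f x) = l2_norm f"
  by (simp add: l2_norm_def norm_mult)

lemma L2_cis_mult:
  assumes "f \<in> L2" "h \<in> borel_measurable borel"
  shows "(\<lambda>x. cis (h x) * f x) \<in> L2"
  by (rule L2_dominated[OF assms(1), of _ 1]) (use assms in \<open>auto simp: norm_mult\<close>)

lemma l2_tendsto_cis_mult:
  assumes "l2_tendsto s f F" "h \<in> borel_measurable borel"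
  shows "l2_tendsto (\<lambda>i x. cis (h x) * s i x) (\<lambda>x. cis (h x) * f x) F"
  using assms by (auto simp: l2_tendsto_def L2_cis_mult l2_norm_cis_mult simp flip: right_diff_distrib)

lemma l2_tendsto_translate:
  assumes "l2_tendsto s f F"
  shows "l2_tendsto (\<lambda>i x. s i (x + c)) (\<lambda>x. f (x + c)) F"
proof -
  have L: "s i \<in> L2" "f \<in> L2" for i
    using assms by (auto simp: l2_tendsto_def)
  have "l2_norm (\<lambda>x. s i (x + c) - f (x + c)) = l2_norm (\<lambda>x. s i x - f x)" for i
    using l2_norm_translate[OF L2_diff[OF L(1)[of i] L(2)], of c] by simp
  with assms show ?thesis
    by (simp add: l2_tendsto_def L2_translate)
qed

lemma L2_reflect: "f \<in> L2 \<Longrightarrow> (\<lambda>x. f (- x)) \<in> L2"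
  using integrable_reflect_iff[of "\<lambda>x. (cmod (f x))\<^sup>2"] by (auto simp: L2_iff)

lemma l2_norm_reflect:
  assumes "f \<in> L2"
  shows "l2_norm (\<lambda>x. f (- x)) = l2_norm f"
  unfolding l2_norm_def using integral_reflect[of "\<lambda>x. (cmod (f x))\<^sup>2"] assms by (simp add: L2_iff)

lemma l2_tendsto_reflect:
  assumes "l2_tendsto s f F"
  shows "l2_tendsto (\<lambda>i x. s i (- x)) (\<lambda>x. f (- x)) F"
proof -
  have L: "s i \<in> L2" "f \<in> L2" for i
    using assms by (auto simp: l2_tendsto_def)
  have "l2_norm (\<lambda>x. s i (- x) - f (- x)) = l2_norm (\<lambda>x. s i x - f x)" for i
    using l2_norm_reflect[OF L2_diff[OF L(1)[of i] L(2)]] by simp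
  with assms show ?thesis
    by (simp add: l2_tendsto_def L2_reflect)
qed

lemma l2_norm_cnj: "l2_norm (\<lambda>x. cnj (f x)) = l2_norm f"
  by (simp add: l2_norm_def)

lemma l2_tendsto_cnj:
  assumes "l2_tendsto s f F"
  shows "l2_tendsto (\<lambda>i x. cnj (s i x)) (\<lambda>x. cnj (f x)) F"
  using assms by (auto simp: l2_tendsto_def L2_cnj l2_norm_cnj simp flip: complex_cnj_diff)

lemma is_fourier_l2_L2: "is_fourier_l2 f g \<Longrightarrow> f \<in> L2" "is_fourier_l2 f g \<Longrightarrow> g \<in> L2"
  by (auto simp: is_fourier_l2_def l2_tendsto_def)

lemma is_fourier_l2_translate:
  assumes "is_fourier_l2 f g"
  shows "is_fourier_l2 (\<lambda>x. f (x - c)) (\<lambda>\<xi>. cis (- 2 * pi * (c \<bullet> \<xi>)) * g \<xi>)"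
proof -
  from assms obtain s where s: "\<And>n. integrable lborel (s n)" "l2_tendsto s f sequentially"
    "l2_tendsto (\<lambda>n. fourier (s n)) g sequentially"
    by (auto simp: is_fourier_l2_def)
  show ?thesis
    unfolding is_fourier_l2_def
  proof (intro exI[of _ "\<lambda>n x. s n (x - c)"] conjI allI)
    show "integrable lborel (\<lambda>x. s n (x - c))" for n
      using s(1)[of n] integrable_translate_iff[of "s n" "- c"] borel_measurable_integrable[OF s(1)[of n]] by simp
    show "l2_tendsto (\<lambda>n x. s n (x - c)) (\<lambda>x. f (x - c)) sequentially"
      using l2_tendsto_translate[OF s(2), of "- c"] by simp
    have "fourier (\<lambda>x. s n (x - c)) = (\<lambda>\<xi>. cis (- 2 * pi * (c \<bullet> \<xi>)) * fourier (s n) \<xi>)" for n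
      using fourier_translate[OF s(1)] by blast
    moreover have "l2_tendsto (\<lambda>n \<xi>. cis (- 2 * pi * (c \<bullet> \<xi>)) * fourier (s n) \<xi>)
        (\<lambda>\<xi>. cis (- 2 * pi * (c \<bullet> \<xi>)) * g \<xi>) sequentially"
      by (rule l2_tendsto_cis_mult[OF s(3)]) measurable
    ultimately show "l2_tendsto (\<lambda>n. fourier (\<lambda>x. s n (x - c))) (\<lambda>\<xi>. cis (- 2 * pi * (c \<bullet> \<xi>)) * g \<xi>) sequentially"
      by simp
  qed
qed

lemma is_fourier_l2_cnj:
  assumes "is_fourier_l2 f g"
  shows "is_fourier_l2 (\<lambda>x. cnj (f x)) (\<lambda>\<xi>. cnj (g (- \<xi>)))"
proof -
  from assms obtain s where s: "\<And>n. integrable lborel (s n)" "l2_tendsto s f sequentially"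
    "l2_tendsto (\<lambda>n. fourier (s n)) g sequentially"
    by (auto simp: is_fourier_l2_def)
  show ?thesis
    unfolding is_fourier_l2_def
  proof (intro exI[of _ "\<lambda>n x. cnj (s n x)"] conjI allI)
    show "integrable lborel (\<lambda>x. cnj (s n x))" for n
      using s(1) by simp
    show "l2_tendsto (\<lambda>n x. cnj (s n x)) (\<lambda>x. cnj (f x)) sequentially"
      by (rule l2_tendsto_cnj[OF s(2)])
    show "l2_tendsto (\<lambda>n. fourier (\<lambda>x. cnj (s n x))) (\<lambda>\<xi>. cnj (g (- \<xi>))) sequentially"
      unfolding fourier_cnj[abs_def] by (rule l2_tendsto_cnj[OF l2_tendsto_reflect[OF s(3)]])
  qed
qed

text \<open>Connects periodizations computed in \<open>ennreal\<close> with the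
  \<open>infsum\<close> of the orthogonalization. Finiteness excludes the default value 0 of a
  divergent \<open>infsum\<close>.\<close>

lemma nn_integral_count_space_infsum:
  fixes a :: "'i \<Rightarrow> real"
  assumes a: "\<And>i. 0 \<le> a i" and fin: "(\<integral>\<^sup>+i. ennreal (a i) \<partial>count_space UNIV) < \<infinity>"
  shows "a summable_on UNIV" "(\<integral>\<^sup>+i. ennreal (a i) \<partial>count_space UNIV) = ennreal (\<Sum>\<^sub>\<infinity>i. a i)"
proof -
  have int: "integrable (count_space UNIV) a"
    using a fin by (intro integrableI_nonneg) auto
  then have abs: "Infinite_Set_Sum.abs_summable_on a UNIV"
    by (simp add: Infinite_Set_Sum.abs_summable_on_def)
  then show "a summable_on UNIV"
    using abs_summable_equivalent abs_summable_summable by blast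
  have "(\<integral>\<^sup>+i. ennreal (a i) \<partial>count_space UNIV) = ennreal (infsetsum a UNIV)"
    using int a by (subst nn_integral_eq_integral) (auto simp: infsetsum_def)
  then show "(\<integral>\<^sup>+i. ennreal (a i) \<partial>count_space UNIV) = ennreal (\<Sum>\<^sub>\<infinity>i. a i)"
    by (simp add: infsetsum_infsum[OF abs])
qed

lemma infsum_lattice_shift:
  fixes h :: "real^'d \<Rightarrow> real"
  shows "(\<Sum>\<^sub>\<infinity>k. h (\<xi> + rvec j + rvec k)) = (\<Sum>\<^sub>\<infinity>k. h (\<xi> + rvec k))"
proof -
  have "bij (\<lambda>k. j + k)"
    by simp
  from infsum_reindex_bij_betw[OF this, of "\<lambda>k. h (\<xi> + rvec k)"] show ?thesis
    by (simp add: rvec_add add.assoc)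
qed

subsection \<open>Functions whose squared modulus has constant periodization\<close>

text \<open>The quotient map to the torus, with the unit cube as its set of representatives.\<close>

definition cube_part :: "real^'d \<Rightarrow> real^'d" where
  "cube_part x = (\<chi> i. x $ i - of_int \<lfloor>x $ i\<rfloor>)"

lemma borel_measurable_cube_part [measurable]: "cube_part \<in> borel_measurable borel"
proof -
  have "(\<lambda>x. cube_part x \<bullet> b) \<in> borel_measurable (borel :: (real^'d) measure)" if "b \<in> Basis" for b
    using that by (auto simp: Basis_real_vec inner_axis cube_part_def)
  then show ?thesis
    by (subst borel_measurable_euclidean_space) blast
qed

lemma cube_part_unit_cube: "x \<in> unit_cube \<Longrightarrow> cube_part x = x"
  by (simp add: unit_cube_def cube_part_def vec_eq_iff floor_eq_iff)

lemma cube_part_shift: "cube_part (x + rvec k) = cube_part x"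
  by (simp add: cube_part_def rvec_def vec_eq_iff)

lemma cis_inner_cube_part: "cis (2 * pi * (rvec k \<bullet> cube_part x)) = cis (2 * pi * (rvec k \<bullet> x))"
proof -
  define j where "j = (\<chi> i. \<lfloor>x $ i\<rfloor>)"
  define n where "n = (\<Sum>i\<in>UNIV. k $ i * j $ i)"
  have x: "cube_part x = x - rvec j"
    by (simp add: cube_part_def rvec_def j_def vec_eq_iff)
  have "rvec k \<bullet> rvec j = of_int n"
    by (simp add: rvec_def inner_vec_def n_def)
  then have "cis (2 * pi * (rvec k \<bullet> x)) = cis (2 * pi * (rvec k \<bullet> cube_part x)) * cis (2 * pi * of_int n)"
    by (simp add: x inner_diff_right cis_mult algebra_simps)
  then show ?thesis
    by simp
qed

text \<open>Pushed forward along \<open>cube_part\<close>, the measure with density \<open>h\<close>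
  becomes Lebesgue measure on the cube, because the periodization is 1. Lattice characters factor
  through \<open>cube_part\<close>, so their integrals are those over the cube.\<close>

lemma integral_mult_cis_periodization:
  fixes h :: "real^'d \<Rightarrow> real"
  assumes [measurable]: "h \<in> borel_measurable borel" and h: "\<And>x. 0 \<le> h x"
    and one: "AE x in lborel. x \<in> unit_cube \<longrightarrow> (\<integral>\<^sup>+k. ennreal (h (x + rvec k)) \<partial>count_space UNIV) = 1"
  shows "(LINT x|lborel. h x * cis (2 * pi * (rvec k \<bullet> x))) = (if k = 0 then 1 else 0)"
proof -
  have eq: "distr (density lborel (\<lambda>x. ennreal (h x))) borel cube_part = density lborel (indicator unit_cube)"
  proof (rule measure_eqI)
    fix X assume "X \<in> sets (distr (density lborel (\<lambda>x. ennreal (h x))) borel cube_part)"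
    then have [measurable]: "X \<in> sets borel"
      by simp
    have "emeasure (distr (density lborel (\<lambda>x. ennreal (h x))) borel cube_part) X
        = (\<integral>\<^sup>+x. ennreal (h x) * indicator X (cube_part x) \<partial>lborel)"
      by (simp add: nn_integral_distr nn_integral_density flip: nn_integral_indicator)
    also have "\<dots> = (\<integral>\<^sup>+x. (\<integral>\<^sup>+k. ennreal (h (x + rvec k)) * indicator X (cube_part (x + rvec k)) \<partial>count_space UNIV)
        * indicator unit_cube x \<partial>lborel)"
      by (rule nn_integral_periodize) measurable
    also have "\<dots> = (\<integral>\<^sup>+x. indicator unit_cube x * indicator X x \<partial>lborel)"
    proof (rule nn_integral_cong_AE)
      show "AE x in lborel. (\<integral>\<^sup>+k. ennreal (h (x + rvec k)) * indicator X (cube_part (x + rvec k)) \<partial>count_space UNIV)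
          * indicator unit_cube x = indicator unit_cube x * indicator X x"
        using one
      proof eventually_elim
        case (elim x)
        then show ?case
          by (cases "x \<in> unit_cube") (auto simp: cube_part_shift cube_part_unit_cube nn_integral_multc)
      qed
    qed
    also have "\<dots> = emeasure (density lborel (indicator unit_cube)) X"
      by (simp add: emeasure_density)
    finally show "emeasure (distr (density lborel (\<lambda>x. ennreal (h x))) borel cube_part) X
        = emeasure (density lborel (indicator unit_cube)) X" .
  qed simp
  have "(LINT x|lborel. h x * cis (2 * pi * (rvec k \<bullet> x)))
      = (LINT x|lborel. h x *\<^sub>R cis (2 * pi * (rvec k \<bullet> cube_part x)))"
    by (simp add: cis_inner_cube_part scaleR_conv_of_real)
  also have "\<dots> = (LINT x|distr (density lborel (\<lambda>x. ennreal (h x))) borel cube_part. cis (2 * pi * (rvec k \<bullet> x)))"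
    using h by (simp add: integral_distr integral_density)
  also have "\<dots> = (LINT x|density lborel (\<lambda>x. ennreal (indicator unit_cube x)). cis (2 * pi * (rvec k \<bullet> x)))"
    by (simp add: eq ennreal_indicator)
  also have "\<dots> = (LINT x|lborel. indicator unit_cube x * cis (2 * pi * (rvec k \<bullet> x)))"
    by (subst integral_density) (auto simp: scaleR_conv_of_real of_real_indicator)
  also have "\<dots> = (if k = 0 then 1 else 0)"
    by (rule integral_exp_unit_cube)
  finally show ?thesis .
qed

definition orthogonalizer :: "(real^'d \<Rightarrow> complex) \<Rightarrow> real^'d \<Rightarrow> complex" where
  "orthogonalizer u \<xi> = u \<xi> / complex_of_real (sqrt (\<Sum>\<^sub>\<infinity>k. (cmod (u (\<xi> + rvec k)))\<^sup>2))"

text \<open>The denominator is lattice periodic and leaves the sum over \<open>k\<close>. It is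
  finite almost everywhere because its square integrates over the cube to the squared norm of
  \<open>u\<close>, and positive because the term \<open>k = 0\<close> is.\<close>

lemma orthogonalizer_periodization:
  fixes u :: "real^'d \<Rightarrow> complex"
  assumes u: "u \<in> L2" and nz: "AE \<xi> in lborel. u \<xi> \<noteq> 0"
  shows "AE x in lborel. x \<in> unit_cube \<longrightarrow>
    (\<integral>\<^sup>+k. ennreal ((cmod (orthogonalizer u (x + rvec k)))\<^sup>2) \<partial>count_space UNIV) = 1"
proof -
  have [measurable]: "u \<in> borel_measurable borel"
    using u by (auto simp: L2_iff)
  define S where "S x = (\<integral>\<^sup>+k. ennreal ((cmod (u (x + rvec k)))\<^sup>2) \<partial>count_space UNIV)" for x
  have S [measurable]: "S \<in> borel_measurable borel"
    unfolding S_def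
    by (intro sigma_finite_measure.borel_measurable_nn_integral
        sigma_finite_measure_count_space_countable measurable_split_conv) measurable
  have "(\<integral>\<^sup>+x. S x * indicator unit_cube x \<partial>lborel) = (\<integral>\<^sup>+x. ennreal ((cmod (u x))\<^sup>2) \<partial>lborel)"
    unfolding S_def by (rule nn_integral_periodize[symmetric]) measurable
  also have "\<dots> < \<infinity>"
    using L2_integrable[OF u] by (subst nn_integral_eq_integral) auto
  finally have "AE x in lborel. S x * indicator unit_cube x \<noteq> \<infinity>"
    by (intro nn_integral_PInf_AE) auto
  then show ?thesis
    using nz
  proof eventually_elim
    case (elim x)
    show ?case
    proof
      assume "x \<in> unit_cube"
      define a where "a k = (cmod (u (x + rvec k)))\<^sup>2" for k
      have a0: "0 \<le> a k" for k
        by (simp add: a_def)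
      have fin: "(\<integral>\<^sup>+k. ennreal (a k) \<partial>count_space UNIV) < \<infinity>"
        using elim \<open>x \<in> unit_cube\<close> by (simp add: S_def a_def less_top)
      note sum = nn_integral_count_space_infsum[OF a0 fin]
      have "a 0 \<le> (\<Sum>\<^sub>\<infinity>k. a k)"
        using finite_sum_le_infsum[OF sum(1), of "{0}"] a0 by simp
      moreover have "0 < a 0"
        using elim by (simp add: a_def)
      ultimately have pos: "0 < (\<Sum>\<^sub>\<infinity>k. a k)"
        by simp
      have "(\<Sum>\<^sub>\<infinity>j. (cmod (u (x + rvec k + rvec j)))\<^sup>2) = (\<Sum>\<^sub>\<infinity>k. a k)" for k
        unfolding a_def by (rule infsum_lattice_shift[of "\<lambda>x. (cmod (u x))\<^sup>2"])
      then have eq: "(cmod (orthogonalizer u (x + rvec k)))\<^sup>2 = (1 / (\<Sum>\<^sub>\<infinity>k. a k)) * a k" for k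
        using pos by (simp add: orthogonalizer_def norm_divide power_divide a_def)
      have "(\<integral>\<^sup>+k. ennreal ((cmod (orthogonalizer u (x + rvec k)))\<^sup>2) \<partial>count_space UNIV)
          = (\<integral>\<^sup>+k. ennreal (1 / (\<Sum>\<^sub>\<infinity>k. a k)) * ennreal (a k) \<partial>count_space UNIV)"
        unfolding eq using pos by (intro nn_integral_cong ennreal_mult') simp
      also have "\<dots> = ennreal (1 / (\<Sum>\<^sub>\<infinity>k. a k)) * ennreal (\<Sum>\<^sub>\<infinity>k. a k)"
        by (subst nn_integral_cmult) (auto simp: sum(2))
      also have "\<dots> = 1"
        using pos by (simp flip: ennreal_mult')
      finally show "(\<integral>\<^sup>+k. ennreal ((cmod (orthogonalizer u (x + rvec k)))\<^sup>2) \<partial>count_space UNIV) = 1" .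
    qed
  qed
qed

text \<open>On the Fourier side shifts are modulations, so the inner product is a Fourier
  coefficient of the squared modulus of \<open>g\<close>.\<close>

lemma orthonormal_shifts_of_fourier:
  assumes F: "is_fourier_l2 f g"
    and one: "AE x in lborel. x \<in> unit_cube \<longrightarrow>
      (\<integral>\<^sup>+k. ennreal ((cmod (g (x + rvec k)))\<^sup>2) \<partial>count_space UNIV) = 1"
  shows "l2_inner (shifts f j) (shifts f k) = (if j = k then 1 else 0)"
proof -
  have [measurable]: "g \<in> borel_measurable borel"
    using is_fourier_l2_L2(2)[OF F] by (auto simp: L2_iff)
  have "l2_inner (shifts f j) (shifts f k) = l2_inner (\<lambda>\<xi>. cis (- 2 * pi * (rvec j \<bullet> \<xi>)) * g \<xi>)
      (\<lambda>\<xi>. cis (- 2 * pi * (rvec k \<bullet> \<xi>)) * g \<xi>)"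
    unfolding shifts_def[abs_def]
    by (intro fourier_l2_inner is_fourier_l2_translate F)
  also have "\<dots> = (LINT \<xi>|lborel. ((cmod (g \<xi>))\<^sup>2) * cis (2 * pi * (rvec (k - j) \<bullet> \<xi>)))"
    unfolding l2_inner_def
  proof (rule Bochner_Integration.integral_cong[OF refl])
    fix \<xi>
    have "cis (- 2 * pi * (rvec j \<bullet> \<xi>)) * cnj (cis (- 2 * pi * (rvec k \<bullet> \<xi>))) = cis (2 * pi * (rvec (k - j) \<bullet> \<xi>))"
      by (simp add: cis_cnj cis_mult rvec_diff inner_diff_left algebra_simps)
    moreover have "complex_of_real ((cmod (g \<xi>))\<^sup>2) = g \<xi> * cnj (g \<xi>)"
      by (rule complex_norm_square)
    ultimately show "cis (- 2 * pi * (rvec j \<bullet> \<xi>)) * g \<xi> * cnj (cis (- 2 * pi * (rvec k \<bullet> \<xi>)) * g \<xi>)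
        = complex_of_real ((cmod (g \<xi>))\<^sup>2) * cis (2 * pi * (rvec (k - j) \<bullet> \<xi>))"
      by (simp only: complex_cnj_mult) (metis (no_types, lifting) mult.assoc mult.left_commute mult.commute)
  qed
  also have "\<dots> = (if k - j = 0 then 1 else 0)"
    by (rule integral_mult_cis_periodization) (use one in auto)
  finally show ?thesis
    by auto
qed

text \<open>\<open>f\<close> and its conjugate have the same transform, so the four inner products
  in the squared norm of their difference coincide and cancel.\<close>

lemma AE_real_of_fourier_hermitian:
  assumes F: "is_fourier_l2 f g" and g: "\<And>\<xi>. g (- \<xi>) = cnj (g \<xi>)"
  shows "AE x in lborel. cnj (f x) = f x"
proof -
  have f: "f \<in> L2" and gL: "g \<in> L2"
    using is_fourier_l2_L2[OF F] by auto
  have F': "is_fourier_l2 (\<lambda>x. cnj (f x)) g"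
    using is_fourier_l2_cnj[OF F] by (simp add: g)
  have "complex_of_real ((l2_norm (\<lambda>x. cnj (f x) - f x))\<^sup>2) = l2_inner (\<lambda>x. cnj (f x) - f x) (\<lambda>x. cnj (f x) - f x)"
    by (simp only: l2_inner_self)
  also have "\<dots> = 0"
    using f by (simp add: l2_inner_diff_left l2_inner_diff_right L2_cnj L2_diff fourier_l2_inner[OF F F]
        fourier_l2_inner[OF F F'] fourier_l2_inner[OF F' F] fourier_l2_inner[OF F' F'])
  finally have "l2_norm (\<lambda>x. cnj (f x) - f x) = 0"
    by simp
  then have "AE x in lborel. cnj (f x) - f x = 0"
    by (intro l2_norm_eq_0_AE L2_diff L2_cnj f)
  then show ?thesis
    by simp
qed

context two_digit
begin

lemma orthogonalization_L2: "is_orthogonalization (tile_bspline G n) \<phi>1 \<Longrightarrow> \<phi>1 \<in> L2"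
  unfolding is_orthogonalization_def by (rule is_fourier_l2_L2)

lemma orthogonalization_orthonormal:
  assumes "is_orthogonalization (tile_bspline G n) \<phi>1"
  shows "l2_inner (shifts \<phi>1 j) (shifts \<phi>1 k) = (if j = k then 1 else 0)"
proof (rule orthonormal_shifts_of_fourier)
  show "is_fourier_l2 \<phi>1 (orthogonalizer (fourier (tile_bspline G n)))"
    using assms by (simp add: is_orthogonalization_def orthogonalizer_def[abs_def])
  show "AE x in lborel. x \<in> unit_cube \<longrightarrow>
      (\<integral>\<^sup>+k. ennreal ((cmod (orthogonalizer (fourier (tile_bspline G n)) (x + rvec k)))\<^sup>2) \<partial>count_space UNIV) = 1"
    by (rule orthogonalizer_periodization[OF fourier_bspline_L2 fourier_bspline_nonzero])
qed

text \<open>The indicator of the tile is real, so its transform is hermitian;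
  \<open>k \<mapsto> - k\<close> permutes the lattice, so the denominator is even.\<close>

lemma orthogonalization_AE_real:
  assumes "is_orthogonalization (tile_bspline G n) \<phi>1"
  shows "AE x in lborel. cnj (\<phi>1 x) = \<phi>1 x"
proof (rule AE_real_of_fourier_hermitian)
  define u where "u = fourier (tile_bspline G n)"
  show "is_fourier_l2 \<phi>1 (orthogonalizer u)"
    using assms by (simp add: is_orthogonalization_def orthogonalizer_def[abs_def] u_def)
  fix \<xi>
  have u: "u (- \<xi>) = cnj (u \<xi>)" for \<xi>
    by (simp add: u_def fourier_bspline_reflect)
  have "(\<Sum>\<^sub>\<infinity>k. (cmod (u (- \<xi> + rvec k)))\<^sup>2) = (\<Sum>\<^sub>\<infinity>k. (cmod (u (\<xi> + rvec (- k))))\<^sup>2)"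
  proof (rule infsum_cong)
    fix k
    show "(cmod (u (- \<xi> + rvec k)))\<^sup>2 = (cmod (u (\<xi> + rvec (- k))))\<^sup>2"
      using u[of "\<xi> - rvec k"] by (simp add: rvec_minus)
  qed
  also have "\<dots> = (\<Sum>\<^sub>\<infinity>k. (cmod (u (\<xi> + rvec k)))\<^sup>2)"
    by (rule infsum_reindex_bij_betw[OF bij_uminus, of "\<lambda>k. (cmod (u (\<xi> + rvec k)))\<^sup>2"])
  finally show "orthogonalizer u (- \<xi>) = cnj (orthogonalizer u \<xi>)"
    by (simp add: orthogonalizer_def u)
qed

end

section \<open>Orthogonal series\<close>

subsection \<open>Completeness\<close>

text \<open>The weights 2^n leave the integrals of \<open>2 ^ n * (cmod (F n x))\<^sup>2\<close>
  bounded by 2^-n. At almost every point these terms are therefore bounded, and \<open>F n x\<close>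
  decays at least like sqrt(1/2)^n.\<close>

lemma AE_summable_of_l2_bound:
  fixes F :: "nat \<Rightarrow> real^'d \<Rightarrow> complex"
  assumes F: "\<And>n. F n \<in> L2" and bound: "\<And>n. l2_norm (F n) \<le> (1 / 2) ^ n"
  shows "AE x in lborel. summable (\<lambda>n. F n x)"
proof -
  have [measurable]: "F n \<in> borel_measurable borel" for n
    using F by (auto simp: L2_iff)
  have "(\<integral>\<^sup>+x. (\<Sum>n. ennreal (2 ^ n * (cmod (F n x))\<^sup>2)) \<partial>lborel)
      = (\<Sum>n. \<integral>\<^sup>+x. ennreal (2 ^ n * (cmod (F n x))\<^sup>2) \<partial>lborel)"
    by (rule nn_integral_suminf) measurable
  also have "\<dots> \<le> (\<Sum>n. ennreal ((1 / 2) ^ n))"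
  proof (rule suminf_le)
    fix n
    have "(\<integral>\<^sup>+x. ennreal (2 ^ n * (cmod (F n x))\<^sup>2) \<partial>lborel) = ennreal (2 ^ n * (l2_norm (F n))\<^sup>2)"
      using L2_integrable[OF F] by (subst nn_integral_eq_integral) (auto simp: l2_norm_power2)
    also have "2 ^ n * (l2_norm (F n))\<^sup>2 \<le> 2 ^ n * ((1 / 2) ^ n)\<^sup>2"
      using bound by (intro mult_left_mono power_mono) auto
    also have "\<dots> = (1 / 2) ^ n"
      by (simp add: power2_eq_square field_simps flip: power_mult_distrib)
    finally show "(\<integral>\<^sup>+x. ennreal (2 ^ n * (cmod (F n x))\<^sup>2) \<partial>lborel) \<le> ennreal ((1 / 2) ^ n)"
      by (simp add: ennreal_leI)
  qed auto
  also have "\<dots> = ennreal (\<Sum>n. (1 / 2) ^ n)"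
    by (intro suminf_ennreal2) auto
  also have "\<dots> < \<infinity>"
    by simp
  finally have "AE x in lborel. (\<Sum>n. ennreal (2 ^ n * (cmod (F n x))\<^sup>2)) \<noteq> \<infinity>"
    by (intro nn_integral_PInf_AE) auto
  then show ?thesis
  proof eventually_elim
    case (elim x)
    define s where "s n = 2 ^ n * (cmod (F n x))\<^sup>2" for n
    have "summable s"
      using elim unfolding s_def by (intro summable_suminf_not_top) auto
    then have "bounded (range s)"
      by (intro convergent_imp_bounded[OF summable_LIMSEQ_zero])
    then obtain C where "\<And>n. norm (s n) \<le> C"
      by (auto simp: bounded_iff)
    then have C: "s n \<le> C" for n
      by (metis abs_ge_self order_trans real_norm_def)
    have C0: "0 \<le> C"
      using C[of 0] by (auto simp: s_def intro: order_trans[rotated])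
    define q where "q = sqrt (1 / 2)"
    have le: "cmod (F n x) \<le> sqrt C * q ^ n" for n
    proof (rule power2_le_imp_le)
      have "(cmod (F n x))\<^sup>2 \<le> C * (1 / 2) ^ n"
        using C[of n] by (simp add: s_def field_simps)
      also have "\<dots> = (sqrt C * q ^ n)\<^sup>2"
      proof -
        have "(q ^ n)\<^sup>2 = (q * q) ^ n"
          by (simp add: power2_eq_square power_mult_distrib)
        also have "q * q = 1 / 2"
          by (simp add: q_def)
        finally show ?thesis
          using C0 by (simp add: power_mult_distrib)
      qed
      finally show "(cmod (F n x))\<^sup>2 \<le> (sqrt C * q ^ n)\<^sup>2" .
    qed (use C0 in \<open>auto simp: q_def\<close>)
    have "summable (\<lambda>n. sqrt C * q ^ n)"
      by (intro summable_mult summable_geometric) (auto simp: q_def real_sqrt_divide)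
    then show ?case
      by (rule summable_comparison_test[rotated]) (use le in blast)
  qed
qed

text \<open>The Riesz-Fischer argument for a fast Cauchy sequence: pointwise limits exist almost
  everywhere, and Fatou's lemma transfers the norm bounds to the limit.\<close>

lemma L2_complete:
  fixes F :: "nat \<Rightarrow> real^'d \<Rightarrow> complex"
  assumes F: "\<And>n. F n \<in> L2" and cauchy: "\<And>n. l2_norm (\<lambda>x. F (Suc n) x - F n x) \<le> (1 / 2) ^ n"
  shows "\<exists>f\<in>L2. \<forall>n. l2_norm (\<lambda>x. F n x - f x) \<le> 2 * (1 / 2) ^ n"
proof -
  have [measurable]: "F n \<in> borel_measurable borel" for n
    using F by (auto simp: L2_iff)
  \<comment> \<open>Where the sequence diverges, \<open>lim\<close> is unspecified; \<open>f\<close>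
    is Borel nevertheless, and only its values almost everywhere enter.\<close>
  define f where "f x = lim (\<lambda>n. F n x)" for x
  have [measurable]: "f \<in> borel_measurable borel"
    unfolding f_def by measurable
  have "AE x in lborel. summable (\<lambda>n. F (Suc n) x - F n x)"
    by (rule AE_summable_of_l2_bound[OF L2_diff[OF F F] cauchy])
  then have conv: "AE x in lborel. (\<lambda>n. F n x) \<longlonglongrightarrow> f x"
  proof eventually_elim
    case (elim x)
    then have "convergent (\<lambda>n. \<Sum>i<n. F (Suc i) x - F i x)"
      by (simp add: summable_iff_convergent)
    then have "convergent (\<lambda>n. (\<Sum>i<n. F (Suc i) x - F i x) + F 0 x)"
      by (simp add: convergent_add_const_right_iff)
    then have "convergent (\<lambda>n. F n x)"
      using sum_lessThan_telescope[of "\<lambda>i. F i x"] by simp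
    then show ?case
      by (simp add: f_def convergent_LIMSEQ_iff)
  qed
  have step: "l2_norm (\<lambda>x. F n x - F (n + m) x) \<le> (1 / 2) ^ n * (2 - 2 * (1 / 2) ^ m)" for n m
  proof (induction m)
    case (Suc m)
    have "l2_norm (\<lambda>x. F n x - F (n + Suc m) x)
        \<le> l2_norm (\<lambda>x. F n x - F (n + m) x) + l2_norm (\<lambda>x. F (n + m) x - F (n + Suc m) x)"
      by (intro l2_norm_triangle_diff F)
    also have "\<dots> \<le> (1 / 2) ^ n * (2 - 2 * (1 / 2) ^ m) + (1 / 2) ^ (n + m)"
      using Suc cauchy[of "n + m"] by (intro add_mono) (auto simp: l2_norm_minus_commute[of "F (n + m)"])
    also have "\<dots> = (1 / 2) ^ n * (2 - 2 * (1 / 2) ^ Suc m)"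
      by (simp add: power_add algebra_simps)
    finally show ?case .
  qed simp
  have fatou: "(\<integral>\<^sup>+x. ennreal ((cmod (F n x - f x))\<^sup>2) \<partial>lborel) \<le> ennreal ((2 * (1 / 2) ^ n)\<^sup>2)" for n
  proof -
    have "(\<integral>\<^sup>+x. ennreal ((cmod (F n x - f x))\<^sup>2) \<partial>lborel)
        = (\<integral>\<^sup>+x. liminf (\<lambda>m. ennreal ((cmod (F n x - F (n + m) x))\<^sup>2)) \<partial>lborel)"
    proof (rule nn_integral_cong_AE)
      show "AE x in lborel. ennreal ((cmod (F n x - f x))\<^sup>2) = liminf (\<lambda>m. ennreal ((cmod (F n x - F (n + m) x))\<^sup>2))"
        using conv
      proof eventually_elim
        case (elim x)
        have "(\<lambda>m. F (n + m) x) \<longlonglongrightarrow> f x"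
          using LIMSEQ_ignore_initial_segment[OF elim, of n] by (simp add: add.commute)
        then have "(\<lambda>m. ennreal ((cmod (F n x - F (n + m) x))\<^sup>2)) \<longlonglongrightarrow> ennreal ((cmod (F n x - f x))\<^sup>2)"
          by (intro tendsto_intros tendsto_ennrealI)
        from lim_imp_Liminf[OF sequentially_bot this] show ?case
          by (rule sym)
      qed
    qed
    also have "\<dots> \<le> liminf (\<lambda>m. \<integral>\<^sup>+x. ennreal ((cmod (F n x - F (n + m) x))\<^sup>2) \<partial>lborel)"
      by (rule nn_integral_liminf) measurable
    also have "\<dots> \<le> liminf (\<lambda>m. ennreal ((2 * (1 / 2) ^ n)\<^sup>2))"
    proof (rule Liminf_mono[OF always_eventually[OF allI]])
      fix m
      have "(\<integral>\<^sup>+x. ennreal ((cmod (F n x - F (n + m) x))\<^sup>2) \<partial>lborel) = ennreal ((l2_norm (\<lambda>x. F n x - F (n + m) x))\<^sup>2)"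
        using L2_integrable[OF L2_diff[OF F F]] by (subst nn_integral_eq_integral) (auto simp: l2_norm_power2)
      also have "\<dots> \<le> ennreal ((2 * (1 / 2) ^ n)\<^sup>2)"
      proof (intro ennreal_leI power_mono)
        have "(1 / 2 :: real) ^ n * (2 - 2 * (1 / 2) ^ m) \<le> (1 / 2) ^ n * 2"
          by (intro mult_left_mono) auto
        then show "l2_norm (\<lambda>x. F n x - F (n + m) x) \<le> 2 * (1 / 2) ^ n"
          using step[of n m] by linarith
      qed auto
      finally show "(\<integral>\<^sup>+x. ennreal ((cmod (F n x - F (n + m) x))\<^sup>2) \<partial>lborel) \<le> ennreal ((2 * (1 / 2) ^ n)\<^sup>2)" .
    qed
    also have "\<dots> = ennreal ((2 * (1 / 2) ^ n)\<^sup>2)"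
      by (rule Liminf_const) simp
    finally show ?thesis .
  qed
  have diff: "(\<lambda>x. F n x - f x) \<in> L2" for n
    unfolding L2_iff
  proof
    show "integrable lborel (\<lambda>x. (cmod (F n x - f x))\<^sup>2)"
      using fatou[of n] by (intro integrableI_nonneg) (auto simp: le_less_trans)
  qed measurable
  have "f \<in> L2"
    using L2_diff[OF F[of 0] diff[of 0]] by simp
  moreover have "l2_norm (\<lambda>x. F n x - f x) \<le> 2 * (1 / 2) ^ n" for n
  proof (rule power2_le_imp_le)
    have "ennreal ((l2_norm (\<lambda>x. F n x - f x))\<^sup>2) = (\<integral>\<^sup>+x. ennreal ((cmod (F n x - f x))\<^sup>2) \<partial>lborel)"
      using L2_integrable[OF diff] by (subst nn_integral_eq_integral) (auto simp: l2_norm_power2)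
    also have "\<dots> \<le> ennreal ((2 * (1 / 2) ^ n)\<^sup>2)"
      by (rule fatou)
    finally show "(l2_norm (\<lambda>x. F n x - f x))\<^sup>2 \<le> (2 * (1 / 2) ^ n)\<^sup>2"
      by (subst (asm) ennreal_le_iff) auto
  qed simp
  ultimately show ?thesis
    by blast
qed

lemma l2_norm_orthogonal_sum:
  assumes u: "\<And>i. u i \<in> L2" and orth: "\<And>i j. i \<noteq> j \<Longrightarrow> l2_inner (u i) (u j) = 0" and A: "finite A"
  shows "(l2_norm (\<lambda>x. \<Sum>i\<in>A. u i x))\<^sup>2 = (\<Sum>i\<in>A. (l2_norm (u i))\<^sup>2)"
  using A
proof induction
  case (insert a A)
  have "l2_inner (u a) (\<lambda>x. \<Sum>i\<in>A. u i x) = (\<Sum>i\<in>A. l2_inner (u a) (u i))"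
    by (intro l2_inner_sum_right u)
  also have "\<dots> = 0"
    using insert(2) by (intro sum.neutral ballI orth) auto
  finally show ?case
    using insert by (simp add: l2_norm_add_power2 u L2_sum)
qed simp

text \<open>By Pythagoras the tail of the squared norms controls the tail of the series. Finite sets
  \<open>A n\<close> missing at most 4^-n of the total give a fast Cauchy sequence, and every finite
  superset of \<open>A n\<close> stays within 2^-n of its partial sum.\<close>

lemma orthogonal_series_converges:
  assumes u: "\<And>i. u i \<in> L2" and orth: "\<And>i j. i \<noteq> j \<Longrightarrow> l2_inner (u i) (u j) = 0"
    and sum: "(\<lambda>i. (l2_norm (u i))\<^sup>2) summable_on UNIV"
  shows "\<exists>f. has_l2_sum u f"
proof -
  define p where "p i = (l2_norm (u i))\<^sup>2" for i
  define S where "S = infsum p UNIV"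
  have p: "(p has_sum S) UNIV"
    using sum by (simp add: p_def[abs_def] S_def has_sum_infsum)
  have "\<exists>A. finite A \<and> S - (1 / 4) ^ n < sum p A" for n
  proof -
    have "\<forall>\<^sub>F A in finite_subsets_at_top UNIV. S - (1 / 4) ^ n < sum p A"
      using p by (intro order_tendstoD(1)[of _ S]) (auto simp: has_sum_def)
    then show ?thesis
      by (auto simp: eventually_finite_subsets_at_top)
  qed
  then obtain B where B: "\<And>n. finite (B n)" "\<And>n. S - (1 / 4) ^ n < sum p (B n)"
    by metis
  \<comment> \<open>Unions make the sets increasing, as the comparison of consecutive partial sums
    requires.\<close>
  define A where "A n = (\<Union>k\<le>n. B k)" for n
  have A: "finite (A n)" "A n \<subseteq> A (Suc n)" for n
    unfolding A_def using B(1) by (simp, intro UN_mono atMost_subset_iff[THEN iffD2] subset_refl) simp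
  have tail: "l2_norm (\<lambda>x. (\<Sum>i\<in>C. u i x) - (\<Sum>i\<in>A n. u i x)) \<le> (1 / 2) ^ n" if "finite C" "A n \<subseteq> C" for n C
  proof (rule power2_le_imp_le)
    have "(\<lambda>x. (\<Sum>i\<in>C. u i x) - (\<Sum>i\<in>A n. u i x)) = (\<lambda>x. \<Sum>i\<in>C - A n. u i x)"
      using that by (simp add: sum_diff)
    then have "(l2_norm (\<lambda>x. (\<Sum>i\<in>C. u i x) - (\<Sum>i\<in>A n. u i x)))\<^sup>2 = sum p (C - A n)"
      using that by (simp add: l2_norm_orthogonal_sum[OF u orth] p_def)
    also have "\<dots> \<le> sum p (C - B n)"
      using that by (intro sum_mono2) (auto simp: A_def p_def)
    also have "\<dots> = sum p C - sum p (B n)"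
      using that B(1) by (intro sum_diff) (auto simp: A_def)
    also have "sum p C \<le> S"
      unfolding S_def using p that by (intro finite_sum_le_infsum) (auto simp: p_def has_sum_imp_summable)
    also have "S - sum p (B n) \<le> (1 / 4) ^ n"
      using B(2)[of n] by simp
    also have "(1 / 4 :: real) ^ n = ((1 / 2) ^ n)\<^sup>2"
      by (simp add: power2_eq_square flip: power_mult_distrib)
    finally show "(l2_norm (\<lambda>x. (\<Sum>i\<in>C. u i x) - (\<Sum>i\<in>A n. u i x)))\<^sup>2 \<le> ((1 / 2) ^ n)\<^sup>2"
      by simp
  qed simp
  have "\<exists>f\<in>L2. \<forall>n. l2_norm (\<lambda>x. (\<Sum>i\<in>A n. u i x) - f x) \<le> 2 * (1 / 2) ^ n"
    by (rule L2_complete[OF L2_sum[OF u] tail[OF A]])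
  then obtain f where f: "f \<in> L2" "\<And>n. l2_norm (\<lambda>x. (\<Sum>i\<in>A n. u i x) - f x) \<le> 2 * (1 / 2) ^ n"
    by auto
  have "((\<lambda>C. l2_norm (\<lambda>x. (\<Sum>i\<in>C. u i x) - f x)) \<longlongrightarrow> 0) (finite_subsets_at_top UNIV)"
  proof (rule tendstoI)
    fix e :: real assume "0 < e"
    then obtain n where n: "(1 / 2 :: real) ^ n < e / 3"
      using real_arch_pow_inv[of "e / 3" "1 / 2"] by auto
    show "\<forall>\<^sub>F C in finite_subsets_at_top UNIV. dist (l2_norm (\<lambda>x. (\<Sum>i\<in>C. u i x) - f x)) 0 < e"
      unfolding eventually_finite_subsets_at_top
    proof (intro exI[of _ "A n"] conjI allI impI)
      fix C assume C: "finite C \<and> A n \<subseteq> C \<and> C \<subseteq> UNIV"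
      have "l2_norm (\<lambda>x. (\<Sum>i\<in>C. u i x) - f x)
          \<le> l2_norm (\<lambda>x. (\<Sum>i\<in>C. u i x) - (\<Sum>i\<in>A n. u i x)) + l2_norm (\<lambda>x. (\<Sum>i\<in>A n. u i x) - f x)"
        by (intro l2_norm_triangle_diff L2_sum u f)
      also have "\<dots> \<le> (1 / 2) ^ n + 2 * (1 / 2) ^ n"
        using C by (intro add_mono tail f) auto
      finally show "dist (l2_norm (\<lambda>x. (\<Sum>i\<in>C. u i x) - f x)) 0 < e"
        using n by simp
    qed (use A in auto)
  qed
  then have "has_l2_sum u f"
    by (simp add: has_l2_sum_def l2_tendsto_def f L2_sum u)
  then show ?thesis
    by (intro exI[of _ f])
qed

subsection \<open>Coefficients and closed spans\<close>

lemma has_l2_sum_L2: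
  assumes "has_l2_sum u f"
  shows "f \<in> L2" "u i \<in> L2"
proof -
  have "\<forall>A. (\<lambda>x. \<Sum>i\<in>A. u i x) \<in> L2"
    using assms by (simp add: has_l2_sum_def l2_tendsto_def)
  from spec[OF this, of "{i}"] show "u i \<in> L2"
    by simp
qed (use assms in \<open>simp add: has_l2_sum_def l2_tendsto_def\<close>)

lemma has_l2_sum_inner:
  assumes u: "has_l2_sum u f" and g: "g \<in> L2"
  shows "((\<lambda>i. l2_inner (u i) g) has_sum l2_inner f g) UNIV"
  using l2_tendsto_inner[OF u[unfolded has_l2_sum_def] l2_tendsto_const[OF g]]
  by (simp add: has_sum_def l2_inner_sum_left has_l2_sum_L2[OF u] g)

lemma has_l2_sum_reindex:
  assumes u: "has_l2_sum u f" and g: "bij g"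
  shows "has_l2_sum (\<lambda>i. u (g i)) f"
proof -
  have inj: "inj g"
    using g by (simp add: bij_def)
  have "filterlim (image g) (finite_subsets_at_top UNIV) (finite_subsets_at_top UNIV)"
    using filtermap_image_finite_subsets_at_top[OF inj] bij_is_surj[OF g] by (simp add: filterlim_def)
  moreover have "((\<lambda>A. l2_norm (\<lambda>x. (\<Sum>i\<in>A. u i x) - f x)) \<longlongrightarrow> 0) (finite_subsets_at_top UNIV)"
    using u by (simp add: has_l2_sum_def l2_tendsto_def)
  ultimately have "((\<lambda>A. l2_norm (\<lambda>x. (\<Sum>i\<in>g ` A. u i x) - f x)) \<longlongrightarrow> 0) (finite_subsets_at_top UNIV)"
    by (rule filterlim_compose[rotated])
  moreover have "(\<Sum>i\<in>g ` A. u i x) = (\<Sum>i\<in>A. u (g i) x)" for A x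
    by (subst sum.reindex) (auto intro: inj_on_subset[OF inj])
  ultimately show ?thesis
    using has_l2_sum_L2[OF u] by (simp add: has_l2_sum_def l2_tendsto_def L2_sum)
qed

lemma closed_span_L2: "f \<in> closed_span b \<Longrightarrow> f \<in> L2"
  by (simp add: closed_span_def)

lemma closed_spanD:
  assumes "f \<in> closed_span b" "\<epsilon> > 0"
  obtains A a where "finite A" "l2_norm (\<lambda>x. f x - (\<Sum>i\<in>A. a i * b i x)) < \<epsilon>"
  using assms by (auto simp: closed_span_def)

lemma sum_in_closed_span:
  assumes "\<And>i. b i \<in> L2" "finite A"
  shows "(\<lambda>x. \<Sum>i\<in>A. a i * b i x) \<in> closed_span b"
  unfolding closed_span_def
proof (intro CollectI conjI allI impI)
  show "(\<lambda>x. \<Sum>i\<in>A. a i * b i x) \<in> L2"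
    by (intro L2_sum L2_scale assms)
  fix \<epsilon> :: real assume "\<epsilon> > 0"
  then show "\<exists>B c. finite B \<and> l2_norm (\<lambda>x. (\<Sum>i\<in>A. a i * b i x) - (\<Sum>i\<in>B. c i * b i x)) < \<epsilon>"
    using assms(2) by (intro exI[of _ A] exI[of _ a]) auto
qed

lemma mem_closed_span:
  assumes "\<And>i. b i \<in> L2"
  shows "b i \<in> closed_span b"
  using sum_in_closed_span[OF assms, of "{i}" "\<lambda>_. 1"] by simp

lemma closed_span_closed:
  assumes b: "\<And>i. b i \<in> L2" and f: "f \<in> L2"
    and approx: "\<And>\<epsilon>. \<epsilon> > 0 \<Longrightarrow> \<exists>g\<in>closed_span b. l2_norm (\<lambda>x. f x - g x) < \<epsilon>"
  shows "f \<in> closed_span b"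
  unfolding closed_span_def
proof (intro CollectI conjI allI impI f)
  fix \<epsilon> :: real assume "\<epsilon> > 0"
  then obtain g where g: "g \<in> closed_span b" "l2_norm (\<lambda>x. f x - g x) < \<epsilon> / 2"
    using approx[of "\<epsilon> / 2"] by auto
  obtain A a where A: "finite A" "l2_norm (\<lambda>x. g x - (\<Sum>i\<in>A. a i * b i x)) < \<epsilon> / 2"
    using closed_spanD[OF g(1), of "\<epsilon> / 2"] \<open>\<epsilon> > 0\<close> by auto
  have "l2_norm (\<lambda>x. f x - (\<Sum>i\<in>A. a i * b i x))
      \<le> l2_norm (\<lambda>x. f x - g x) + l2_norm (\<lambda>x. g x - (\<Sum>i\<in>A. a i * b i x))"
    by (intro l2_norm_triangle_diff f closed_span_L2[OF g(1)] L2_sum L2_scale b)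
  also have "\<dots> < \<epsilon>"
    using g A by simp
  finally show "\<exists>A a. finite A \<and> l2_norm (\<lambda>x. f x - (\<Sum>i\<in>A. a i * b i x)) < \<epsilon>"
    using A(1) by blast
qed

lemma closed_span_add:
  assumes b: "\<And>i. b i \<in> L2" and f: "f \<in> closed_span b" and g: "g \<in> closed_span b"
  shows "(\<lambda>x. f x + g x) \<in> closed_span b"
proof (rule closed_span_closed[OF b L2_add[OF closed_span_L2[OF f] closed_span_L2[OF g]]])
  fix \<epsilon> :: real assume "\<epsilon> > 0"
  obtain A a where A: "finite A" "l2_norm (\<lambda>x. f x - (\<Sum>i\<in>A. a i * b i x)) < \<epsilon> / 2"
    using closed_spanD[OF f, of "\<epsilon> / 2"] \<open>\<epsilon> > 0\<close> by auto
  obtain B c where B: "finite B" "l2_norm (\<lambda>x. g x - (\<Sum>i\<in>B. c i * b i x)) < \<epsilon> / 2"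
    using closed_spanD[OF g, of "\<epsilon> / 2"] \<open>\<epsilon> > 0\<close> by auto
  define h where "h x = (\<Sum>i\<in>A \<union> B. ((if i \<in> A then a i else 0) + (if i \<in> B then c i else 0)) * b i x)" for x
  have h: "h x = (\<Sum>i\<in>A. a i * b i x) + (\<Sum>i\<in>B. c i * b i x)" for x
  proof -
    have "h x = (\<Sum>i\<in>A \<union> B. if i \<in> A then a i * b i x else 0) + (\<Sum>i\<in>A \<union> B. if i \<in> B then c i * b i x else 0)"
      unfolding h_def by (subst sum.distrib[symmetric]) (intro sum.cong, auto simp: distrib_right)
    also have "(\<Sum>i\<in>A \<union> B. if i \<in> A then a i * b i x else 0) = (\<Sum>i\<in>A. a i * b i x)"
      using A(1) B(1) by (intro sum.mono_neutral_cong_right) auto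
    also have "(\<Sum>i\<in>A \<union> B. if i \<in> B then c i * b i x else 0) = (\<Sum>i\<in>B. c i * b i x)"
      using A(1) B(1) by (intro sum.mono_neutral_cong_right) auto
    finally show ?thesis .
  qed
  have "h \<in> closed_span b"
    unfolding h_def[abs_def] using A(1) B(1) by (intro sum_in_closed_span b) auto
  moreover have "l2_norm (\<lambda>x. (f x + g x) - h x) < \<epsilon>"
  proof -
    have "l2_norm (\<lambda>x. (f x - (\<Sum>i\<in>A. a i * b i x)) + (g x - (\<Sum>i\<in>B. c i * b i x)))
        \<le> l2_norm (\<lambda>x. f x - (\<Sum>i\<in>A. a i * b i x)) + l2_norm (\<lambda>x. g x - (\<Sum>i\<in>B. c i * b i x))"
      by (intro l2_norm_triangle L2_diff closed_span_L2[OF f] closed_span_L2[OF g] L2_sum L2_scale b)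
    then show ?thesis
      using A(2) B(2) by (simp add: h algebra_simps)
  qed
  ultimately show "\<exists>h\<in>closed_span b. l2_norm (\<lambda>x. (f x + g x) - h x) < \<epsilon>"
    by blast
qed

lemma closed_span_scale:
  assumes b: "\<And>i. b i \<in> L2" and f: "f \<in> closed_span b"
  shows "(\<lambda>x. c * f x) \<in> closed_span b"
proof (rule closed_span_closed[OF b L2_scale[OF closed_span_L2[OF f]]])
  fix \<epsilon> :: real assume "\<epsilon> > 0"
  then have "\<epsilon> / (cmod c + 1) > 0"
    by (simp add: add_nonneg_pos)
  then obtain A a where A: "finite A" "l2_norm (\<lambda>x. f x - (\<Sum>i\<in>A. a i * b i x)) < \<epsilon> / (cmod c + 1)"
    using closed_spanD[OF f] by metis
  have "l2_norm (\<lambda>x. c * f x - (\<Sum>i\<in>A. (c * a i) * b i x)) = l2_norm (\<lambda>x. c * (f x - (\<Sum>i\<in>A. a i * b i x)))"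
    by (simp add: right_diff_distrib sum_distrib_left mult.assoc)
  also have "\<dots> = cmod c * l2_norm (\<lambda>x. f x - (\<Sum>i\<in>A. a i * b i x))"
    by (rule l2_norm_scale)
  also have "\<dots> \<le> (cmod c + 1) * l2_norm (\<lambda>x. f x - (\<Sum>i\<in>A. a i * b i x))"
    by (intro mult_right_mono) auto
  also have "\<dots> < (cmod c + 1) * (\<epsilon> / (cmod c + 1))"
    by (intro mult_strict_left_mono A(2)) (simp add: add_nonneg_pos)
  also have "\<dots> = \<epsilon>"
    using add_nonneg_pos[of "cmod c" 1] by simp
  finally show "\<exists>g\<in>closed_span b. l2_norm (\<lambda>x. c * f x - g x) < \<epsilon>"
    by (intro bexI[of _ "\<lambda>x. \<Sum>i\<in>A. (c * a i) * b i x"] sum_in_closed_span b A(1))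
qed

lemma closed_span_sum:
  assumes b: "\<And>i. b i \<in> L2" and f: "\<And>i. i \<in> A \<Longrightarrow> f i \<in> closed_span b"
  shows "(\<lambda>x. \<Sum>i\<in>A. f i x) \<in> closed_span b"
  using f
proof (induction A rule: infinite_finite_induct)
  case (insert i A)
  then have "(\<lambda>x. f i x + (\<Sum>i\<in>A. f i x)) \<in> closed_span b"
    by (intro closed_span_add b) auto
  with insert show ?case
    by simp
qed (use sum_in_closed_span[OF b, of "{}"] in auto)

lemma closed_span_mono:
  assumes b: "\<And>i. b i \<in> L2" and b': "\<And>i. b' i \<in> L2" and sub: "\<And>i. b i \<in> closed_span b'"
  shows "closed_span b \<subseteq> closed_span b'"
proof
  fix f assume f: "f \<in> closed_span b"
  show "f \<in> closed_span b'"
  proof (rule closed_span_closed[OF b' closed_span_L2[OF f]])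
    fix \<epsilon> :: real assume "\<epsilon> > 0"
    then obtain A a where "finite A" "l2_norm (\<lambda>x. f x - (\<Sum>i\<in>A. a i * b i x)) < \<epsilon>"
      using closed_spanD[OF f] by metis
    moreover have "(\<lambda>x. \<Sum>i\<in>A. a i * b i x) \<in> closed_span b'"
      by (intro closed_span_sum closed_span_scale b' sub)
    ultimately show "\<exists>g\<in>closed_span b'. l2_norm (\<lambda>x. f x - g x) < \<epsilon>"
      by (intro bexI[of _ "\<lambda>x. \<Sum>i\<in>A. a i * b i x"])
  qed
qed

lemma has_l2_sum_in_closed_span:
  assumes b: "\<And>i. b i \<in> L2" and u: "has_l2_sum u f" "\<And>i. u i \<in> closed_span b"
  shows "f \<in> closed_span b"
proof (rule closed_span_closed[OF b has_l2_sum_L2(1)[OF u(1)]])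
  fix \<epsilon> :: real assume "\<epsilon> > 0"
  then have "\<forall>\<^sub>F A in finite_subsets_at_top UNIV. l2_norm (\<lambda>x. (\<Sum>i\<in>A. u i x) - f x) < \<epsilon>"
    using u(1) by (intro order_tendstoD(2)[of _ 0]) (auto simp: has_l2_sum_def l2_tendsto_def)
  then obtain A where "l2_norm (\<lambda>x. (\<Sum>i\<in>A. u i x) - f x) < \<epsilon>"
    by (auto simp: eventually_finite_subsets_at_top)
  then have "l2_norm (\<lambda>x. f x - (\<Sum>i\<in>A. u i x)) < \<epsilon>"
    by (simp add: l2_norm_minus_commute[of f])
  moreover have "(\<lambda>x. \<Sum>i\<in>A. u i x) \<in> closed_span b"
    by (intro closed_span_sum b u)
  ultimately show "\<exists>g\<in>closed_span b. l2_norm (\<lambda>x. f x - g x) < \<epsilon>"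
    by (intro bexI[of _ "\<lambda>x. \<Sum>i\<in>A. u i x"])
qed

lemma orthogonal_closed_span:
  assumes b: "\<And>i. b i \<in> L2" and h: "h \<in> L2" "\<And>i. l2_inner h (b i) = 0" and g: "g \<in> closed_span b"
  shows "l2_inner h g = 0"
proof -
  have "cmod (l2_inner h g) \<le> 0"
  proof (rule field_le_epsilon)
    fix e :: real assume "e > 0"
    then have "e / (l2_norm h + 1) > 0"
      by (simp add: add_nonneg_pos)
    then obtain A a where A: "l2_norm (\<lambda>x. g x - (\<Sum>i\<in>A. a i * b i x)) < e / (l2_norm h + 1)"
      using closed_spanD[OF g] by metis
    have S: "(\<lambda>x. \<Sum>i\<in>A. a i * b i x) \<in> L2"
      by (intro L2_sum L2_scale b)
    have "l2_inner h (\<lambda>x. \<Sum>i\<in>A. a i * b i x) = 0"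
      using h by (subst l2_inner_sum_right) (auto intro: L2_scale b simp: l2_inner_scale_right)
    then have "l2_inner h g = l2_inner h (\<lambda>x. g x - (\<Sum>i\<in>A. a i * b i x))"
      using l2_inner_diff_right[OF closed_span_L2[OF g] S h(1)] by simp
    also have "cmod \<dots> \<le> l2_norm h * l2_norm (\<lambda>x. g x - (\<Sum>i\<in>A. a i * b i x))"
      by (intro cmod_l2_inner_le h L2_diff closed_span_L2[OF g] S)
    also have "\<dots> \<le> (l2_norm h + 1) * (e / (l2_norm h + 1))"
      using A by (intro mult_mono) auto
    also have "\<dots> = e"
      using add_nonneg_pos[of "l2_norm h" 1] by simp
    finally show "cmod (l2_inner h g) \<le> 0 + e"
      by simp
  qed
  then show ?thesis
    by simp
qed

text \<open>Bessel's identity. A vector lies in the closed span as soon as finite sums of its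
  squared coefficients approach its squared norm.\<close>

lemma orthonormal_projection_error:
  assumes v: "\<And>i. v i \<in> L2" and orth: "\<And>i j. l2_inner (v i) (v j) = (if i = j then 1 else 0)"
    and f: "f \<in> L2" and A: "finite A"
  shows "(l2_norm (\<lambda>x. f x - (\<Sum>i\<in>A. l2_inner f (v i) * v i x)))\<^sup>2
    = (l2_norm f)\<^sup>2 - (\<Sum>i\<in>A. (cmod (l2_inner f (v i)))\<^sup>2)"
proof -
  define P where "P x = (\<Sum>i\<in>A. l2_inner f (v i) * v i x)" for x
  define s where "s = (\<Sum>i\<in>A. (cmod (l2_inner f (v i)))\<^sup>2)"
  have P: "P \<in> L2"
    unfolding P_def[abs_def] by (intro L2_sum L2_scale v)
  have norm_v: "(l2_norm (v i))\<^sup>2 = 1" for i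
    using l2_inner_self[of "v i"] orth[of i i] by (metis of_real_1 of_real_eq_iff)
  have normP: "(l2_norm P)\<^sup>2 = s"
    unfolding P_def s_def
    by (subst l2_norm_orthogonal_sum)
      (auto intro: L2_scale v A simp: l2_inner_scale_left l2_inner_scale_right orth l2_norm_scale power_mult_distrib norm_v)
  have "l2_inner f P = (\<Sum>i\<in>A. cnj (l2_inner f (v i)) * l2_inner f (v i))"
    unfolding P_def by (subst l2_inner_sum_right) (auto intro: L2_scale v f simp: l2_inner_scale_right)
  also have "\<dots> = of_real s"
    unfolding s_def of_real_sum complex_norm_square by (simp add: mult.commute)
  finally have fP: "l2_inner f P = of_real s" .
  have "(l2_norm (\<lambda>x. f x + (- 1) * P x))\<^sup>2
      = (l2_norm f)\<^sup>2 + (l2_norm (\<lambda>x. (- 1) * P x))\<^sup>2 + 2 * Re (l2_inner f (\<lambda>x. (- 1) * P x))"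
    by (intro l2_norm_add_power2 f L2_scale P)
  also have "\<dots> = (l2_norm f)\<^sup>2 - s"
    unfolding l2_norm_scale l2_inner_scale_right fP by (simp add: normP)
  finally show ?thesis
    by (simp add: P_def s_def)
qed

section \<open>Wavelets from an orthonormal refinable function\<close>

text \<open>The interface to the Fourier part: the tile enters the wavelet construction only through
  these properties.\<close>

locale orthonormal_refinable =
  fixes M :: "int^'d^'d" and \<phi> :: "real^'d \<Rightarrow> complex" and c :: "int^'d \<Rightarrow> complex"
  assumes det_M: "\<bar>det M\<bar> = 2"
    and phi_L2: "\<phi> \<in> L2"
    and orthonormal: "\<And>j k. l2_inner (shifts \<phi> j) (shifts \<phi> k) = (if j = k then 1 else 0)"
    and phi_real: "AE x in lborel. cnj (\<phi> x) = \<phi> x"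
    and refinable: "refinement_coeffs M \<phi> c"
begin

text \<open>Left without the factor sqrt 2 so that the coefficients match those of the refinement
  equation; the system is orthogonal with squared norm 1/2.\<close>

definition b :: "int^'d \<Rightarrow> real^'d \<Rightarrow> complex" where
  "b k x = \<phi> (rmat M *v x - rvec k)"

lemma det_rmat_nz: "det (rmat M) \<noteq> 0" and abs_det_rmat: "\<bar>det (rmat M)\<bar> = 2"
  using det_M by (auto simp: det_rmat)

lemma L2_dilate: "f \<in> L2 \<Longrightarrow> (\<lambda>x. f (rmat M *v x)) \<in> L2"
  using integrable_matrix_iff[OF det_rmat_nz, of "\<lambda>x. (cmod (f x))\<^sup>2"] by (auto simp: L2_iff)

lemma l2_inner_dilate:
  assumes "f \<in> L2" "g \<in> L2"
  shows "l2_inner (\<lambda>x. f (rmat M *v x)) (\<lambda>x. g (rmat M *v x)) = l2_inner f g / 2"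
  unfolding l2_inner_def
  using integral_matrix[OF det_rmat_nz, of "\<lambda>x. f x * cnj (g x)"] assms abs_det_rmat
  by (simp add: L2_iff scaleR_conv_of_real)

lemma l2_norm_dilate:
  assumes "f \<in> L2"
  shows "l2_norm (\<lambda>x. f (rmat M *v x)) = l2_norm f / sqrt 2"
  unfolding l2_norm_def
  using integral_matrix[OF det_rmat_nz, of "\<lambda>x. (cmod (f x))\<^sup>2"] assms abs_det_rmat
  by (simp add: L2_iff real_sqrt_divide[symmetric])

lemma shifts_L2: "f \<in> L2 \<Longrightarrow> shifts f k \<in> L2"
  unfolding shifts_def[abs_def] using L2_translate[of f "- rvec k"] by simp

lemma b_eq_dilate: "b k = (\<lambda>x. shifts \<phi> k (rmat M *v x))"
  by (simp add: b_def shifts_def fun_eq_iff)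

lemma b_L2: "b k \<in> L2"
  unfolding b_eq_dilate by (intro L2_dilate shifts_L2 phi_L2)

lemma b_inner: "l2_inner (b j) (b k) = (if j = k then 1 / 2 else 0)"
  unfolding b_eq_dilate by (subst l2_inner_dilate) (auto simp: shifts_L2 phi_L2 orthonormal)

text \<open>Dilation scales all norms by 1 / sqrt 2, so approximations in \<open>V0\<close> and in
  the span of \<open>b\<close> correspond. Conversely, composing with the inverse matrix recovers
  the function in \<open>V0\<close>.\<close>

lemma V1_eq: "V1 M \<phi> = closed_span b"
proof -
  let ?A = "matrix_inv (rmat M)"
  have inv: "rmat M *v (?A *v x) = x" "?A *v (rmat M *v x) = x" for x
    using matrix_inv_mult[of "rmat M"] det_rmat_nz
    by (simp_all add: matrix_vector_mul_assoc invertible_det_nz)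
  have dist: "l2_norm (\<lambda>x. f (rmat M *v x) - (\<Sum>i\<in>A. a i * b i x)) = l2_norm (\<lambda>x. f x - (\<Sum>i\<in>A. a i * shifts \<phi> i x)) / sqrt 2"
    if "f \<in> L2" for f A a
    using l2_norm_dilate[of "\<lambda>x. f x - (\<Sum>i\<in>A. a i * shifts \<phi> i x)"] that
    by (simp add: b_eq_dilate L2_diff L2_sum L2_scale shifts_L2 phi_L2)
  have *: "(\<lambda>x. f (rmat M *v x)) \<in> closed_span b \<longleftrightarrow> f \<in> closed_span (shifts \<phi>)" if f: "f \<in> L2" for f
  proof
    assume L: "(\<lambda>x. f (rmat M *v x)) \<in> closed_span b"
    show "f \<in> closed_span (shifts \<phi>)"
      unfolding closed_span_def
    proof (intro CollectI conjI allI impI f)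
      fix \<epsilon> :: real assume "\<epsilon> > 0"
      then have "\<epsilon> / sqrt 2 > 0"
        by simp
      then obtain A a where "finite A" "l2_norm (\<lambda>x. f (rmat M *v x) - (\<Sum>i\<in>A. a i * b i x)) < \<epsilon> / sqrt 2"
        by (rule closed_spanD[OF L])
      then show "\<exists>A a. finite A \<and> l2_norm (\<lambda>x. f x - (\<Sum>i\<in>A. a i * shifts \<phi> i x)) < \<epsilon>"
        unfolding dist[OF f] by (intro exI[of _ A] exI[of _ a]) (simp add: divide_less_cancel)
    qed
  next
    assume L: "f \<in> closed_span (shifts \<phi>)"
    show "(\<lambda>x. f (rmat M *v x)) \<in> closed_span b"
      unfolding closed_span_def
    proof (intro CollectI conjI allI impI L2_dilate f)
      fix \<epsilon> :: real assume "\<epsilon> > 0"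
      then have "\<epsilon> * sqrt 2 > 0"
        by simp
      then obtain A a where "finite A" "l2_norm (\<lambda>x. f x - (\<Sum>i\<in>A. a i * shifts \<phi> i x)) < \<epsilon> * sqrt 2"
        by (rule closed_spanD[OF L])
      then show "\<exists>A a. finite A \<and> l2_norm (\<lambda>x. f (rmat M *v x) - (\<Sum>i\<in>A. a i * b i x)) < \<epsilon>"
        unfolding dist[OF f] by (intro exI[of _ A] exI[of _ a]) (simp add: divide_less_eq)
    qed
  qed
  show ?thesis
  proof (intro equalityI subsetI)
    fix h assume "h \<in> V1 M \<phi>"
    then obtain f where f: "f \<in> closed_span (shifts \<phi>)" and h: "h = (\<lambda>x. f (rmat M *v x))"
      by (auto simp: V1_def V0_def)
    show "h \<in> closed_span b"
      using *[OF closed_span_L2[OF f]] f by (simp add: h)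
  next
    fix h assume h: "h \<in> closed_span b"
    define f where "f x = h (?A *v x)" for x
    have hf: "(\<lambda>x. f (rmat M *v x)) = h"
      by (simp add: f_def inv)
    have "h \<in> L2"
      by (rule closed_span_L2[OF h])
    then have [measurable]: "h \<in> borel_measurable borel"
      by (auto simp: L2_iff)
    have fm [measurable]: "f \<in> borel_measurable borel"
      unfolding f_def[abs_def] by measurable
    have "f \<in> L2"
      using integrable_matrix_iff[OF det_rmat_nz, of "\<lambda>x. (cmod (f x))\<^sup>2"] \<open>h \<in> L2\<close>
      by (auto simp: L2_iff f_def inv)
    then have "f \<in> V0 \<phi>"
      using *[of f] h by (simp add: hf V0_def)
    then show "h \<in> V1 M \<phi>"
      unfolding V1_def using hf by blast
  qed
qed

definition rep :: "(real^'d \<Rightarrow> complex) \<Rightarrow> (int^'d \<Rightarrow> complex) \<Rightarrow> bool" where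
  "rep f a \<longleftrightarrow> has_l2_sum (\<lambda>k x. a k * b k x) f"

lemma rep_L2: "rep f a \<Longrightarrow> f \<in> L2"
  unfolding rep_def by (rule has_l2_sum_L2)

lemma rep_in_closed_span: "rep f a \<Longrightarrow> f \<in> closed_span b"
  unfolding rep_def
  by (rule has_l2_sum_in_closed_span[OF b_L2]) (auto intro: closed_span_scale mem_closed_span b_L2)

lemma rep_phi: "rep \<phi> c"
  using refinable by (simp add: rep_def refinement_coeffs_def b_def)

lemma rep_inner_b:
  assumes "rep f a"
  shows "l2_inner f (b j) = a j / 2"
proof -
  have "((\<lambda>k. l2_inner (\<lambda>x. a k * b k x) (b j)) has_sum l2_inner f (b j)) UNIV"
    by (rule has_l2_sum_inner[OF assms[unfolded rep_def] b_L2])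
  moreover have "((\<lambda>k. l2_inner (\<lambda>x. a k * b k x) (b j)) has_sum (a j / 2)) UNIV"
    by (rule has_sum_finite_neutralI[of "{j}"]) (auto simp: l2_inner_scale_left b_inner)
  ultimately show ?thesis
    by (rule has_sum_unique)
qed

lemma rep_inner:
  assumes f: "rep f a" and g: "rep g a'"
  shows "((\<lambda>k. a k * cnj (a' k) / 2) has_sum l2_inner f g) UNIV"
proof -
  have eq: "l2_inner (b k) g = cnj (a' k) / 2" for k
    by (subst l2_inner_commute) (simp add: rep_inner_b[OF g])
  show ?thesis
    using has_l2_sum_inner[OF f[unfolded rep_def] rep_L2[OF g]]
    unfolding l2_inner_scale_left eq by simp
qed

lemma bij_shift: "bij (\<lambda>k::int^'d. k - v)"
  by (rule bij_betw_byWitness[where f'="\<lambda>k. k + v"]) auto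

lemma bij_reflect: "bij (\<lambda>k::int^'d. v - k)"
  by (rule bij_betw_byWitness[where f'="\<lambda>k. v - k"]) auto

text \<open>Translation by \<open>l\<close> sends \<open>b k\<close> to
  \<open>b (k + M *v l)\<close>; the series is then reindexed.\<close>

lemma rep_shifts:
  assumes "rep f a"
  shows "rep (shifts f l) (\<lambda>k. a (k - M *v l))"
proof -
  have "l2_tendsto (\<lambda>A x. \<Sum>k\<in>A. a k * b k (x + - rvec l)) (\<lambda>x. f (x + - rvec l)) (finite_subsets_at_top UNIV)"
    using l2_tendsto_translate[OF assms[unfolded rep_def has_l2_sum_def]] .
  moreover have "b k (x + - rvec l) = b (k + M *v l) x" for k x
    by (simp add: b_def rvec_add matrix_vector_mult_diff_distrib rmat_mult_rvec algebra_simps)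
  ultimately have "has_l2_sum (\<lambda>k x. a k * b (k + M *v l) x) (shifts f l)"
    by (simp add: has_l2_sum_def shifts_def[abs_def])
  from has_l2_sum_reindex[OF this bij_shift[of "M *v l"]] show ?thesis
    by (simp add: rep_def)
qed

text \<open>\<open>c k\<close> is twice the inner product of \<phi> and \<open>b k\<close>, both
  real almost everywhere. The null set is carried through translation and dilation by means of
  \<open>l2_norm\<close>.\<close>

lemma c_real: "cnj (c k) = c k"
proof -
  have b_real: "AE x in lborel. cnj (b k x) = b k x"
  proof -
    have "l2_norm (\<lambda>x. cnj (shifts \<phi> k x) - shifts \<phi> k x) = l2_norm (\<lambda>x. cnj (\<phi> x) - \<phi> x)"
      using l2_norm_translate[of "\<lambda>x. cnj (\<phi> x) - \<phi> x" "- rvec k"]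
      by (simp add: shifts_def L2_diff L2_cnj phi_L2)
    also have "\<dots> = l2_norm (\<lambda>x::real^'d. 0)"
      using phi_real phi_L2 L2_cnj[OF phi_L2] by (intro l2_norm_cong_AE) (auto simp: L2_iff)
    finally have "l2_norm (\<lambda>x. cnj (b k x) - b k x) = 0"
      using l2_norm_dilate[of "\<lambda>x. cnj (shifts \<phi> k x) - shifts \<phi> k x"]
      by (simp add: b_eq_dilate L2_diff L2_cnj shifts_L2 phi_L2)
    then have "AE x in lborel. cnj (b k x) - b k x = 0"
      by (intro l2_norm_eq_0_AE L2_diff L2_cnj b_L2)
    then show ?thesis
      by simp
  qed
  have "cnj (l2_inner \<phi> (b k)) = l2_inner (\<lambda>x. cnj (\<phi> x)) (\<lambda>x. cnj (b k x))"
    by (simp add: l2_inner_def flip: Bochner_Integration.integral_cnj)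
  also have "\<dots> = l2_inner \<phi> (b k)"
    using phi_real b_real L2_cnj[OF phi_L2] L2_cnj[OF b_L2] phi_L2 b_L2
    by (intro l2_inner_cong_AE) (auto simp: L2_iff)
  finally show ?thesis
    by (simp add: rep_inner_b[OF rep_phi])
qed

text \<open>Orthonormality of the shifts of \<phi> in terms of coefficients, without conjugates
  because they are real. The case \<open>j = l\<close> is also the source of square
  summability.\<close>

lemma c_autocorrelation:
  "((\<lambda>k. c (k - M *v j) * c (k - M *v l) / 2) has_sum (if j = l then 1 else 0)) UNIV"
  using rep_inner[OF rep_shifts[OF rep_phi, of j] rep_shifts[OF rep_phi, of l]]
  by (simp add: c_real orthonormal)

end

locale alternating_flip = orthonormal_refinable M \<phi> c
  for M :: "int^'d^'d" and \<phi> c +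
  fixes \<sigma> :: "int^'d \<Rightarrow> complex" and w0 :: "int^'d"
  assumes sigma: "\<And>k. \<sigma> k \<in> {1, -1}"
    and sigma_add: "\<And>j k. \<sigma> (j + k) = \<sigma> j * \<sigma> k"
    and sigma_kernel: "\<And>k. \<sigma> k = 1 \<longleftrightarrow> k \<in> range ((*v) M)"
    and sigma_w0: "\<sigma> w0 = -1"
begin

lemma sigma_lattice [simp]: "\<sigma> (M *v l) = 1"
  by (simp add: sigma_kernel)

lemma sigma_square [simp]: "\<sigma> k * \<sigma> k = 1"
  using sigma[of k] by auto

lemma sigma_minus [simp]: "\<sigma> (- k) = \<sigma> k"
proof -
  have "\<sigma> (- k) * \<sigma> k = 1"
    using sigma_add[of "- k" k] sigma_lattice[of 0] by simp
  then show ?thesis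
    using sigma[of k] sigma[of "- k"] by auto
qed

lemma sigma_diff: "\<sigma> (j - k) = \<sigma> j * \<sigma> k"
  using sigma_add[of j "- k"] by simp

lemma cnj_sigma [simp]: "cnj (\<sigma> k) = \<sigma> k"
  using sigma[of k] by auto

lemma sigma_w0_diff: "\<sigma> (w0 - k) = - \<sigma> k"
  by (simp add: sigma_diff sigma_w0)

text \<open>The coefficients of \<psi> along \<open>b\<close>, after the substitution
  \<open>j = w0 - k\<close>.\<close>

definition a :: "int^'d \<Rightarrow> complex" where
  "a j = \<sigma> (w0 - j) * c (w0 - j)"

lemma a_real: "cnj (a j) = a j"
  by (simp add: a_def c_real)

text \<open>The terms are orthogonal with squared norms \<open>c k * c k / 2\<close>, whose sum
  \<open>c_autocorrelation\<close> evaluates.\<close>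

lemma wavelet_exists: "\<exists>\<psi>. has_l2_sum (\<lambda>k x. \<sigma> k * c k * b (w0 - k) x) \<psi>"
proof (rule orthogonal_series_converges)
  show "(\<lambda>x. \<sigma> k * c k * b (w0 - k) x) \<in> L2" for k
    by (intro L2_scale b_L2)
  show "l2_inner (\<lambda>x. \<sigma> j * c j * b (w0 - j) x) (\<lambda>x. \<sigma> k * c k * b (w0 - k) x) = 0" if "j \<noteq> k" for j k
    using that by (simp add: l2_inner_scale_left l2_inner_scale_right b_inner)
  have "(l2_norm (\<lambda>x. \<sigma> k * c k * b (w0 - k) x))\<^sup>2 = Re (c k * c k / 2)" for k
  proof -
    have "complex_of_real ((l2_norm (\<lambda>x. \<sigma> k * c k * b (w0 - k) x))\<^sup>2)
        = l2_inner (\<lambda>x. (\<sigma> k * c k) * b (w0 - k) x) (\<lambda>x. (\<sigma> k * c k) * b (w0 - k) x)"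
      by (rule l2_inner_self[symmetric])
    also have "\<dots> = (\<sigma> k * \<sigma> k) * (c k * c k) / 2"
      unfolding l2_inner_scale_left l2_inner_scale_right by (simp add: b_inner c_real)
    finally show ?thesis
      by (metis Re_complex_of_real sigma_square mult_1)
  qed
  moreover have "(\<lambda>k. Re (c k * c k / 2)) summable_on UNIV"
    using c_autocorrelation[of 0 0] has_sum_Re has_sum_imp_summable by fastforce
  ultimately show "(\<lambda>k. (l2_norm (\<lambda>x. \<sigma> k * c k * b (w0 - k) x))\<^sup>2) summable_on UNIV"
    by (simp only:)
qed

context
  fixes \<psi>
  assumes psi: "has_l2_sum (\<lambda>k x. \<sigma> k * c k * b (w0 - k) x) \<psi>"
begin

lemma rep_psi: "rep \<psi> a"
  using has_l2_sum_reindex[OF psi bij_reflect[of w0]] by (simp add: rep_def a_def)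

lemma psi_L2: "\<psi> \<in> L2"
  by (rule rep_L2[OF rep_psi])

lemma psi_phi_orthogonal: "l2_inner (shifts \<psi> k) (shifts \<phi> l) = 0"
proof -
  define T where "T j = a (j - M *v k) * c (j - M *v l) / 2" for j
  have T: "(T has_sum l2_inner (shifts \<psi> k) (shifts \<phi> l)) UNIV"
    using rep_inner[OF rep_shifts[OF rep_psi, of k] rep_shifts[OF rep_phi, of l]]
    by (simp add: T_def[abs_def] c_real)
  \<comment> \<open>This reflection exchanges the two arguments at which \<open>c\<close> is
    evaluated, once \<open>a\<close> is unfolded. The sign changes from
    \<open>\<sigma> (w0 - j)\<close> to \<open>\<sigma> j\<close>, up to lattice terms, which
    \<sigma> ignores.\<close>
  have flip: "T (w0 + M *v k + M *v l - j) = - T j" for j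
  proof -
    have e: "w0 + M *v k + M *v l - j - M *v k = w0 - (j - M *v l)"
      "w0 + M *v k + M *v l - j - M *v l = w0 - (j - M *v k)"
      by (simp_all add: algebra_simps)
    show ?thesis
      unfolding T_def e a_def by (simp add: sigma_diff sigma_w0)
  qed
  have "((\<lambda>j. T (w0 + M *v k + M *v l - j)) has_sum l2_inner (shifts \<psi> k) (shifts \<phi> l)) UNIV"
    using T by (subst has_sum_reindex_bij_betw[OF bij_reflect])
  then have "(T has_sum - l2_inner (shifts \<psi> k) (shifts \<phi> l)) UNIV"
    by (simp add: flip has_sum_uminus)
  with T have "l2_inner (shifts \<psi> k) (shifts \<phi> l) = - l2_inner (shifts \<psi> k) (shifts \<phi> l)"
    by (rule has_sum_unique)
  then show ?thesis
    by simp
qed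

text \<open>The two signs in each product agree, since their arguments differ by an element of the
  image of \<open>M\<close>. The sum is therefore the autocorrelation of \<open>c\<close>, reflected
  at \<open>w0\<close>, at shifts \<open>- k\<close> and \<open>- l\<close>.\<close>

lemma psi_orthonormal: "l2_inner (shifts \<psi> k) (shifts \<psi> l) = (if k = l then 1 else 0)"
proof -
  have T: "((\<lambda>j. a (j - M *v k) * a (j - M *v l) / 2) has_sum l2_inner (shifts \<psi> k) (shifts \<psi> l)) UNIV"
    using rep_inner[OF rep_shifts[OF rep_psi, of k] rep_shifts[OF rep_psi, of l]] by (simp add: a_real)
  have "((\<lambda>j. c (w0 - j - M *v (- k)) * c (w0 - j - M *v (- l)) / 2) has_sum (if - k = - l then 1 else 0)) UNIV"
    using c_autocorrelation[of "- k" "- l"] by (subst has_sum_reindex_bij_betw[OF bij_reflect])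
  moreover have "c (w0 - j - M *v (- k)) * c (w0 - j - M *v (- l)) / 2 = a (j - M *v k) * a (j - M *v l) / 2" for j
  proof -
    have e: "w0 - j - M *v (- k) = w0 - (j - M *v k)" "w0 - j - M *v (- l) = w0 - (j - M *v l)"
      using matrix_vector_mult_diff_distrib[of M 0 k] matrix_vector_mult_diff_distrib[of M 0 l] by simp_all
    have "a (j - M *v k) * a (j - M *v l)
        = (\<sigma> j * \<sigma> j) * (c (w0 - (j - M *v k)) * c (w0 - (j - M *v l)))"
      unfolding a_def by (simp only: sigma_w0_diff) (simp add: sigma_diff mult_ac)
    then show ?thesis
      unfolding e by simp
  qed
  ultimately have "((\<lambda>j. a (j - M *v k) * a (j - M *v l) / 2) has_sum (if - k = - l then 1 else 0)) UNIV"
    by simp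
  with T show ?thesis
    using has_sum_unique by fastforce
qed

section \<open>Completeness of the shifts of \<phi> and \<psi> in \<open>V1\<close>\<close>

definition joint :: "int^'d + int^'d \<Rightarrow> real^'d \<Rightarrow> complex" where
  "joint = case_sum (shifts \<phi>) (shifts \<psi>)"

lemma joint_L2: "joint i \<in> L2"
  by (cases i) (auto simp: joint_def shifts_L2 phi_L2 psi_L2)

lemma joint_orthonormal: "l2_inner (joint i) (joint j) = (if i = j then 1 else 0)"
proof -
  have "l2_inner (shifts \<phi> k) (shifts \<psi> l) = 0" for k l
    by (subst l2_inner_commute) (simp add: psi_phi_orthogonal)
  then show ?thesis
    by (cases i; cases j) (auto simp: joint_def orthonormal psi_orthonormal psi_phi_orthogonal)
qed

lemma inj_M: "M *v k = M *v l \<longleftrightarrow> k = l"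
proof
  assume "M *v k = M *v l"
  then have "rmat M *v rvec k = rmat M *v rvec l"
    by (simp add: rmat_mult_rvec)
  then have "matrix_inv (rmat M) *v (rmat M *v rvec k) = matrix_inv (rmat M) *v (rmat M *v rvec l)"
    by simp
  then show "k = l"
    using matrix_inv_mult[of "rmat M"] det_rmat_nz by (simp add: matrix_vector_mul_assoc invertible_det_nz)
qed simp

lemma bij_coset: "bij_betw (\<lambda>l. j - M *v l) UNIV {k. \<sigma> k = \<sigma> j}"
  unfolding bij_betw_def
proof (intro conjI equalityI subsetI)
  show "inj (\<lambda>l. j - M *v l)"
    by (auto simp: inj_def inj_M)
next
  fix k assume "k \<in> range (\<lambda>l. j - M *v l)"
  then show "k \<in> {k. \<sigma> k = \<sigma> j}"
    by (auto simp: sigma_diff)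
next
  fix k assume "k \<in> {k. \<sigma> k = \<sigma> j}"
  then have "\<sigma> (j - k) = 1"
    by (simp add: sigma_diff)
  then obtain l where "j - k = M *v l"
    using sigma_kernel by auto
  then have "k = j - M *v l"
    by (simp add: algebra_simps)
  then show "k \<in> range (\<lambda>l. j - M *v l)"
    by blast
qed

lemma bij_other_coset: "bij_betw (\<lambda>l. w0 - (j - M *v l)) UNIV {k. \<sigma> k = - \<sigma> j}"
proof -
  have "bij_betw (\<lambda>k. w0 - k) {k. \<sigma> k = \<sigma> j} {k. \<sigma> k = - \<sigma> j}"
    by (rule bij_betw_byWitness[where f'="\<lambda>k. w0 - k"]) (auto simp: sigma_w0_diff)
  from bij_betw_trans[OF bij_coset this] show ?thesis
    by (simp add: comp_def)
qed

text \<open>Parseval: the coefficients of \<open>b j\<close> along the shifts of \<open>\<phi>\<close> run through \<open>c / 2\<close> on the coset of \<open>j\<close>,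
  those along the shifts of \<open>\<psi>\<close> through \<open>\<plusminus> c / 2\<close> on the other coset, so together they exhaust
  the squared norm \<open>1 / 2\<close> of \<open>b j\<close>.\<close>

lemma b_in_joint_span: "b j \<in> closed_span joint"
proof -
  define p where "p k = (cmod (c k))\<^sup>2 / 4" for k
  have p_total: "(p has_sum 1 / 2) UNIV"
  proof -
    have "((\<lambda>k. Re (c k * c k / 2)) has_sum Re 1) UNIV"
      using has_sum_Re[OF c_autocorrelation[of 0 0]] by simp
    then have "((\<lambda>k. Re (c k * c k / 2) * (1 / 2)) has_sum 1 * (1 / 2)) UNIV"
      by (intro has_sum_cmult_left) simp
    moreover have "Re (c k * c k / 2) * (1 / 2) = p k" for k
    proof -
      have "c k * c k = of_real ((cmod (c k))\<^sup>2)"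
        unfolding complex_norm_square by (simp add: c_real)
      then show ?thesis
        by (simp add: p_def)
    qed
    ultimately show ?thesis
      by simp
  qed
  define N where "N = {k. \<sigma> k = \<sigma> j}"
  define N' where "N' = {k. \<sigma> k = - \<sigma> j}"
  have "\<sigma> k = \<sigma> j \<or> \<sigma> k = - \<sigma> j" "\<sigma> j \<noteq> - \<sigma> j" for k
    using sigma[of k] sigma[of j] by auto
  then have "N \<union> N' = UNIV" "N \<inter> N' = {}"
    by (auto simp: N_def N'_def)
  have summ: "p summable_on X" for X
    using p_total has_sum_imp_summable summable_on_subset_banach by blast
  define S where "S = infsum p N"
  define S' where "S' = infsum p N'"
  have S_sum: "S + S' = 1 / 2"
    using infsum_Un_disjoint[OF summ summ \<open>N \<inter> N' = {}\<close>] infsumI[OF p_total]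
    by (simp add: S_def S'_def \<open>N \<union> N' = UNIV\<close>)
  have S: "((\<lambda>l. p (j - M *v l)) has_sum S) UNIV"
    unfolding S_def N_def by (subst has_sum_reindex_bij_betw[OF bij_coset]) (rule has_sum_infsum[OF summ])
  have S': "((\<lambda>l. p (w0 - (j - M *v l))) has_sum S') UNIV"
    unfolding S'_def N'_def by (subst has_sum_reindex_bij_betw[OF bij_other_coset]) (rule has_sum_infsum[OF summ])
  have coeff: "(cmod (l2_inner (b j) (joint (Inl l))))\<^sup>2 = p (j - M *v l)"
    "(cmod (l2_inner (b j) (joint (Inr l))))\<^sup>2 = p (w0 - (j - M *v l))" for l
  proof -
    have Inl: "l2_inner (b j) (joint (Inl l)) = cnj (c (j - M *v l) / 2)"
      unfolding joint_def by (subst l2_inner_commute) (simp add: rep_inner_b[OF rep_shifts[OF rep_phi]])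
    show "(cmod (l2_inner (b j) (joint (Inl l))))\<^sup>2 = p (j - M *v l)"
      unfolding Inl by (simp add: p_def norm_divide power_divide)
    have Inr: "l2_inner (b j) (joint (Inr l)) = cnj (a (j - M *v l) / 2)"
      unfolding joint_def by (subst l2_inner_commute) (simp add: rep_inner_b[OF rep_shifts[OF rep_psi]])
    have "cmod (\<sigma> k) = 1" for k
      using sigma[of k] by auto
    then show "(cmod (l2_inner (b j) (joint (Inr l))))\<^sup>2 = p (w0 - (j - M *v l))"
      unfolding Inr by (simp add: p_def a_def norm_divide norm_mult power_divide)
  qed
  have norm_b: "(l2_norm (b j))\<^sup>2 = 1 / 2"
  proof -
    have "complex_of_real ((l2_norm (b j))\<^sup>2) = complex_of_real (1 / 2)"
      unfolding l2_inner_self[symmetric] by (simp add: b_inner)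
    then show ?thesis
      by (rule of_real_eq_iff[THEN iffD1])
  qed
  show ?thesis
    unfolding closed_span_def
  proof (intro CollectI conjI allI impI b_L2)
    fix \<epsilon> :: real assume "\<epsilon> > 0"
    \<comment> \<open>Each of the two cosets may lose half of the permitted squared error.\<close>
    then have "S - \<epsilon>\<^sup>2 / 2 < S" "S' - \<epsilon>\<^sup>2 / 2 < S'"
      by simp_all
    then have "\<forall>\<^sub>F A in finite_subsets_at_top UNIV. S - \<epsilon>\<^sup>2 / 2 < (\<Sum>l\<in>A. p (j - M *v l))"
      "\<forall>\<^sub>F A in finite_subsets_at_top UNIV. S' - \<epsilon>\<^sup>2 / 2 < (\<Sum>l\<in>A. p (w0 - (j - M *v l)))"
      using S S' unfolding has_sum_def by (auto intro: order_tendstoD(1))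
    then obtain A B where A: "finite A" "S - \<epsilon>\<^sup>2 / 2 < (\<Sum>l\<in>A. p (j - M *v l))"
      and B: "finite B" "S' - \<epsilon>\<^sup>2 / 2 < (\<Sum>l\<in>B. p (w0 - (j - M *v l)))"
      by (auto simp: eventually_finite_subsets_at_top)
    have fin: "finite (A <+> B)"
      using A B by auto
    have "(\<Sum>i\<in>A <+> B. (cmod (l2_inner (b j) (joint i)))\<^sup>2)
        = (\<Sum>l\<in>A. p (j - M *v l)) + (\<Sum>l\<in>B. p (w0 - (j - M *v l)))"
      using A B by (simp add: sum.Plus coeff)
    then have "(l2_norm (\<lambda>x. b j x - (\<Sum>i\<in>A <+> B. l2_inner (b j) (joint i) * joint i x)))\<^sup>2
        = 1 / 2 - ((\<Sum>l\<in>A. p (j - M *v l)) + (\<Sum>l\<in>B. p (w0 - (j - M *v l))))"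
      using orthonormal_projection_error[OF joint_L2 joint_orthonormal b_L2 fin] norm_b by simp
    also have "\<dots> < \<epsilon>\<^sup>2"
      using A B S_sum by simp
    finally have "l2_norm (\<lambda>x. b j x - (\<Sum>i\<in>A <+> B. l2_inner (b j) (joint i) * joint i x)) < \<epsilon>"
      by (rule power2_less_imp_less) (use \<open>\<epsilon> > 0\<close> in simp)
    then show "\<exists>A a. finite A \<and> l2_norm (\<lambda>x. b j x - (\<Sum>i\<in>A. a i * joint i x)) < \<epsilon>"
      using fin by (intro exI[of _ "A <+> B"] exI[of _ "\<lambda>i. l2_inner (b j) (joint i)"] conjI)
  qed
qed

text \<open>For the inclusion of \<open>W\<close> in the span, approximate \<open>f\<close> by
  \<open>P x + R x\<close> with \<open>P\<close> from the shifts of \<phi> and \<open>R\<close> from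
  those of \<psi>. \<open>P\<close> is orthogonal to both \<open>f\<close> and \<open>R\<close>, so
  by Pythagoras dropping it cannot increase the error.\<close>

lemma wavelet: "is_wavelet M \<phi> \<psi>"
proof -
  define W where "W = {f \<in> V1 M \<phi>. \<forall>g\<in>V0 \<phi>. l2_inner f g = 0}"
  have sL: "shifts \<phi> k \<in> L2" "shifts \<psi> k \<in> L2" for k
    by (auto intro: shifts_L2 phi_L2 psi_L2)
  have shifts_V1: "shifts \<psi> k \<in> closed_span b" for k
    by (rule rep_in_closed_span[OF rep_shifts[OF rep_psi]])
  have shifts_V0: "l2_inner (shifts \<psi> k) g = 0" if "g \<in> V0 \<phi>" for k g
    using that unfolding V0_def
    by (intro orthogonal_closed_span[OF sL(1) sL(2) psi_phi_orthogonal])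
  have shifts_W: "shifts \<psi> k \<in> W" for k
    using shifts_V1 shifts_V0 by (auto simp: W_def V1_eq)
  have "closed_span (shifts \<psi>) = W"
  proof (intro equalityI subsetI)
    fix f assume f: "f \<in> closed_span (shifts \<psi>)"
    have "closed_span (shifts \<psi>) \<subseteq> closed_span b"
      by (intro closed_span_mono sL b_L2 shifts_V1)
    moreover have "l2_inner f g = 0" if g: "g \<in> V0 \<phi>" for g
    proof -
      have gL: "g \<in> L2"
        using g closed_span_L2 by (auto simp: V0_def)
      have "l2_inner g (shifts \<psi> k) = 0" for k
        by (subst l2_inner_commute) (simp add: shifts_V0[OF g])
      then have "l2_inner g f = 0"
        by (intro orthogonal_closed_span[OF sL(2) gL _ f])
      then show ?thesis
        by (subst l2_inner_commute) simp
    qed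
    ultimately show "f \<in> W"
      using f by (auto simp: W_def V1_eq)
  next
    fix f assume "f \<in> W"
    then have f: "f \<in> closed_span b" and fV0: "\<And>g. g \<in> V0 \<phi> \<Longrightarrow> l2_inner f g = 0"
      by (auto simp: W_def V1_eq)
    have fL: "f \<in> L2"
      by (rule closed_span_L2[OF f])
    have f_joint: "f \<in> closed_span joint"
      using closed_span_mono[of b joint, OF b_L2 joint_L2 b_in_joint_span] f by blast
    show "f \<in> closed_span (shifts \<psi>)"
      unfolding closed_span_def
    proof (intro CollectI conjI allI impI fL)
      fix \<epsilon> :: real assume "\<epsilon> > 0"
      with f_joint obtain F d where F: "finite F" "l2_norm (\<lambda>x. f x - (\<Sum>i\<in>F. d i * joint i x)) < \<epsilon>"
        by (rule closed_spanD)
      define A where "A = Inl -` F"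
      define B where "B = Inr -` F"
      have AB: "finite A" "finite B" "F = A <+> B"
        using F(1) by (auto simp: A_def B_def finite_vimageI elim!: sumE) (metis InlI InrI sumE vimageI)
      define P where "P x = (\<Sum>l\<in>A. d (Inl l) * shifts \<phi> l x)" for x
      define R where "R x = (\<Sum>l\<in>B. d (Inr l) * shifts \<psi> l x)" for x
      have PL: "P \<in> L2" and RL: "R \<in> L2"
        unfolding P_def[abs_def] R_def[abs_def] by (intro L2_sum L2_scale sL)+
      have split: "(\<Sum>i\<in>F. d i * joint i x) = P x + R x" for x
        using AB(1,2) by (simp add: AB(3) sum.Plus joint_def P_def R_def)
      have PV0: "P \<in> V0 \<phi>"
        unfolding V0_def P_def[abs_def] by (intro sum_in_closed_span sL AB)
      have "l2_inner R P = (\<Sum>l\<in>B. l2_inner (\<lambda>x. d (Inr l) * shifts \<psi> l x) P)"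
        unfolding R_def by (intro l2_inner_sum_left L2_scale sL PL)
      also have "\<dots> = 0"
        by (simp add: l2_inner_scale_left shifts_V0[OF PV0])
      finally have orth: "l2_inner (\<lambda>x. f x - R x) P = 0"
        by (simp add: l2_inner_diff_left fL RL PL fV0[OF PV0])
      have "(l2_norm (\<lambda>x. (f x - R x) + (- 1) * P x))\<^sup>2
          = (l2_norm (\<lambda>x. f x - R x))\<^sup>2 + (l2_norm (\<lambda>x. (- 1) * P x))\<^sup>2
            + 2 * Re (l2_inner (\<lambda>x. f x - R x) (\<lambda>x. (- 1) * P x))"
        by (intro l2_norm_add_power2 L2_diff L2_scale fL RL PL)
      then have "(l2_norm (\<lambda>x. f x - R x))\<^sup>2 \<le> (l2_norm (\<lambda>x. (f x - R x) + (- 1) * P x))\<^sup>2"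
        unfolding l2_inner_scale_right orth by simp
      then have "l2_norm (\<lambda>x. f x - R x) \<le> l2_norm (\<lambda>x. (f x - R x) + (- 1) * P x)"
        by (rule power2_le_imp_le) simp
      also have "(\<lambda>x. (f x - R x) + (- 1) * P x) = (\<lambda>x. f x - (\<Sum>i\<in>F. d i * joint i x))"
        by (simp add: split algebra_simps)
      also have "l2_norm \<dots> < \<epsilon>"
        by (rule F(2))
      finally show "\<exists>A a. finite A \<and> l2_norm (\<lambda>x. f x - (\<Sum>i\<in>A. a i * shifts \<psi> i x)) < \<epsilon>"
        unfolding R_def using AB(2) by (intro exI[of _ B] exI[of _ "\<lambda>l. d (Inr l)"] conjI)
    qed
  qed
  then have "orthonormal_basis (shifts \<psi>) W"
    using shifts_W psi_orthonormal by (simp add: orthonormal_basis_def)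
  moreover have "\<psi> \<in> V1 M \<phi>"
    using rep_in_closed_span[OF rep_psi] by (simp add: V1_eq)
  ultimately show ?thesis
    by (simp add: is_wavelet_def W_def)
qed

end

end

section \<open>Wavelets for two-digit tile B-splines\<close>

lemma alternating_wavelet:
  fixes M :: "int^'d^'d" and \<sigma> :: "int^'d \<Rightarrow> complex"
  assumes tile: "two_digit_tile M D"
    and phi: "is_orthogonalization (tile_bspline (tile_set M D) n) \<phi>1"
    and c: "refinement_coeffs M \<phi>1 c"
    and sigma: "\<And>k. \<sigma> k \<in> {1, -1}" "\<And>j k. \<sigma> (j + k) = \<sigma> j * \<sigma> k"
      "\<And>k. \<sigma> k = 1 \<longleftrightarrow> k \<in> range ((*v) M)" "\<sigma> w0 = -1"
  shows "\<exists>\<psi>. has_l2_sum (\<lambda>k x. \<sigma> k * c k * \<phi>1 (rmat M *v x - rvec (w0 - k))) \<psi> \<and> is_wavelet M \<phi>1 \<psi>"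
proof -
  interpret two_digit M D
    by unfold_locales (rule tile)
  note phi' = phi[folded G_def]
  interpret alternating_flip M \<phi>1 c \<sigma> w0
  proof unfold_locales
    show "\<bar>det M\<bar> = 2"
      using tile by (simp add: two_digit_tile_def)
    show "\<phi>1 \<in> L2"
      by (rule orthogonalization_L2[OF phi'])
    show "l2_inner (shifts \<phi>1 j) (shifts \<phi>1 k) = (if j = k then 1 else 0)" for j k
      by (rule orthogonalization_orthonormal[OF phi'])
    show "AE x in lborel. cnj (\<phi>1 x) = \<phi>1 x"
      by (rule orthogonalization_AE_real[OF phi'])
  qed (fact c sigma)+
  obtain \<psi> where "has_l2_sum (\<lambda>k x. \<sigma> k * c k * b (w0 - k) x) \<psi>"
    using wavelet_exists by blast
  then show ?thesis
    using wavelet by (auto simp: b_def[abs_def])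
qed

text \<open>Two digits mean that the quotient of the lattice by the image \<open>R\<close> has order
  two; \<sigma> is its nontrivial character, and the nonzero digit serves as
  \<open>w0\<close>.\<close>

lemma lattice_character:
  assumes "two_digit_tile M D"
  obtains \<sigma> :: "int^'d \<Rightarrow> complex" and w0
  where "\<And>k. \<sigma> k \<in> {1, -1}" "\<And>j k. \<sigma> (j + k) = \<sigma> j * \<sigma> k"
    "\<And>k. \<sigma> k = 1 \<longleftrightarrow> k \<in> range ((*v) M)" "\<sigma> w0 = -1"
proof -
  interpret two_digit M D
    by unfold_locales (rule assms)
  obtain e where D: "D = {0, e}" "e \<noteq> 0"
    by (rule digits)
  define R where "R = range ((*v) M)"
  have ex1: "\<exists>!r. r \<in> D \<and> k - r \<in> R" for k
    using assms by (auto simp: two_digit_tile_def digit_set_def R_def image_iff)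
  have add: "j + k \<in> R" if "j \<in> R" "k \<in> R" for j k
    using that unfolding R_def by (auto simp flip: matrix_vector_right_distrib)
  have diff: "j - k \<in> R" if "j \<in> R" "k \<in> R" for j k
    using that unfolding R_def by (auto simp flip: matrix_vector_mult_diff_distrib)
  have zero: "0 \<in> R"
    unfolding R_def by (rule image_eqI[of _ _ 0]) auto
  have e: "e \<notin> R"
  proof
    assume "e \<in> R"
    then have "0 \<in> D \<and> e - 0 \<in> R" "e \<in> D \<and> e - e \<in> R"
      using zero D(1) by simp_all
    then show False
      using ex1[of e] D(2) by blast
  qed
  have shift: "k - e \<in> R" if "k \<notin> R" for k
  proof -
    obtain r where "r \<in> D" "k - r \<in> R"
      using ex1[of k] by blast
    with that D(1) show ?thesis
      by (cases "r = 0") simp_all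
  qed
  have two_e: "e + e \<in> R"
    using shift[of "e + e"] e by auto
  \<comment> \<open>Written as (j - e) + (k - e) + (e + e), with all three summands in
    \<open>R\<close>.\<close>
  have both: "j + k \<in> R" if "j \<notin> R" "k \<notin> R" for j k
    using add[OF add[OF shift[OF that(1)] shift[OF that(2)]] two_e] by (simp add: algebra_simps)
  have one: "j + k \<notin> R" if "j \<in> R" "k \<notin> R" for j k
    using diff[of "j + k" j] that by auto
  have one': "j + k \<notin> R" if "j \<notin> R" "k \<in> R" for j k
    using one[OF that(2,1)] by (simp add: add.commute)
  show ?thesis
  proof (rule that[of "\<lambda>k. if k \<in> R then 1 else -1" e])
    show "(if j + k \<in> R then 1 else -1) = (if j \<in> R then 1 else -1) * (if k \<in> R then 1 else - 1 :: complex)" for j k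
      by (cases "j \<in> R"; cases "k \<in> R") (simp_all add: add both one one')
  qed (use e in \<open>auto simp: R_def\<close>)
qed

section \<open>Parity characters of the planar matrices\<close>

lemma minus_one_powi: "(-1 :: complex) powi n = (if even n then 1 else -1)"
  by (auto simp: power_int_minus_left)

lemma rvec_vector2: "rvec (vector [a, b] :: int^2) = vector [of_int a, of_int b]"
  by (simp add: rvec_def vec_eq_iff forall_2)

text \<open>The columns (1,1) and (-2,0) generate the vectors whose coordinates have equal parity;
  the witness solves x - 2y = k1, x = k2.\<close>

lemma bear_range: "k \<in> range ((*v) bear) \<longleftrightarrow> even (k $ 2 - k $ 1)"
proof
  assume "even (k $ 2 - k $ 1)"
  then obtain m where "k $ 2 - k $ 1 = 2 * m"
    by (rule evenE)
  then have "k = bear *v vector [k $ 2, m]"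
    by (simp add: bear_def vec_eq_iff forall_2 matrix_vector_mult_def sum_2)
  then show "k \<in> range ((*v) bear)"
    by blast
qed (auto simp: bear_def matrix_vector_mult_def sum_2)

text \<open>The columns are (0,1) and (-2,0), so only the first coordinate is constrained.\<close>

lemma square_range: "k \<in> range ((*v) square) \<longleftrightarrow> even (k $ 1)"
proof
  assume "even (k $ 1)"
  then obtain m where "k $ 1 = 2 * m"
    by (rule evenE)
  then have "k = square *v vector [k $ 2, - m]"
    by (simp add: square_def vec_eq_iff forall_2 matrix_vector_mult_def sum_2)
  then show "k \<in> range ((*v) square)"
    by blast
qed (auto simp: square_def matrix_vector_mult_def sum_2)

text \<open>The columns (1,-1) and (1,1) generate the same lattice as for the Bear; the witness
  solves x + y = k1, y - x = k2.\<close>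

lemma dragon_range: "k \<in> range ((*v) dragon) \<longleftrightarrow> even (k $ 2 - k $ 1)"
proof
  assume "even (k $ 2 - k $ 1)"
  then obtain m where "k $ 2 - k $ 1 = 2 * m"
    by (rule evenE)
  then have "k = dragon *v vector [- m, k $ 1 + m]"
    by (simp add: dragon_def vec_eq_iff forall_2 matrix_vector_mult_def sum_2)
  then show "k \<in> range ((*v) dragon)"
    by blast
qed (auto simp: dragon_def matrix_vector_mult_def sum_2)

text \<open>The character is (-1) to the power of an additive form \<open>h\<close> that is even
  exactly on the image of \<open>M\<close>; the vector with entries \<open>p\<close> and
  \<open>q\<close> plays the part of \<open>w0\<close>, and its subtraction of \<open>k\<close>
  becomes the \<open>+ rvec k\<close> of the explicit formulas.\<close>

lemma planar_wavelet:
  fixes M :: "int^2^2"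
  assumes tile: "two_digit_tile M D"
    and phi: "is_orthogonalization (tile_bspline (tile_set M D) n) \<phi>1"
    and c: "refinement_coeffs M \<phi>1 c"
    and h: "\<And>j k. h (j + k) = h j + h k" "\<And>k. k \<in> range ((*v) M) \<longleftrightarrow> even (h k)" "odd (h (vector [p, q]))"
  shows "\<exists>\<psi>. has_l2_sum (\<lambda>k x. c k * (-1) powi (h k) *
    \<phi>1 (rmat M *v x + rvec k - vector [of_int p, of_int q])) \<psi> \<and> is_wavelet M \<phi>1 \<psi>"
proof -
  have "\<exists>\<psi>. has_l2_sum (\<lambda>k x. (-1) powi (h k) * c k * \<phi>1 (rmat M *v x - rvec (vector [p, q] - k))) \<psi>
      \<and> is_wavelet M \<phi>1 \<psi>"
    by (rule alternating_wavelet[OF tile phi c]) (auto simp: minus_one_powi h)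
  moreover have "rmat M *v x - rvec (vector [p, q] - k) = rmat M *v x + rvec k - vector [of_int p, of_int q]" for x k
    by (simp add: rvec_diff rvec_vector2)
  ultimately show ?thesis
    by (simp add: mult.commute[of "c _"])
qed

theorem theorem3:
  shows
    "(\<forall>(M::int^'d^'d) D n \<phi>1 c.
        two_digit_tile M D \<and> is_orthogonalization (tile_bspline (tile_set M D) n) \<phi>1 \<and>
        refinement_coeffs M \<phi>1 c \<longrightarrow>
        (\<exists>\<psi> (\<epsilon>::int^'d \<Rightarrow> complex) (w::int^'d \<Rightarrow> int^'d).
           (\<forall>k. \<epsilon> k \<in> {1, -1}) \<and> inj w \<and>
           has_l2_sum (\<lambda>k x. \<epsilon> k * c k * \<phi>1 (rmat M *v x - rvec (w k))) \<psi> \<and>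
           is_wavelet M \<phi>1 \<psi>))
     \<and>
     (\<forall>(M::int^2^2) D n \<phi>1 c.
        D = {vector [0, 0], vector [1, 0]} \<and>
        two_digit_tile M D \<and> is_orthogonalization (tile_bspline (tile_set M D) n) \<phi>1 \<and>
        refinement_coeffs M \<phi>1 c \<longrightarrow>
        (M = bear \<longrightarrow> (\<exists>\<psi>B.
           has_l2_sum (\<lambda>k x. c k * (-1) powi (k $ 2 - k $ 1) *
             \<phi>1 (rmat M *v x + rvec k - vector [0, 1])) \<psi>B \<and>
           is_wavelet M \<phi>1 \<psi>B)) \<and>
        (M = square \<longrightarrow> (\<exists>\<psi>S.
           has_l2_sum (\<lambda>k x. c k * (-1) powi (k $ 1) *
             \<phi>1 (rmat M *v x + rvec k - vector [1, 0])) \<psi>S \<and>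
           is_wavelet M \<phi>1 \<psi>S)) \<and>
        (M = dragon \<longrightarrow> (\<exists>\<psi>D.
           has_l2_sum (\<lambda>k x. c k * (-1) powi (k $ 2 - k $ 1) *
             \<phi>1 (rmat M *v x + rvec k - vector [0, 1])) \<psi>D \<and>
           is_wavelet M \<phi>1 \<psi>D)))"
proof (intro conjI allI impI; elim conjE)
  fix M :: "int^'d^'d" and D n \<phi>1 c
  assume tile: "two_digit_tile M D"
    and phi: "is_orthogonalization (tile_bspline (tile_set M D) n) \<phi>1" and c: "refinement_coeffs M \<phi>1 c"
  obtain \<sigma> :: "int^'d \<Rightarrow> complex" and w0 where sigma: "\<And>k. \<sigma> k \<in> {1, -1}" "\<And>j k. \<sigma> (j + k) = \<sigma> j * \<sigma> k"
    "\<And>k. \<sigma> k = 1 \<longleftrightarrow> k \<in> range ((*v) M)" "\<sigma> w0 = -1"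
    using lattice_character[OF tile] by blast
  obtain \<psi> where psi: "has_l2_sum (\<lambda>k x. \<sigma> k * c k * \<phi>1 (rmat M *v x - rvec (w0 - k))) \<psi>" "is_wavelet M \<phi>1 \<psi>"
    using alternating_wavelet[OF tile phi c sigma] by blast
  have "inj (\<lambda>k. w0 - k)"
    by (auto simp: inj_def)
  with sigma(1) psi show "\<exists>\<psi> (\<epsilon>::int^'d \<Rightarrow> complex) (w::int^'d \<Rightarrow> int^'d).
      (\<forall>k. \<epsilon> k \<in> {1, -1}) \<and> inj w \<and>
      has_l2_sum (\<lambda>k x. \<epsilon> k * c k * \<phi>1 (rmat M *v x - rvec (w k))) \<psi> \<and> is_wavelet M \<phi>1 \<psi>"
    by (intro exI[of _ \<psi>] exI[of _ \<sigma>] exI[of _ "\<lambda>k. w0 - k"]) blast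
next
  fix M :: "int^2^2" and D n \<phi>1 c
  assume tile: "two_digit_tile M D"
    and phi: "is_orthogonalization (tile_bspline (tile_set M D) n) \<phi>1" and c: "refinement_coeffs M \<phi>1 c"
  note wavelet = planar_wavelet[OF tile phi c]
  show "\<exists>\<psi>B. has_l2_sum (\<lambda>k x. c k * (-1) powi (k $ 2 - k $ 1) *
      \<phi>1 (rmat M *v x + rvec k - vector [0, 1])) \<psi>B \<and> is_wavelet M \<phi>1 \<psi>B" if "M = bear"
    using wavelet[of "\<lambda>k. k $ 2 - k $ 1" 0 1] that by (simp add: bear_range)
  show "\<exists>\<psi>S. has_l2_sum (\<lambda>k x. c k * (-1) powi (k $ 1) *
      \<phi>1 (rmat M *v x + rvec k - vector [1, 0])) \<psi>S \<and> is_wavelet M \<phi>1 \<psi>S" if "M = square"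
    using wavelet[of "\<lambda>k. k $ 1" 1 0] that by (simp add: square_range)
  show "\<exists>\<psi>D. has_l2_sum (\<lambda>k x. c k * (-1) powi (k $ 2 - k $ 1) *
      \<phi>1 (rmat M *v x + rvec k - vector [0, 1])) \<psi>D \<and> is_wavelet M \<phi>1 \<psi>D" if "M = dragon"
    using wavelet[of "\<lambda>k. k $ 2 - k $ 1" 0 1] that by (simp add: dragon_range)
qed

end
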